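(* Let $q, q_0 \in L^1_{\mathbb{R}}(0,\pi)$ be real-valued potentials, let $\alpha_0, \beta, \beta_0 \in (0,\pi)$, and suppose that $q' \in L^2_{\mathbb{R}}(0,\pi)$ (i.e. $q$ is absolutely continuous on $[0,\pi]$ with derivative in $L^2_{\mathbb{R}}(0,\pi)$). If for all integers $n \geq 0$ $$\mu_n(q, \alpha_0, \beta) = \mu_n(q_0, \alpha_0, \beta_0) \quad\text{and}\quad a_n(q, \alpha_0, \beta) \geq a_n(q_0, \alpha_0, \beta_0),$$ then $\beta = \beta_0$ and $q = q_0$ (almost everywhere) on $(0,\pi)$.
   Context: For a real-valued $q \in L^1_{\mathbb{R}}(0,\pi)$ (subscript $\mathbb{R}$ means real-valued) and $\alpha,\beta \in (0,\pi)$, let $L(q,\alpha,\beta)$ denote the Sturm-Liouville boundary value problem $$-y''+q(x)y=\mu y,\quad x\in(0,\pi),\ \mu\in\mathbb{C},$$ $$y(0)\cot\alpha+y'(0)=0,\qquad y(\pi)\cot\beta+y'(\pi)=0.$$ Solutions are understood in the usual sense ($y, y'$ absolutely continuous on $[0,\pi]$, equation satisfied almost everywhere). The spectrum of this problem is discrete and consists of real simple eigenvalues, enumerated increasingly as $\mu_0(q,\alpha,\beta)<\mu_1(q,\alpha,\beta)<\dots<\mu_n(q,\alpha,\beta)<\cdots$, $n\ge 0$. Let $\varphi(x,\mu)$ be the solution of $-y''+q(x)y=\mu y$ with $\varphi(0,\mu)=1$, $\varphi'(0,\mu)=-\cot\alpha$. Then $\varphi(x,\mu_n)$ is an eigenfunction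 for $\mu_n=\mu_n(q,\alpha,\beta)$, and the norming constants are $$a_n(q,\alpha,\beta)=\int_0^\pi|\varphi(x,\mu_n)|^2\,dx,\quad n\ge0.$$ *)

theory Defs
  imports "HOL-Analysis.Analysis"
begin

definition abs_cont_on :: "real \<Rightarrow> real \<Rightarrow> (real \<Rightarrow> 'a::real_normed_vector) \<Rightarrow> bool" where
  "abs_cont_on s t f \<longleftrightarrow>
     (\<forall>\<epsilon>>0. \<exists>\<delta>>0. \<forall>(n::nat) (a::nat \<Rightarrow> real) (b::nat \<Rightarrow> real).
        (\<forall>i<n. s \<le> a i \<and> a i \<le> b i \<and> b i \<le> t) \<longrightarrow>
        disjoint_family_on (\<lambda>i. {a i<..<b i}) {..<n} \<longrightarrow>
        (\<Sum>i<n. b i - a i) < \<delta> \<longrightarrow>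
        (\<Sum>i<n. norm (f (b i) - f (a i))) < \<epsilon>)"

definition L1_potential :: "(real \<Rightarrow> real) \<Rightarrow> bool" where
  "L1_potential q \<longleftrightarrow> q absolutely_integrable_on {0<..<pi}"

definition L2_on :: "(real \<Rightarrow> real) \<Rightarrow> real set \<Rightarrow> bool" where
  "L2_on g S \<longleftrightarrow>
     g \<in> borel_measurable (lebesgue_on S) \<and> (\<lambda>x. (g x)\<^sup>2) absolutely_integrable_on S"

text \<open>The condition that the derivative of q lies in L2. Elements of L1 are classes modulo
  null sets, so it is required of some representative Q that is absolutely continuous on the
  closed interval.\<close>

definition L2_derivative :: "(real \<Rightarrow> real) \<Rightarrow> bool" where
  "L2_derivative q \<longleftrightarrow>
     (\<exists>Q g. (AE x in lebesgue. x \<in> {0<..<pi} \<longrightarrow> Q x = q x) \<and>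
            abs_cont_on 0 pi Q \<and>
            (AE x in lebesgue. x \<in> {0<..<pi} \<longrightarrow> (Q has_real_derivative g x) (at x)) \<and>
            L2_on g {0<..<pi})"

text \<open>y is a solution with first derivative y'; at the endpoints the derivative is one-sided.\<close>

definition SL_solution ::
  "(real \<Rightarrow> real) \<Rightarrow> complex \<Rightarrow> (real \<Rightarrow> complex) \<Rightarrow> (real \<Rightarrow> complex) \<Rightarrow> bool" where
  "SL_solution q \<mu> y y' \<longleftrightarrow>
     abs_cont_on 0 pi y \<and> abs_cont_on 0 pi y' \<and>
     (\<forall>x\<in>{0..pi}. (y has_vector_derivative y' x) (at x within {0..pi})) \<and>
     (AE x in lebesgue. x \<in> {0<..<pi} \<longrightarrow>
        (\<exists>y''. (y' has_vector_derivative y'') (at x) \<and>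
               - y'' + of_real (q x) * y x = \<mu> * y x))"

definition SL_spectrum :: "(real \<Rightarrow> real) \<Rightarrow> real \<Rightarrow> real \<Rightarrow> complex set" where
  "SL_spectrum q \<alpha> \<beta> =
     {\<mu>. \<exists>y y'. SL_solution q \<mu> y y' \<and> (\<exists>x\<in>{0..pi}. y x \<noteq> 0) \<and>
               y 0 * of_real (cot \<alpha>) + y' 0 = 0 \<and>
               y pi * of_real (cot \<beta>) + y' pi = 0}"

text \<open>The eigenvalues as the increasing enumeration, from index 0, of the whole (a priori
  complex) spectrum; such an enumeration is unique.\<close>

definition SL_eigenvalue :: "(real \<Rightarrow> real) \<Rightarrow> real \<Rightarrow> real \<Rightarrow> nat \<Rightarrow> real" where
  "SL_eigenvalue q \<alpha> \<beta> =
     (THE e. strict_mono e \<and> range (\<lambda>n. complex_of_real (e n)) = SL_spectrum q \<alpha> \<beta>)"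

text \<open>The initial value problem determines the solution on [0, pi] only, so uniqueness is
  imposed pointwise on its value at x; values at x outside [0, pi] are irrelevant.\<close>

definition SL_phi :: "(real \<Rightarrow> real) \<Rightarrow> real \<Rightarrow> complex \<Rightarrow> real \<Rightarrow> complex" where
  "SL_phi q \<alpha> \<mu> x =
     (THE v. \<exists>y y'. SL_solution q \<mu> y y' \<and> y 0 = 1 \<and> y' 0 = - of_real (cot \<alpha>) \<and> v = y x)"

definition SL_norming :: "(real \<Rightarrow> real) \<Rightarrow> real \<Rightarrow> real \<Rightarrow> nat \<Rightarrow> real" where
  "SL_norming q \<alpha> \<beta> n =
     integral {0..pi} (\<lambda>x. (cmod (SL_phi q \<alpha> (of_real (SL_eigenvalue q \<alpha> \<beta> n)) x))\<^sup>2)"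

end

theory Submission
  imports Defs "HOL-Complex_Analysis.Complex_Analysis"
begin

text \<open>
  The Weyl function \<open>M = - Eta / Delta\<close> at the left endpoint is meromorphic with a simple pole of residue
  \<open>1 / a\<^sub>n\<close> at each eigenvalue. For two problems with the same \<open>\<alpha>\<close>, the Lagrange identity for the
  Weyl solutions gives \<open>M - M\<^sub>0 = o(1 / \<bar>\<mu>\<bar>)\<close> off a parabola around the positive axis. Integrating
  \<open>M - M\<^sub>0\<close> over large circles, with a weight vanishing at the real points of the circle, shows that
  weighted sums of \<open>1 / a\<^sub>n - 1 / a\<^sub>n\<^sup>0\<close> tend to 0. These terms have one sign, so all norming constants
  agree, and the same contour argument yields \<open>M = M\<^sub>0\<close>. Then the entire function
  \<open>phi theta\<^sub>0 - theta phi\<^sub>0\<close> tends to 0 at infinity, hence vanishes, and this forces \<open>q = q\<^sub>0\<close>.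
\<close>

text \<open>The obstacle is the neighbourhood of the positive axis, where both Weyl functions have
  their poles. No asymptotics of eigenvalues enter. Self-adjointness replaces them: the Lagrange
  identity of a solution with its conjugate bounds \<open>|Im mu| * |M|\<close> by a multiple of
  \<open>sqrt |mu|\<close> inside any parabola \<open>|Im k| <= K\<close>, where
  \<open>k^2 = mu\<close>. This holds on every large circle wherever the eigenvalues lie, and a
  weight with zeros of order three at the two real points of the circle absorbs it. A radius only
  has to avoid the moduli of the eigenvalues.

  The common left boundary condition matters for the rate: with different \<open>h\<close> the
  difference of the Weyl functions would contain a term of exact order \<open>1 / |mu|\<close>, and
  the circle integrals would keep a nonzero limit.

  Potentials are merely integrable, so second derivatives exist only almost everywhere. This is why
  the calculus of solutions is built on absolute continuity in its epsilon-delta form.\<close>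

lemmas HK_int_add = Henstock_Kurzweil_Integration.integral_add
lemmas HK_int_combine = Henstock_Kurzweil_Integration.integral_combine
lemmas HK_int_cong = Henstock_Kurzweil_Integration.integral_cong
lemmas HK_int_diff = Henstock_Kurzweil_Integration.integral_diff
lemmas HK_int_le = Henstock_Kurzweil_Integration.integral_le
lemmas HK_int_nonneg = Henstock_Kurzweil_Integration.integral_nonneg
lemmas HK_norm_bound = Henstock_Kurzweil_Integration.integral_norm_bound_integral

section \<open>Absolutely continuous functions\<close>

text \<open>Carrying the almost everywhere derivative as an explicit function lets the product rule,
  the fundamental theorem and Gronwall compose as rules. Integrability of \<open>f'\<close> is not
  part of the notion: it comes out of \<open>ac_derivative_has_integral\<close>.\<close>

definition ac_derivative ::
  "real \<Rightarrow> real \<Rightarrow> (real \<Rightarrow> 'a::real_normed_vector) \<Rightarrow> (real \<Rightarrow> 'a) \<Rightarrow> bool" where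
  "ac_derivative s t f f' \<longleftrightarrow> abs_cont_on s t f \<and>
     (AE x\<in>{s<..<t} in lebesgue. (f has_vector_derivative f' x) (at x))"

definition small_increments ::
  "real \<Rightarrow> real \<Rightarrow> (real \<Rightarrow> 'a::real_normed_vector) \<Rightarrow> real \<Rightarrow> real \<Rightarrow> bool" where
  "small_increments s t f \<delta> \<epsilon> \<longleftrightarrow>
     (\<forall>(n::nat) a b. (\<forall>i<n. s \<le> a i \<and> a i \<le> b i \<and> b i \<le> t) \<longrightarrow>
        disjoint_family_on (\<lambda>i. {a i<..<b i}) {..<n} \<longrightarrow>
        (\<Sum>i<n. b i - a i) < \<delta> \<longrightarrow> (\<Sum>i<n. norm (f (b i) - f (a i))) < \<epsilon>)"

lemma small_incrementsD:
  assumes "small_increments s t f \<delta> \<epsilon>" "\<forall>i<n. s \<le> a i \<and> a i \<le> b i \<and> b i \<le> t"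
    and "disjoint_family_on (\<lambda>i. {a i<..<b i}) {..<n::nat}" "(\<Sum>i<n. b i - a i) < \<delta>"
  shows "(\<Sum>i<n. norm (f (b i) - f (a i))) < \<epsilon>"
  using assms unfolding small_increments_def by blast

lemma abs_cont_on_altdef: "abs_cont_on s t f \<longleftrightarrow> (\<forall>\<epsilon>>0. \<exists>\<delta>>0. small_increments s t f \<delta> \<epsilon>)"
  unfolding abs_cont_on_def small_increments_def ..

text \<open>Arbitrary finite index sets replace initial segments of the naturals because the
  intervals of a tagged division are indexed by their (tag, interval) pairs.\<close>

lemma abs_cont_on_finite:
  fixes f :: "real \<Rightarrow> 'a::real_normed_vector"
  assumes "abs_cont_on s t f" "\<epsilon> > 0"
  obtains \<delta> where "\<delta> > 0"
    "\<And>(I::'i set) a b. \<lbrakk>finite I; \<And>i. i \<in> I \<Longrightarrow> s \<le> a i \<and> a i \<le> b i \<and> b i \<le> t;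
       disjoint_family_on (\<lambda>i. {a i<..<b i}) I; (\<Sum>i\<in>I. b i - a i) < \<delta>\<rbrakk>
      \<Longrightarrow> (\<Sum>i\<in>I. norm (f (b i) - f (a i))) < \<epsilon>"
proof -
  obtain \<delta> where \<delta>: "\<delta> > 0" and small: "small_increments s t f \<delta> \<epsilon>"
    using assms unfolding abs_cont_on_altdef by blast
  show thesis
  proof (rule that[OF \<delta>])
    fix I :: "'i set" and a b
    assume I: "finite I" "\<And>i. i \<in> I \<Longrightarrow> s \<le> a i \<and> a i \<le> b i \<and> b i \<le> t"
       "disjoint_family_on (\<lambda>i. {a i<..<b i}) I" "(\<Sum>i\<in>I. b i - a i) < \<delta>"
    obtain h where h: "bij_betw h {..<card I} I"
      using ex_bij_betw_nat_finite[OF I(1)] by (metis atLeast0LessThan)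
    have "(\<Sum>i<card I. norm (f ((b \<circ> h) i) - f ((a \<circ> h) i))) < \<epsilon>"
    proof (rule small_incrementsD[OF small])
      show "\<forall>i<card I. s \<le> (a \<circ> h) i \<and> (a \<circ> h) i \<le> (b \<circ> h) i \<and> (b \<circ> h) i \<le> t"
        using I(2) bij_betwE[OF h] by auto
      show "disjoint_family_on (\<lambda>i. {(a \<circ> h) i<..<(b \<circ> h) i}) {..<card I}"
        unfolding disjoint_family_on_def
      proof (intro ballI impI)
        fix m n assume mn: "m \<in> {..<card I}" "n \<in> {..<card I}" "m \<noteq> n"
        hence "h m \<in> I" "h n \<in> I" "h m \<noteq> h n"
          using h bij_betwE[OF h] by (auto simp: bij_betw_def inj_on_def)
        thus "{(a \<circ> h) m<..<(b \<circ> h) m} \<inter> {(a \<circ> h) n<..<(b \<circ> h) n} = {}"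
          using I(3) unfolding disjoint_family_on_def comp_def by blast
      qed
      show "(\<Sum>i<card I. (b \<circ> h) i - (a \<circ> h) i) < \<delta>"
        using sum.reindex_bij_betw[OF h, of "\<lambda>i. b i - a i"] I(4) by simp
    qed
    thus "(\<Sum>i\<in>I. norm (f (b i) - f (a i))) < \<epsilon>"
      using sum.reindex_bij_betw[OF h, of "\<lambda>i. norm (f (b i) - f (a i))"] by simp
  qed
qed

section \<open>The fundamental theorem of calculus for absolutely continuous functions\<close>

lemma sum_length_le_measure:
  fixes a b :: "'i \<Rightarrow> real"
  assumes "finite I" "\<And>i. i \<in> I \<Longrightarrow> a i \<le> b i"
    and "disjoint_family_on (\<lambda>i. {a i<..<b i}) I"
    and "\<And>i. i \<in> I \<Longrightarrow> {a i<..<b i} \<subseteq> U" "U \<in> lmeasurable"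
  shows "(\<Sum>i\<in>I. b i - a i) \<le> measure lebesgue U"
proof -
  have "(\<Sum>i\<in>I. b i - a i) = (\<Sum>i\<in>I. measure lebesgue {a i<..<b i})"
    using assms(2) by (intro sum.cong) auto
  also have "\<dots> = measure lebesgue (\<Union>i\<in>I. {a i<..<b i})"
    using assms(1,2,3) by (intro measure_finite_Union[symmetric]) auto
  also have "\<dots> \<le> measure lebesgue U"
    using assms by (intro measure_mono_fmeasurable) (auto intro!: sets.finite_UN)
  finally show ?thesis .
qed

lemma AE_lebesgue_negligibleE:
  assumes "AE x in lebesgue. P x"
  obtains N where "negligible N" "\<And>x. x \<notin> N \<Longrightarrow> P x"
proof -
  obtain N where N: "{x. \<not> P x} \<subseteq> N" "N \<in> null_sets lebesgue"
    using assms by (auto simp: eventually_ae_filter)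
  show ?thesis by (rule that[of N]) (use N in \<open>auto simp: negligible_iff_null_sets\<close>)
qed

text \<open>A gauge is built directly. The exceptional null set \<open>E\<close> lies in an open
  \<open>U\<close> of measure below \<delta>. A tag in \<open>E\<close> forces its interval into
  \<open>U\<close>, where the Riemann term is 0 and absolute continuity makes the increments of
  \<open>f\<close> small. Every other tag gets the radius from differentiability, so its Riemann
  term matches the increment up to \<open>e'\<close> times the length.\<close>

lemma ac_derivative_has_integral:
  fixes f :: "real \<Rightarrow> 'a::euclidean_space"
  assumes f: "ac_derivative a b f f'" and ab: "a \<le> b"
  shows "(f' has_integral (f b - f a)) {a..b}"
proof -
  obtain N where N: "negligible N"
    "\<And>x. x \<notin> N \<Longrightarrow> x \<in> {a<..<b} \<Longrightarrow> (f has_vector_derivative f' x) (at x)"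
    using f AE_lebesgue_negligibleE unfolding ac_derivative_def by (metis (no_types, lifting))
  have acf: "abs_cont_on a b f" using f unfolding ac_derivative_def by blast
  define E where "E = N \<union> {a, b}"
  define g where "g x = (if x \<in> E then 0 else f' x)" for x
  have E: "negligible E" using N by (simp add: E_def negligible_insert negligible_Un)
  have der: "(f has_vector_derivative g x) (at x)" if "x \<in> {a..b} - E" for x
  proof -
    have "x \<notin> N" "x \<in> {a<..<b}" using that by (auto simp: E_def)
    thus ?thesis using N(2) that by (simp add: g_def)
  qed
  have "(g has_integral (f b - f a)) (cbox a b)"
    unfolding has_integral
  proof (intro allI impI)
    fix e :: real assume "e > 0"
    \<comment> \<open>The summand 1 in the denominator covers the degenerate interval
      \<open>a = b\<close> and makes the later inequality strict.\<close>
    define e' where "e' = e / (2 * (b - a + 1))"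
    have e': "e' > 0" "e' * (b - a) < e / 2" using \<open>e > 0\<close> ab by (auto simp: e'_def field_simps)
    obtain \<delta> where \<delta>: "\<delta> > 0"
    "\<And>(I::(real \<times> real set) set) u v. \<lbrakk>finite I; \<And>i. i \<in> I \<Longrightarrow> a \<le> u i \<and> u i \<le> v i \<and> v i \<le> b;
       disjoint_family_on (\<lambda>i. {u i<..<v i}) I; (\<Sum>i\<in>I. v i - u i) < \<delta>\<rbrakk>
      \<Longrightarrow> (\<Sum>i\<in>I. norm (f (v i) - f (u i))) < e / 2"
      by (rule abs_cont_on_finite[OF acf, of "e/2"]) (use \<open>e > 0\<close> in simp, erule that, blast)
    have "E \<in> lmeasurable" "measure lebesgue E = 0"
      using E by (auto simp: negligible_imp_measurable negligible_imp_measure0)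
    hence E': "E \<in> lmeasurable" by simp
    obtain U where U: "open U" "E \<subseteq> U" "U \<in> lmeasurable" "measure lebesgue U < \<delta>"
    proof (rule sets_lebesgue_outer_open[of E \<delta>])
      fix T assume T: "open T" "E \<subseteq> T" "T - E \<in> lmeasurable" "emeasure lebesgue (T - E) < ennreal \<delta>"
      have "T = (T - E) \<union> E" using T by auto
      hence "T \<in> lmeasurable" using T(3) \<open>E \<in> lmeasurable\<close> by (metis fmeasurable.Un)
      moreover have "measure lebesgue T = measure lebesgue (T - E)"
        by (rule measure_negligible_symdiff[OF _ negligible_subset[OF E]])
          (use T calculation in auto)
      moreover have "measure lebesgue (T - E) < \<delta>"
        using T(3,4) \<delta>(1) by (simp add: emeasure_eq_measure2 ennreal_less_iff)
      ultimately show thesis using that T by simp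
    qed (use \<open>E \<in> lmeasurable\<close> \<delta>(1) in auto)
    have "\<forall>x. \<exists>r>0. x \<in> {a..b} - E \<longrightarrow> (\<forall>y. norm (y - x) < r \<longrightarrow>
             norm (f y - f x - (y - x) *\<^sub>R g x) \<le> e' * norm (y - x))"
      using der e'(1) unfolding has_vector_derivative_def has_derivative_at_alt
      by (metis zero_less_one)
    then obtain r where r: "\<And>x. r x > 0" "\<And>x y. x \<in> {a..b} - E \<Longrightarrow> norm (y - x) < r x \<Longrightarrow>
             norm (f y - f x - (y - x) *\<^sub>R g x) \<le> e' * norm (y - x)"
      by metis
    define \<gamma> where "\<gamma> x = (if x \<in> E then U else ball x (r x))" for x
    have gau: "gauge \<gamma>" using U r(1) by (auto simp: gauge_def \<gamma>_def)
    have fin: "norm ((\<Sum>(x,K)\<in>\<D>. measure lborel K *\<^sub>R g x) - (f b - f a)) < e"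
      if D: "\<D> tagged_division_of cbox a b" "\<gamma> fine \<D>" for \<D>
    proof -
      have fin: "finite \<D>" using tagged_division_ofD(1)[OF D(1)] .
      have K: "\<exists>u v. u \<le> x \<and> x \<le> v \<and> a \<le> u \<and> v \<le> b \<and> K = {u..v}" if xK: "(x,K) \<in> \<D>" for x K
      proof -
        obtain u v where "K = cbox u v" using tagged_division_ofD(4)[OF D(1) xK] by blast
        moreover have "x \<in> K" "K \<subseteq> cbox a b"
          using tagged_division_ofD(2,3)[OF D(1) xK] by auto
        ultimately show ?thesis by (intro exI[of _ u] exI[of _ v]) auto
      qed
      let ?d = "\<lambda>(x,K). measure lborel K *\<^sub>R g x - (f (Sup K) - f (Inf K))"
      have "(\<Sum>(x,K)\<in>\<D>. f (Sup K) - f (Inf K)) = f b - f a"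
        using additive_tagged_division_1[OF ab, of \<D> f] D(1) by simp
      hence "(\<Sum>(x,K)\<in>\<D>. measure lborel K *\<^sub>R g x) - (f b - f a) = (\<Sum>p\<in>\<D>. ?d p)"
        by (simp add: sum_subtractf split_def)
      also have "\<dots> = (\<Sum>p\<in>{p\<in>\<D>. fst p \<in> E}. ?d p) + (\<Sum>p\<in>{p\<in>\<D>. fst p \<notin> E}. ?d p)"
        using fin by (subst sum.union_disjoint[symmetric]) (auto intro!: sum.cong)
      finally have eq: "(\<Sum>(x,K)\<in>\<D>. measure lborel K *\<^sub>R g x) - (f b - f a) = \<dots>" .
      have "norm (\<Sum>p\<in>{p\<in>\<D>. fst p \<in> E}. ?d p) \<le> (\<Sum>p\<in>{p\<in>\<D>. fst p \<in> E}. norm (f (Sup (snd p)) - f (Inf (snd p))))"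
        by (rule order_trans[OF norm_sum]) (auto intro!: sum_mono simp: g_def norm_minus_commute)
      also have "\<dots> < e / 2"
      proof (rule \<delta>(2))
        let ?I = "{p\<in>\<D>. fst p \<in> E}"
        show "finite ?I" using fin by auto
        show *: "a \<le> Inf (snd p) \<and> Inf (snd p) \<le> Sup (snd p) \<and> Sup (snd p) \<le> b" if "p \<in> ?I" for p
          using K[of "fst p" "snd p"] that by auto
        show **: "disjoint_family_on (\<lambda>p. {Inf (snd p)<..<Sup (snd p)}) ?I"
          unfolding disjoint_family_on_def
        proof (intro ballI impI)
          fix p p' assume p: "p \<in> ?I" "p' \<in> ?I" "p \<noteq> p'"
          have "{Inf (snd p)<..<Sup (snd p)} = interior (snd p)" if "p \<in> ?I" for p
            using K[of "fst p" "snd p"] that by auto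
          moreover have "interior (snd p) \<inter> interior (snd p') = {}"
            using tagged_division_ofD(5)[OF D(1), of "fst p" "snd p" "fst p'" "snd p'"] p by auto
          ultimately show "{Inf (snd p)<..<Sup (snd p)} \<inter> {Inf (snd p')<..<Sup (snd p')} = {}" using p by auto
        qed
        have "(\<Sum>p\<in>?I. Sup (snd p) - Inf (snd p)) \<le> measure lebesgue U"
        proof (rule sum_length_le_measure)
          show "finite ?I" using fin by auto
          show "Inf (snd p) \<le> Sup (snd p)" if "p \<in> ?I" for p using *[OF that] by simp
          show "disjoint_family_on (\<lambda>p. {Inf (snd p)<..<Sup (snd p)}) ?I" by (rule **)
          show "{Inf (snd p)<..<Sup (snd p)} \<subseteq> U" if p: "p \<in> ?I" for p
          proof -
            have "snd p \<subseteq> \<gamma> (fst p)" using fineD[OF D(2), of "fst p" "snd p"] p by simp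
            hence "snd p \<subseteq> U" using p by (auto simp: \<gamma>_def)
            thus ?thesis using K[of "fst p" "snd p"] p by auto
          qed
        qed fact
        thus "(\<Sum>p\<in>?I. Sup (snd p) - Inf (snd p)) < \<delta>" using U by simp
      qed
      finally have 1: "norm (\<Sum>p\<in>{p\<in>\<D>. fst p \<in> E}. ?d p) < e / 2" .
      have "norm (?d p) \<le> e' * measure lborel (snd p)" if p: "p \<in> \<D>" "fst p \<notin> E" for p
      proof -
        obtain x L where xL: "p = (x, L)" by force
        then obtain u v where uv: "u \<le> x" "x \<le> v" "a \<le> u" "v \<le> b" "L = {u..v}" using K p by metis
        have "L \<subseteq> ball x (r x)" using fineD[OF D(2), of x L] p xL by (simp add: \<gamma>_def)
        moreover have "u \<in> L" "v \<in> L" using uv by auto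
        ultimately have "v \<in> ball x (r x)" "u \<in> ball x (r x)" by blast+
        hence "norm (v - x) < r x" "norm (u - x) < r x" by (auto simp: dist_norm)
        moreover have "x \<in> {a..b} - E" using p xL uv by auto
        ultimately have "norm (f v - f x - (v - x) *\<^sub>R g x) \<le> e' * norm (v - x)"
          "norm (f u - f x - (u - x) *\<^sub>R g x) \<le> e' * norm (u - x)" using r(2) by blast+
        hence "norm ((f u - f x - (u - x) *\<^sub>R g x) - (f v - f x - (v - x) *\<^sub>R g x)) \<le> e' * (x - u) + e' * (v - x)"
          using uv by (intro order_trans[OF norm_triangle_ineq4]) auto
        also have "(f u - f x - (u - x) *\<^sub>R g x) - (f v - f x - (v - x) *\<^sub>R g x) = (v - u) *\<^sub>R g x - (f v - f u)"
          by (simp add: algebra_simps)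
        finally show ?thesis using uv xL by (simp add: algebra_simps)
      qed
      hence "norm (\<Sum>p\<in>{p\<in>\<D>. fst p \<notin> E}. ?d p) \<le> (\<Sum>p\<in>{p\<in>\<D>. fst p \<notin> E}. e' * measure lborel (snd p))"
        by (intro order_trans[OF norm_sum] sum_mono) auto
      also have "\<dots> \<le> (\<Sum>p\<in>\<D>. e' * measure lborel (snd p))"
        using fin e'(1) by (intro sum_mono2) (auto intro!: mult_nonneg_nonneg)
      also have "\<dots> = e' * (b - a)"
        using additive_content_tagged_division[OF D(1)] ab by (simp add: sum_distrib_left[symmetric] split_def)
      finally have 2: "norm (\<Sum>p\<in>{p\<in>\<D>. fst p \<notin> E}. ?d p) < e / 2" using e' by simp
      show ?thesis unfolding eq by (rule norm_triangle_lt) (use 1 2 in linarith)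
    qed
    show "\<exists>\<gamma>. gauge \<gamma> \<and> (\<forall>\<D>. \<D> tagged_division_of cbox a b \<and> \<gamma> fine \<D> \<longrightarrow>
        norm ((\<Sum>(x,K)\<in>\<D>. measure lborel K *\<^sub>R g x) - (f b - f a)) < e)"
      by (rule exI[of _ \<gamma>], rule conjI[OF gau], intro allI impI, elim conjE, rule fin)
  qed
  hence "(g has_integral (f b - f a)) {a..b}" by simp
  thus ?thesis by (rule has_integral_spike[OF E, rotated]) (auto simp: g_def)
qed


section \<open>Closure properties of absolutely continuous functions\<close>

lemma abs_cont_on_subset:
  assumes "abs_cont_on s t f" "s \<le> s'" "t' \<le> t"
  shows "abs_cont_on s' t' f"
  unfolding abs_cont_on_altdef
proof (intro allI impI)
  fix \<epsilon> :: real assume "\<epsilon> > 0"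
  then obtain \<delta> where "\<delta> > 0" and \<delta>: "small_increments s t f \<delta> \<epsilon>"
    using assms(1) unfolding abs_cont_on_altdef by blast
  have "small_increments s' t' f \<delta> \<epsilon>"
    unfolding small_increments_def
    by (intro allI impI, rule small_incrementsD[OF \<delta>]) (use assms(2,3) in fastforce)+
  thus "\<exists>\<delta>>0. small_increments s' t' f \<delta> \<epsilon>" using \<open>\<delta> > 0\<close> by blast
qed

lemma ac_derivative_subset:
  assumes "ac_derivative s t f f'" "s \<le> s'" "t' \<le> t"
  shows "ac_derivative s' t' f f'"
proof -
  have "AE x\<in>{s<..<t} in lebesgue. (f has_vector_derivative f' x) (at x)"
    using assms(1) by (simp add: ac_derivative_def)
  hence "AE x\<in>{s'<..<t'} in lebesgue. (f has_vector_derivative f' x) (at x)"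
    by eventually_elim (use assms in auto)
  thus ?thesis using abs_cont_on_subset[of s t f s' t'] assms by (simp add: ac_derivative_def)
qed

text \<open>The single source of absolute continuity for sums, products, linear images and
  compositions: each has increments controlled by those of its ingredients. With one ingredient,
  take \<open>g = f\<close>.\<close>

lemma abs_cont_on_dominated:
  assumes f: "abs_cont_on s t f" and g: "abs_cont_on s t g"
    and le: "\<And>x y. x \<in> {s..t} \<Longrightarrow> y \<in> {s..t} \<Longrightarrow>
      norm (h y - h x) \<le> C * (norm (f y - f x) + norm (g y - g x))"
  shows "abs_cont_on s t h"
  unfolding abs_cont_on_altdef
proof (intro allI impI)
  fix \<epsilon> :: real assume \<epsilon>: "\<epsilon> > 0"
  define e where "e = \<epsilon> / (2 * (\<bar>C\<bar> + 1))"
  have e: "e > 0" using \<epsilon> by (simp add: e_def)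
  have "\<bar>C\<bar> * (e + e) < (\<bar>C\<bar> + 1) * (e + e)" using e by simp
  also have "\<dots> = \<epsilon>" unfolding e_def by (simp add: divide_simps)
  finally have eC: "\<bar>C\<bar> * (e + e) < \<epsilon>" .
  obtain \<delta>1 where "\<delta>1 > 0" and 1: "small_increments s t f \<delta>1 e"
    using f e unfolding abs_cont_on_altdef by blast
  obtain \<delta>2 where "\<delta>2 > 0" and 2: "small_increments s t g \<delta>2 e"
    using g e unfolding abs_cont_on_altdef by blast
  show "\<exists>\<delta>>0. small_increments s t h \<delta> \<epsilon>"
    unfolding small_increments_def
  proof (intro exI[of _ "min \<delta>1 \<delta>2"] conjI allI impI)
    show "min \<delta>1 \<delta>2 > 0" using \<open>\<delta>1 > 0\<close> \<open>\<delta>2 > 0\<close> by simp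
    fix n :: nat and a b :: "nat \<Rightarrow> real"
    assume *: "\<forall>i<n. s \<le> a i \<and> a i \<le> b i \<and> b i \<le> t"
      "disjoint_family_on (\<lambda>i. {a i<..<b i}) {..<n}" "(\<Sum>i<n. b i - a i) < min \<delta>1 \<delta>2"
    let ?F = "\<Sum>i<n. norm (f (b i) - f (a i))" and ?G = "\<Sum>i<n. norm (g (b i) - g (a i))"
    have "?F < e" using small_incrementsD[OF 1 *(1,2)] *(3) by simp
    moreover have "?G < e" using small_incrementsD[OF 2 *(1,2)] *(3) by simp
    moreover have "(\<Sum>i<n. norm (h (b i) - h (a i))) \<le>
        (\<Sum>i<n. \<bar>C\<bar> * (norm (f (b i) - f (a i)) + norm (g (b i) - g (a i))))"
    proof (rule sum_mono)
      fix i assume "i \<in> {..<n}"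
      hence "norm (h (b i) - h (a i)) \<le> C * (norm (f (b i) - f (a i)) + norm (g (b i) - g (a i)))"
        using *(1) by (intro le) auto
      also have "\<dots> \<le> \<bar>C\<bar> * (norm (f (b i) - f (a i)) + norm (g (b i) - g (a i)))"
        by (intro mult_right_mono) auto
      finally show "norm (h (b i) - h (a i)) \<le> \<dots>" .
    qed
    moreover have "\<dots> = \<bar>C\<bar> * (?F + ?G)" by (simp add: sum_distrib_left[symmetric] sum.distrib)
    moreover have "\<bar>C\<bar> * (?F + ?G) \<le> \<bar>C\<bar> * (e + e)"
      using calculation by (intro mult_left_mono) auto
    ultimately show "(\<Sum>i<n. norm (h (b i) - h (a i))) < \<epsilon>" using eC by linarith
  qed
qed

lemma abs_cont_on_id: "abs_cont_on s t (\<lambda>x::real. x)"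
  unfolding abs_cont_on_def by (intro allI impI, rule_tac x=\<epsilon> in exI) auto

lemma abs_cont_on_imp_continuous_on:
  assumes "abs_cont_on s t f"
  shows "continuous_on {s..t} f"
  unfolding continuous_on_iff
proof (intro ballI allI impI)
  fix x e :: real assume x: "x \<in> {s..t}" and "e > 0"
  obtain \<delta> where "\<delta> > 0" and \<delta>: "\<And>(I::unit set) a b. \<lbrakk>finite I; \<And>i. i \<in> I \<Longrightarrow> s \<le> a i \<and> a i \<le> b i \<and> b i \<le> t;
       disjoint_family_on (\<lambda>i. {a i<..<b i}) I; (\<Sum>i\<in>I. b i - a i) < \<delta>\<rbrakk>
      \<Longrightarrow> (\<Sum>i\<in>I. norm (f (b i) - f (a i))) < e"
    by (rule abs_cont_on_finite[OF assms \<open>e > 0\<close>]) (erule that, blast)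
  have "dist (f y) (f x) < e" if y: "y \<in> {s..t}" "dist y x < \<delta>" for y
  proof (cases "x \<le> y")
    case True
    thus ?thesis using \<delta>[of UNIV "\<lambda>_. x" "\<lambda>_. y"] x y
      by (auto simp: dist_norm disjoint_family_on_def)
  next
    case False
    thus ?thesis using \<delta>[of UNIV "\<lambda>_. y" "\<lambda>_. x"] x y
      by (auto simp: dist_norm disjoint_family_on_def norm_minus_commute)
  qed
  thus "\<exists>d>0. \<forall>x'\<in>{s..t}. dist x' x < d \<longrightarrow> dist (f x') (f x) < e"
    using \<open>\<delta> > 0\<close> by blast
qed

lemma ac_derivative_continuous_on:
  "ac_derivative s t f f' \<Longrightarrow> continuous_on {s..t} f"
  by (simp add: ac_derivative_def abs_cont_on_imp_continuous_on)

lemma ac_derivative_cong: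
  assumes "ac_derivative s t f f'" "\<And>x. x \<in> {s..t} \<Longrightarrow> g x = f x"
    and "\<And>x. x \<in> {s<..<t} \<Longrightarrow> g' x = f' x"
  shows "ac_derivative s t g g'"
proof -
  have "AE x\<in>{s<..<t} in lebesgue. (f has_vector_derivative f' x) (at x)"
    using assms(1) by (simp add: ac_derivative_def)
  hence "AE x\<in>{s<..<t} in lebesgue. (g has_vector_derivative g' x) (at x)"
  proof eventually_elim
    case (elim x)
    thus ?case
      using has_vector_derivative_transform_within_open[of f "f' x" x "{s<..<t}" g] assms(2,3) by auto
  qed
  moreover have "abs_cont_on s t g"
    by (rule abs_cont_on_dominated[of s t f f g 1])
      (use assms in \<open>auto simp: ac_derivative_def\<close>)
  ultimately show ?thesis by (simp add: ac_derivative_def)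
qed

text \<open>Kept general because both the complex product (Wronskians) and the real inner product
  (the energy of a solution) are differentiated later.\<close>

lemma ac_derivative_bilinear:
  fixes f :: "real \<Rightarrow> 'a::real_normed_vector" and g :: "real \<Rightarrow> 'b::real_normed_vector"
  assumes "bounded_bilinear bop"
    and f: "ac_derivative s t f f'" and g: "ac_derivative s t g g'"
  shows "ac_derivative s t (\<lambda>x. bop (f x) (g x)) (\<lambda>x. bop (f x) (g' x) + bop (f' x) (g x))"
proof -
  interpret bounded_bilinear bop by fact
  obtain K where K: "K > 0" "\<And>a b. norm (bop a b) \<le> norm a * norm b * K" using pos_bounded by blast
  have "bounded (f ` {s..t})" "bounded (g ` {s..t})"
    using f g by (auto intro!: compact_imp_bounded compact_continuous_image ac_derivative_continuous_on)
  then obtain A B where A: "\<And>x. x \<in> {s..t} \<Longrightarrow> norm (f x) \<le> A" and B: "\<And>x. x \<in> {s..t} \<Longrightarrow> norm (g x) \<le> B"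
    unfolding bounded_iff by (metis imageI)
  have "abs_cont_on s t (\<lambda>x. bop (f x) (g x))"
  proof (rule abs_cont_on_dominated[of s t f g _ "(\<bar>A\<bar> + \<bar>B\<bar>) * K"])
    show "abs_cont_on s t f" "abs_cont_on s t g" using f g by (auto simp: ac_derivative_def)
    fix x y assume xy: "x \<in> {s..t}" "y \<in> {s..t}"
    have "bop (f y) (g y) - bop (f x) (g x) = bop (f y) (g y - g x) + bop (f y - f x) (g x)"
      by (simp add: diff_left diff_right)
    also have "norm \<dots> \<le> norm (f y) * norm (g y - g x) * K + norm (f y - f x) * norm (g x) * K"
      by (intro order_trans[OF norm_triangle_ineq] add_mono K)
    also have "\<dots> \<le> (\<bar>A\<bar> + \<bar>B\<bar>) * norm (g y - g x) * K + norm (f y - f x) * (\<bar>A\<bar> + \<bar>B\<bar>) * K"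
      using A[OF xy(2)] B[OF xy(1)] K(1)
      by (intro add_mono mult_right_mono mult_left_mono) auto
    also have "\<dots> = (\<bar>A\<bar> + \<bar>B\<bar>) * K * (norm (f y - f x) + norm (g y - g x))"
      by (simp add: algebra_simps)
    finally show "norm (bop (f y) (g y) - bop (f x) (g x)) \<le> \<dots>" .
  qed
  moreover have "AE x\<in>{s<..<t} in lebesgue. (f has_vector_derivative f' x) (at x)"
      "AE x\<in>{s<..<t} in lebesgue. (g has_vector_derivative g' x) (at x)"
    using f g by (auto simp: ac_derivative_def)
  hence "AE x\<in>{s<..<t} in lebesgue. ((\<lambda>x. bop (f x) (g x)) has_vector_derivative (bop (f x) (g' x) + bop (f' x) (g x))) (at x)"
    by eventually_elim (auto intro: has_vector_derivative)
  ultimately show ?thesis by (simp add: ac_derivative_def)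
qed

lemmas ac_derivative_mult = ac_derivative_bilinear[OF bounded_bilinear_mult]
lemmas ac_derivative_inner = ac_derivative_bilinear[OF bounded_bilinear_inner]

lemma ac_derivative_add:
  assumes f: "ac_derivative s t f f'" and g: "ac_derivative s t g g'"
  shows "ac_derivative s t (\<lambda>x. f x + g x) (\<lambda>x. f' x + g' x)"
proof -
  have "abs_cont_on s t (\<lambda>x. f x + g x)"
    by (rule abs_cont_on_dominated[of s t f g _ 1])
      (use f g in \<open>auto simp: ac_derivative_def add_diff_add norm_triangle_ineq\<close>)
  moreover have "AE x\<in>{s<..<t} in lebesgue. (f has_vector_derivative f' x) (at x)"
      "AE x\<in>{s<..<t} in lebesgue. (g has_vector_derivative g' x) (at x)"
    using f g by (auto simp: ac_derivative_def)
  hence "AE x\<in>{s<..<t} in lebesgue. ((\<lambda>x. f x + g x) has_vector_derivative (f' x + g' x)) (at x)"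
    by eventually_elim (auto intro: derivative_intros)
  ultimately show ?thesis by (simp add: ac_derivative_def)
qed

lemma ac_derivative_linear:
  assumes "bounded_linear T" and f: "ac_derivative s t f f'"
  shows "ac_derivative s t (\<lambda>x. T (f x)) (\<lambda>x. T (f' x))"
proof -
  interpret bounded_linear T by fact
  obtain K where K: "\<And>x. norm (T x) \<le> norm x * K" using bounded by blast
  have K': "norm (T y - T x) \<le> K * norm (y - x)" for x y using K[of "y - x"] by (simp add: diff mult.commute)
  have "abs_cont_on s t (\<lambda>x. T (f x))"
    by (rule abs_cont_on_dominated[of s t f f _ "\<bar>K\<bar>"])
      (use f in \<open>auto simp: ac_derivative_def intro!: order_trans[OF K'] mult_mono\<close>)
  moreover have "AE x\<in>{s<..<t} in lebesgue. (f has_vector_derivative f' x) (at x)"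
    using f by (auto simp: ac_derivative_def)
  hence "AE x\<in>{s<..<t} in lebesgue. ((\<lambda>x. T (f x)) has_vector_derivative T (f' x)) (at x)"
    by eventually_elim (auto intro: has_vector_derivative)
  ultimately show ?thesis by (simp add: ac_derivative_def)
qed

lemmas ac_derivative_minus = ac_derivative_linear[OF bounded_linear_minus[OF bounded_linear_ident]]

lemma ac_derivative_diff:
  assumes f: "ac_derivative s t f f'" and g: "ac_derivative s t g g'"
  shows "ac_derivative s t (\<lambda>x. f x - g x) (\<lambda>x. f' x - g' x)"
  using ac_derivative_add[OF f ac_derivative_minus[OF g]] by simp

lemma vector_derivative_lipschitz:
  fixes f :: "real \<Rightarrow> 'a::real_normed_vector"
  assumes "\<And>x. (f has_vector_derivative f' x) (at x)" "\<And>x. x \<in> {s..t} \<Longrightarrow> norm (f' x) \<le> B"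
    and "x \<in> {s..t}" "y \<in> {s..t}"
  shows "norm (f y - f x) \<le> B * norm (y - x)"
proof (rule differentiable_bound[of "{s..t}" f "\<lambda>x h. h *\<^sub>R f' x"])
  show "(f has_derivative (\<lambda>h. h *\<^sub>R f' x)) (at x within {s..t})" for x
    using assms(1) by (auto simp: has_vector_derivative_def intro: has_derivative_at_withinI)
  show "onorm (\<lambda>h. h *\<^sub>R f' x) \<le> B" if "x \<in> {s..t}" for x
    using assms(2)[OF that] by (intro onorm_le) (simp add: mult.commute[of "\<bar>_\<bar>"] mult_right_mono)
qed (use assms in auto)

text \<open>A \<open>C^1\<close> function is Lipschitz on the compact range of \<open>f\<close>, and
  Lipschitz images preserve absolute continuity.\<close>

lemma ac_derivative_compose:
  fixes f :: "real \<Rightarrow> real" and F :: "real \<Rightarrow> 'a::real_normed_vector"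
  assumes f: "ac_derivative s t f f'"
    and F: "\<And>x. (F has_vector_derivative F' x) (at x)" and cont: "continuous_on UNIV F'"
  shows "ac_derivative s t (\<lambda>x. F (f x)) (\<lambda>x. f' x *\<^sub>R F' (f x))"
proof -
  have "bounded (f ` {s..t})"
    using f by (auto intro!: compact_imp_bounded compact_continuous_image ac_derivative_continuous_on)
  then obtain C where C: "\<And>x. x \<in> {s..t} \<Longrightarrow> \<bar>f x\<bar> \<le> C" unfolding bounded_iff by (metis imageI real_norm_def)
  have "bounded (F' ` {-C..C})" using cont by (intro compact_imp_bounded compact_continuous_image) (auto intro: continuous_on_subset)
  then obtain B where B: "\<And>x. x \<in> {-C..C} \<Longrightarrow> norm (F' x) \<le> B" unfolding bounded_iff by blast
  have "norm (F y - F x) \<le> B * norm (y - x)" if "x \<in> {-C..C}" "y \<in> {-C..C}" for x y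
    using vector_derivative_lipschitz[OF F B] that by blast
  hence "norm (F (f y) - F (f x)) \<le> B * norm (f y - f x)" if "x \<in> {s..t}" "y \<in> {s..t}" for x y
  proof -
    have "f z \<in> {-C..C}" if "z \<in> {s..t}" for z using C[OF that] by auto
    thus ?thesis using that \<open>\<And>x y. x \<in> {-C..C} \<Longrightarrow> y \<in> {-C..C} \<Longrightarrow> norm (F y - F x) \<le> B * norm (y - x)\<close> by blast
  qed
  moreover have "B * norm (f y - f x) \<le> \<bar>B\<bar> * (norm (f y - f x) + norm (f y - f x))" for x y
    by (intro mult_mono) auto
  ultimately have "norm (F (f y) - F (f x)) \<le> \<bar>B\<bar> * (norm (f y - f x) + norm (f y - f x))" if "x \<in> {s..t}" "y \<in> {s..t}" for x y
    using that order_trans by blast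
  hence "abs_cont_on s t (\<lambda>x. F (f x))"
    using f by (intro abs_cont_on_dominated[of s t f f "\<lambda>x. F (f x)" "\<bar>B\<bar>"]) (simp_all add: ac_derivative_def)
  moreover have "AE x\<in>{s<..<t} in lebesgue. (f has_vector_derivative f' x) (at x)"
    using f by (auto simp: ac_derivative_def)
  hence "AE x\<in>{s<..<t} in lebesgue. ((\<lambda>x. F (f x)) has_vector_derivative (f' x *\<^sub>R F' (f x))) (at x)"
    by eventually_elim (use vector_diff_chain_at[OF _ F] in \<open>auto simp: o_def\<close>)
  ultimately show ?thesis by (simp add: ac_derivative_def)
qed

lemma ac_derivative_C1:
  fixes f :: "real \<Rightarrow> 'a::real_normed_vector"
  assumes "\<And>x. (f has_vector_derivative f' x) (at x)" "continuous_on UNIV f'"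
  shows "ac_derivative s t f f'"
proof -
  have "ac_derivative s t (\<lambda>x. x) (\<lambda>_. 1 :: real)"
    by (simp add: ac_derivative_def abs_cont_on_id)
  from ac_derivative_compose[OF this assms] show ?thesis by simp
qed

section \<open>Indefinite integrals of absolutely integrable functions\<close>

lemma sum_integral_disjoint_le:
  fixes h :: "real \<Rightarrow> real"
  assumes "finite I" "\<And>i. i \<in> I \<Longrightarrow> s \<le> a i \<and> a i \<le> b i \<and> b i \<le> t"
    and disj: "disjoint_family_on (\<lambda>i. {a i<..<b i}) I"
    and h: "h integrable_on {s..t}" "\<And>x. x \<in> {s..t} \<Longrightarrow> 0 \<le> h x"
  shows "(\<Sum>i\<in>I. integral {a i..b i} h) \<le> integral {s..t} h"
proof -
  have "(h has_integral (\<Sum>i\<in>I. integral {a i..b i} h)) (\<Union>i\<in>I. {a i<..<b i})"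
  proof (rule has_integral_UN)
    fix i assume "i \<in> I"
    hence "h integrable_on {a i..b i}"
      using assms(2) h(1) by (intro integrable_on_subinterval[OF h(1)]) auto
    thus "(h has_integral integral {a i..b i} h) {a i<..<b i}"
      using has_integral_Icc_iff_Ioo integrable_integral by blast
  next
    show "pairwise (\<lambda>i i'. negligible ({a i<..<b i} \<inter> {a i'<..<b i'})) I"
      using disj by (auto simp: pairwise_def disjoint_family_on_def)
  qed fact
  thus ?thesis
    by (rule has_integral_subset_le[rotated, OF _ integrable_integral[OF h(1)]])
      (use h(2) assms(2) in fastforce)+
qed

text \<open>Truncation: \<open>norm (g x)\<close> is its minimum with \<open>N\<close> plus the
  excess \<open>h N x\<close>. The excess has integral below \<epsilon>/2 for large \<open>N\<close>
  by dominated convergence, and the truncated part contributes at most \<open>N\<close> times the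
  total length of the intervals.\<close>

lemma abs_cont_on_indefinite_integral:
  fixes g :: "real \<Rightarrow> 'a::euclidean_space"
  assumes g: "g absolutely_integrable_on {s..t}"
  shows "abs_cont_on s t (\<lambda>x. integral {s..x} g)"
  unfolding abs_cont_on_altdef
proof (intro allI impI)
  fix \<epsilon> :: real assume \<epsilon>: "\<epsilon> > 0"
  define h where "h N x = norm (g x) - min (norm (g x)) (real N)" for N x
  have ng: "(\<lambda>x. norm (g x)) absolutely_integrable_on {s..t}"
    using absolutely_integrable_norm[OF g] by (simp add: o_def)
  have hint: "h N absolutely_integrable_on {s..t}" for N
    unfolding h_def using ng
    by (intro set_integral_diff absolutely_integrable_min_1) (auto intro: absolutely_integrable_on_const)
  have lim: "(\<lambda>N. h N x) \<longlonglongrightarrow> 0" for x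
  proof (rule tendsto_eventually)
    obtain N0 :: nat where "norm (g x) \<le> real N0" using real_arch_simple by blast
    thus "eventually (\<lambda>N. h N x = 0) sequentially"
      by (intro eventually_sequentiallyI[of N0]) (auto simp: h_def min_def)
  qed
  have "(\<lambda>N. integral {s..t} (h N)) \<longlonglongrightarrow> integral {s..t} (\<lambda>x. 0)"
  proof (rule dominated_convergence(2)[where h="\<lambda>x. norm (g x)"])
    show "h k integrable_on {s..t}" for k using hint absolutely_integrable_on_def by blast
    show "(\<lambda>x. norm (g x)) integrable_on {s..t}" using g absolutely_integrable_on_def by blast
    show "norm (h k x) \<le> norm (g x)" for k x by (auto simp: h_def)
  qed (rule lim)
  hence "eventually (\<lambda>N. integral {s..t} (h N) < \<epsilon> / 2) sequentially"
    using \<epsilon> by (intro order_tendstoD(2)) auto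
  then obtain N where N: "integral {s..t} (h N) < \<epsilon> / 2" by (meson eventually_happens sequentially_bot)
  show "\<exists>\<delta>>0. small_increments s t (\<lambda>x. integral {s..x} g) \<delta> \<epsilon>"
    unfolding small_increments_def
  proof (intro exI[of _ "\<epsilon> / (2 * (real N + 1))"] conjI allI impI)
    show "\<epsilon> / (2 * (real N + 1)) > 0" using \<epsilon> by simp
    fix n :: nat and a b :: "nat \<Rightarrow> real"
    assume *: "\<forall>i<n. s \<le> a i \<and> a i \<le> b i \<and> b i \<le> t"
      "disjoint_family_on (\<lambda>i. {a i<..<b i}) {..<n}" "(\<Sum>i<n. b i - a i) < \<epsilon> / (2 * (real N + 1))"
    have "norm (integral {s..b i} g - integral {s..a i} g) \<le> integral {a i..b i} (h N) + real N * (b i - a i)"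
      if "i < n" for i
    proof -
      have i: "s \<le> a i" "a i \<le> b i" "b i \<le> t" using * that by auto
      have gi: "g integrable_on {s..b i}" "g integrable_on {a i..b i}"
        using g i by (auto intro!: integrable_on_subinterval[of g "{s..t}"] simp: absolutely_integrable_on_def)
      have hi: "h N integrable_on {a i..b i}"
        using hint[of N] i by (auto intro!: integrable_on_subinterval[of "h N" "{s..t}"] simp: absolutely_integrable_on_def)
      have "integral {s..b i} g - integral {s..a i} g = integral {a i..b i} g"
        using HK_int_combine[of s "a i" "b i" g] i gi by (simp add: algebra_simps)
      also have "norm \<dots> \<le> integral {a i..b i} (\<lambda>x. h N x + real N)"
        by (rule HK_norm_bound)
          (use gi hi in \<open>auto intro!: Henstock_Kurzweil_Integration.integrable_add simp: h_def[abs_def]\<close>)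
      also have "\<dots> = integral {a i..b i} (h N) + real N * (b i - a i)"
        using hi i by (subst HK_int_add) (auto simp: mult.commute)
      finally show ?thesis .
    qed
    hence "(\<Sum>i<n. norm (integral {s..b i} g - integral {s..a i} g)) \<le>
        (\<Sum>i<n. integral {a i..b i} (h N) + real N * (b i - a i))"
      by (intro sum_mono) auto
    also have "\<dots> = (\<Sum>i<n. integral {a i..b i} (h N)) + real N * (\<Sum>i<n. b i - a i)"
      by (simp add: sum.distrib sum_distrib_left)
    also have "(\<Sum>i<n. integral {a i..b i} (h N)) \<le> integral {s..t} (h N)"
      by (rule sum_integral_disjoint_le)
        (use * hint[of N] in \<open>auto simp: absolutely_integrable_on_def h_def\<close>)
    also have "real N * (\<Sum>i<n. b i - a i) \<le> real N * (\<epsilon> / (2 * (real N + 1)))"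
      using *(3) by (intro mult_left_mono) auto
    also have "\<dots> \<le> \<epsilon> / 2" using \<epsilon> by (simp add: field_simps)
    finally show "(\<Sum>i<n. norm (integral {s..b i} g - integral {s..a i} g)) < \<epsilon>" using N by linarith
  qed
qed

text \<open>The differentiation theorem used here speaks of averages over intervals to the right of
  a point. Left averages are right averages of the reflected function, so the exceptional set is
  \<open>N1\<close> together with the reflection of \<open>N2\<close>.\<close>

lemma AE_indefinite_integral_derivative:
  fixes g :: "real \<Rightarrow> 'a::euclidean_space"
  assumes g: "g integrable_on {s..t}"
  shows "AE x\<in>{s<..<t} in lebesgue. ((\<lambda>x. integral {s..x} g) has_vector_derivative g x) (at x)"
proof -
  define G where "G x = (if x \<in> {s..t} then g x else 0)" for x
  have "G integrable_on UNIV"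
    unfolding G_def using g by (subst Henstock_Kurzweil_Integration.integrable_restrict_UNIV)
  hence GI: "G integrable_on cbox u v" for u v by (rule integrable_on_subcbox) simp
  obtain N1 where N1: "negligible N1" "\<And>x e. x \<notin> N1 \<Longrightarrow> 0 < e \<Longrightarrow>
       \<exists>d>0. \<forall>h. 0 < h \<and> h < d \<longrightarrow> norm (integral (cbox x (x + h *\<^sub>R One)) G /\<^sub>R h ^ DIM(real) - G x) < e"
    using integrable_ccontinuous_explicit[OF GI] by blast
  have "(\<lambda>x. G (- x)) integrable_on cbox u v" for u v
    using integrable_reflect[of G "-u" "-v"] GI[of "-v" "-u"] by simp
  then obtain N2 where N2: "negligible N2" "\<And>x e. x \<notin> N2 \<Longrightarrow> 0 < e \<Longrightarrow>
       \<exists>d>0. \<forall>h. 0 < h \<and> h < d \<longrightarrow> norm (integral (cbox x (x + h *\<^sub>R One)) (\<lambda>x. G (- x)) /\<^sub>R h ^ DIM(real) - G (- x)) < e"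
    using integrable_ccontinuous_explicit[of "\<lambda>x. G (- x)"] by blast
  have neg: "negligible (N1 \<union> uminus ` N2)"
    using N1(1) N2(1)
    by (intro negligible_Un negligible_differentiable_image_negligible)
      (auto intro: differentiable_on_minus differentiable_on_id[unfolded id_def] simp: differentiable_on_def)
  have key: "((\<lambda>x. integral {s..x} g) has_vector_derivative g x) (at x)"
    if x: "x \<in> {s<..<t}" "x \<notin> N1 \<union> uminus ` N2" for x
    unfolding has_vector_derivative_def has_derivative_at_alt
  proof (intro conjI allI impI)
    show "bounded_linear (\<lambda>h. h *\<^sub>R g x)" by (rule bounded_linear_scaleR_left)
    fix e :: real assume e: "e > 0"
    have x2: "- x \<notin> N2" using x(2) by (metis UnI2 image_eqI minus_minus)
    obtain d1 where d1: "d1 > 0" "\<And>h. 0 < h \<Longrightarrow> h < d1 \<Longrightarrow> norm (integral {x..x+h} G /\<^sub>R h - G x) < e"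
      using N1(2)[of x e] x e by auto
    obtain d2 where d2: "d2 > 0" "\<And>h. 0 < h \<Longrightarrow> h < d2 \<Longrightarrow> norm (integral {-x..-x+h} (\<lambda>x. G (-x)) /\<^sub>R h - G x) < e"
      using N2(2)[of "-x" e] x2 e by auto
    define d where "d = min (min d1 d2) (min (x - s) (t - x))"
    have "d > 0" using d1 d2 x by (simp add: d_def)
    moreover have "norm (integral {s..y} g - integral {s..x} g - (y - x) *\<^sub>R g x) \<le> e * norm (y - x)"
      if y: "norm (y - x) < d" for y
    proof -
      have yst: "y \<in> {s<..<t}" using y x by (auto simp: d_def abs_less_iff)
      have Gg: "integral {u..v} g = integral {u..v} G" if "s \<le> u" "v \<le> t" for u v
        using that by (intro HK_int_cong) (auto simp: G_def)
      have comb: "integral {s..v} g - integral {s..u} g = integral {u..v} G" if "s \<le> u" "u \<le> v" "v \<le> t" for u v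
        using HK_int_combine[of s u v g] that Gg[of u v]
          integrable_on_subinterval[OF g, of s v] by (auto simp: algebra_simps)
      consider "y = x" | "y > x" | "y < x" by linarith
      thus ?thesis
      proof cases
        case 2
        define h where "h = y - x"
        have h: "0 < h" "h < d1" "y = x + h" using 2 y by (auto simp: h_def d_def)
        have "integral {s..y} g - integral {s..x} g - (y - x) *\<^sub>R g x = h *\<^sub>R (integral {x..x+h} G /\<^sub>R h - G x)"
          using comb[of x y] yst x 2 h by (simp add: algebra_simps G_def)
        thus ?thesis using d1(2)[of h] h
          by (simp add: mult.commute[of e] mult_left_mono)
      next
        case 3
        define h where "h = x - y"
        have h: "0 < h" "h < d2" "y = x - h" using 3 y by (auto simp: h_def d_def)
        have "integral {-x..-x+h} (\<lambda>x. G (-x)) = integral {y..x} G"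
          using Henstock_Kurzweil_Integration.integral_reflect_real[of x y G] unfolding h(3) by (simp add: algebra_simps)
        hence "integral {s..y} g - integral {s..x} g - (y - x) *\<^sub>R g x
            = - (h *\<^sub>R (integral {-x..-x+h} (\<lambda>x. G (-x)) /\<^sub>R h - G x))"
        proof -
          assume I: "integral {-x..-x+h} (\<lambda>x. G (-x)) = integral {y..x} G"
          have 1: "integral {s..y} g - integral {s..x} g = - integral {y..x} G"
            using arg_cong[OF comb[of y x], of uminus] yst x 3 by simp
          have 2: "g x = G x" "y - x = - h" using x h(3) by (auto simp: G_def)
          show ?thesis unfolding I 1 2 using h(1) by (simp add: scaleR_diff_right)
        qed
        thus ?thesis using d2(2)[of h] h
          by (simp add: mult.commute[of e] mult_left_mono)
      qed auto
    qed
    ultimately show "\<exists>d>0. \<forall>y. norm (y - x) < d \<longrightarrow>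
      norm (integral {s..y} g - integral {s..x} g - (y - x) *\<^sub>R g x) \<le> e * norm (y - x)" by blast
  qed
  show ?thesis
    by (rule AE_I'[of "N1 \<union> uminus ` N2"])
      (use neg key in \<open>auto simp: negligible_iff_null_sets\<close>)
qed

lemma ac_derivative_indefinite_integral:
  fixes g :: "real \<Rightarrow> 'a::euclidean_space"
  assumes "g absolutely_integrable_on {s..t}"
  shows "ac_derivative s t (\<lambda>x. integral {s..x} g) g"
  using assms abs_cont_on_indefinite_integral[OF assms] AE_indefinite_integral_derivative[of g s t]
  by (simp add: ac_derivative_def absolutely_integrable_on_def)

section \<open>Mean value and Gronwall inequalities\<close>

lemma ac_derivative_norm_le:
  fixes f :: "real \<Rightarrow> 'a::euclidean_space"
  assumes f: "ac_derivative s t f f'" and st: "s \<le> t"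
    and le: "AE x\<in>{s<..<t} in lebesgue. norm (f' x) \<le> h x" and h: "h integrable_on {s..t}"
  shows "norm (f t - f s) \<le> integral {s..t} h"
proof -
  obtain N where N: "negligible N" "\<And>x. x \<notin> N \<Longrightarrow> x \<in> {s<..<t} \<longrightarrow> norm (f' x) \<le> h x"
    using AE_lebesgue_negligibleE[OF le] by blast
  define E where "E = N \<union> {s, t}"
  have E: "negligible E" using N(1) by (simp add: E_def)
  define f1 h1 where "f1 x = (if x \<in> E then 0 else f' x)" and "h1 x = (if x \<in> E then 0 else h x)" for x
  have "(f1 has_integral (f t - f s)) {s..t}"
    by (rule has_integral_spike[OF E _ ac_derivative_has_integral[OF f st]]) (auto simp: f1_def)
  moreover have "(h1 has_integral (integral {s..t} h)) {s..t}"
    by (rule has_integral_spike[OF E _ integrable_integral[OF h]]) (auto simp: h1_def)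
  moreover have "norm (f1 x) \<le> h1 x" if "x \<in> {s..t}" for x
    using N(2)[of x] that by (auto simp: f1_def h1_def E_def)
  ultimately show ?thesis
    using HK_norm_bound[of f1 "{s..t}" h1]
    by (auto simp: has_integral_iff)
qed

lemma ac_derivative_antimono:
  fixes f :: "real \<Rightarrow> real"
  assumes f: "ac_derivative s t f f'" and st: "s \<le> t"
    and le: "AE x\<in>{s<..<t} in lebesgue. f' x \<le> 0"
  shows "f t \<le> f s"
proof -
  obtain N where N: "negligible N" "\<And>x. x \<notin> N \<Longrightarrow> x \<in> {s<..<t} \<longrightarrow> f' x \<le> 0"
    using AE_lebesgue_negligibleE[OF le] by blast
  define E where "E = N \<union> {s, t}"
  have E: "negligible E" using N(1) by (simp add: E_def)
  have "((\<lambda>x. if x \<in> E then 0 else f' x) has_integral (f t - f s)) {s..t}"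
    by (rule has_integral_spike[OF E _ ac_derivative_has_integral[OF f st]]) auto
  hence "((\<lambda>x. - (if x \<in> E then 0 else f' x)) has_integral (- (f t - f s))) {s..t}"
    by (rule has_integral_neg)
  hence "0 \<le> - (f t - f s)"
    by (rule has_integral_nonneg) (use N(2) in \<open>auto simp: E_def\<close>)
  thus ?thesis by simp
qed

lemma ac_derivative_const: "ac_derivative s t (\<lambda>_. c) (\<lambda>_. 0)"
  by (rule ac_derivative_C1) (auto intro: derivative_intros)

lemma ac_derivative_exp:
  fixes f :: "real \<Rightarrow> real"
  assumes "ac_derivative s t f f'"
  shows "ac_derivative s t (\<lambda>x. exp (f x)) (\<lambda>x. f' x * exp (f x))"
  using ac_derivative_compose[OF assms, of exp exp]
  by (simp add: has_real_derivative_iff_has_vector_derivative[symmetric] DERIV_exp continuous_on_exp)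

lemma gronwall_forward:
  fixes f :: "real \<Rightarrow> real"
  assumes f: "ac_derivative s t f f'" and g: "g absolutely_integrable_on {s..t}" and st: "s \<le> t"
    and le: "AE x\<in>{s<..<t} in lebesgue. f' x \<le> g x * f x"
  shows "f t \<le> f s * exp (integral {s..t} g)"
proof -
  let ?G = "\<lambda>x. integral {s..x} g"
  have "ac_derivative s t (\<lambda>x. exp (- ?G x)) (\<lambda>x. - g x * exp (- ?G x))"
    by (rule ac_derivative_exp[OF ac_derivative_minus[OF ac_derivative_indefinite_integral[OF g]]])
  from ac_derivative_mult[OF f this]
  have d: "ac_derivative s t (\<lambda>x. f x * exp (- ?G x)) (\<lambda>x. f x * (- g x * exp (- ?G x)) + f' x * exp (- ?G x))" .
  have "f t * exp (- ?G t) \<le> f s * exp (- ?G s)"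
  proof (rule ac_derivative_antimono[OF d st])
    show "AE x\<in>{s<..<t} in lebesgue. f x * (- g x * exp (- ?G x)) + f' x * exp (- ?G x) \<le> 0"
      using le
    proof eventually_elim
      case (elim x)
      show ?case
      proof
        assume "x \<in> {s<..<t}"
        hence "(f' x - g x * f x) * exp (- ?G x) \<le> 0" using elim by (intro mult_nonpos_nonneg) auto
        thus "f x * (- g x * exp (- ?G x)) + f' x * exp (- ?G x) \<le> 0" by (simp add: algebra_simps)
      qed
    qed
  qed
  thus ?thesis by (simp add: exp_minus field_simps)
qed

text \<open>The forward inequality makes no assumption on signs, so it may be applied to
  \<open>- f\<close> and \<open>- g\<close>.\<close>

lemma gronwall_backward:
  fixes f :: "real \<Rightarrow> real"
  assumes f: "ac_derivative s t f f'" and g: "g absolutely_integrable_on {s..t}" and st: "s \<le> t"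
    and le: "AE x\<in>{s<..<t} in lebesgue. - f' x \<le> g x * f x"
  shows "f s \<le> f t * exp (integral {s..t} g)"
proof -
  have "- f t \<le> - f s * exp (integral {s..t} (\<lambda>x. - g x))"
    by (rule gronwall_forward[OF ac_derivative_minus[OF f] _ st])
      (use g le in \<open>auto simp: absolutely_integrable_on_def intro: integrable_neg\<close>)
  thus ?thesis by (simp add: exp_minus field_simps)
qed

section \<open>Solutions of the Sturm-Liouville equation\<close>

lemma absolutely_integrable_continuous_mult:
  fixes f g :: "real \<Rightarrow> 'a::{real_normed_algebra, euclidean_space}"
  assumes "continuous_on {s..t} f" "g absolutely_integrable_on {s..t}"
  shows "(\<lambda>x. f x * g x) absolutely_integrable_on {s..t}"
  using assms
  by (intro absolutely_integrable_bounded_measurable_product[of "(*)"] bilinear_times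
      continuous_imp_measurable_on_sets_lebesgue compact_imp_bounded compact_continuous_image) auto

lemma SL_solution_derivative:
  assumes "SL_solution q \<mu> y y'" "x \<in> {0<..<pi}"
  shows "(y has_vector_derivative y' x) (at x)"
proof -
  have "(y has_vector_derivative y' x) (at x within {0..pi})"
    using assms unfolding SL_solution_def by auto
  thus ?thesis using assms(2) by (metis at_within_Icc_at greaterThanLessThan_iff)
qed

text \<open>The working form is a first order system. \<open>SL_solution\<close> asks for the
  derivative of \<open>y\<close> at every point, endpoints included, while
  \<open>ac_derivative\<close> gives it almost everywhere. The gap closes because \<open>y'\<close>
  is continuous and \<open>y\<close> is its integral.\<close>

lemma SL_solution_iff:
  "SL_solution q \<mu> y y' \<longleftrightarrow>
    ac_derivative 0 pi y y' \<and> ac_derivative 0 pi y' (\<lambda>x. (of_real (q x) - \<mu>) * y x)"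
  (is "_ \<longleftrightarrow> ?R")
proof
  assume L: "SL_solution q \<mu> y y'"
  have "(y has_vector_derivative y' x) (at x)" if "x \<in> {0<..<pi}" for x
    by (rule SL_solution_derivative[OF L that])
  moreover have "AE x\<in>{0<..<pi} in lebesgue. (\<exists>y''. (y' has_vector_derivative y'') (at x) \<and> - y'' + of_real (q x) * y x = \<mu> * y x)"
    using L unfolding SL_solution_def by blast
  hence "AE x\<in>{0<..<pi} in lebesgue. (y' has_vector_derivative ((of_real (q x) - \<mu>) * y x)) (at x)"
  proof eventually_elim
    case (elim x)
    show ?case
    proof
      assume "x \<in> {0<..<pi}"
      then obtain d where d: "(y' has_vector_derivative d) (at x)" "- d + of_real (q x) * y x = \<mu> * y x"
        using elim by blast
      have "d = (of_real (q x) - \<mu>) * y x" using d(2) by (simp add: algebra_simps add_eq_0_iff)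
      thus "(y' has_vector_derivative ((of_real (q x) - \<mu>) * y x)) (at x)" using d(1) by simp
    qed
  qed
  ultimately show ?R using L by (auto simp: SL_solution_def ac_derivative_def)
next
  assume R: ?R
  have "(y has_vector_derivative y' x) (at x within {0..pi})" if x: "x \<in> {0..pi}" for x
  proof -
    have c: "continuous_on {0..pi} y'" using R ac_derivative_continuous_on by blast
    have "((\<lambda>u. y 0 + integral {0..u} y') has_vector_derivative (0 + y' x)) (at x within {0..pi})"
      by (intro derivative_intros integral_has_vector_derivative c x)
    hence d: "((\<lambda>u. y 0 + integral {0..u} y') has_vector_derivative y' x) (at x within {0..pi})"
      by simp
    have "y u = y 0 + integral {0..u} y'" if "u \<in> {0..pi}" for u
      using ac_derivative_has_integral[OF ac_derivative_subset[of 0 pi y y' 0 u]] R that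
      by (auto simp: has_integral_iff)
    from has_vector_derivative_transform[OF x this d] show ?thesis .
  qed
  moreover have "AE x\<in>{0<..<pi} in lebesgue. (y' has_vector_derivative ((of_real (q x) - \<mu>) * y x)) (at x)"
    using R by (simp add: ac_derivative_def)
  hence "AE x\<in>{0<..<pi} in lebesgue. (\<exists>y''. (y' has_vector_derivative y'') (at x) \<and> - y'' + of_real (q x) * y x = \<mu> * y x)"
  proof eventually_elim
    case (elim x)
    show ?case
    proof
      assume "x \<in> {0<..<pi}"
      thus "\<exists>y''. (y' has_vector_derivative y'') (at x) \<and> - y'' + of_real (q x) * y x = \<mu> * y x"
        using elim by (intro exI[of _ "(of_real (q x) - \<mu>) * y x"]) (auto simp: algebra_simps)
    qed
  qed
  ultimately show "SL_solution q \<mu> y y'" using R by (auto simp: SL_solution_def ac_derivative_def)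
qed

lemma L1_potential_integrable:
  "L1_potential q \<Longrightarrow> q absolutely_integrable_on {0..pi}"
  by (simp add: L1_potential_def absolutely_integrable_on_Icc_iff_Ioo)

definition L1_mass :: "(real \<Rightarrow> real) \<Rightarrow> real" where
  "L1_mass q = integral {0..pi} (\<lambda>x. \<bar>q x\<bar>)"

lemma L1_potential_abs:
  "L1_potential q \<Longrightarrow> (\<lambda>x. \<bar>q x\<bar>) absolutely_integrable_on {0..pi}"
  using absolutely_integrable_norm[OF L1_potential_integrable, of q] by (simp add: o_def)

lemma L1_mass_nonneg: "L1_potential q \<Longrightarrow> L1_mass q \<ge> 0"
  unfolding L1_mass_def using L1_potential_abs[of q]
  by (intro HK_int_nonneg) (auto simp: absolutely_integrable_on_def)

lemma L1_potential_complex: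
  assumes "L1_potential q"
  shows "(\<lambda>x. complex_of_real (q x) - \<mu>) absolutely_integrable_on {0..pi}"
proof -
  have "(\<lambda>x. complex_of_real (q x)) absolutely_integrable_on {0..pi}"
    using absolutely_integrable_linear[OF L1_potential_integrable[OF assms] bounded_linear_of_real]
    by (simp add: o_def)
  thus ?thesis by (intro set_integral_diff absolutely_integrable_on_const) auto
qed

text \<open>Fixed point of the Volterra equation with kernel \<open>(x - t) * p t\<close>.
  Substituting \<open>u = exp (2 * G) * w\<close> is the Bielecki renorming:
  \<open>g = pi * norm p\<close> dominates the kernel, and since \<open>2 * g * exp (2 * G)\<close>
  is the derivative of \<open>exp (2 * G)\<close>, the map for \<open>w\<close> contracts by 1/2 on
  the whole interval in one go.\<close>

lemma SL_solution_exists: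
  assumes q: "L1_potential q"
  shows "\<exists>y y'. SL_solution q \<mu> y y' \<and> y 0 = a \<and> y' 0 = b"
proof -
  define p where "p x = complex_of_real (q x) - \<mu>" for x
  define g where "g x = pi * norm (p x)" for x
  define G where "G x = integral {0..x} g" for x
  have p: "p absolutely_integrable_on {0..pi}" unfolding p_def by (rule L1_potential_complex[OF q])
  have g: "g absolutely_integrable_on {0..pi}" unfolding g_def
    using absolutely_integrable_norm[OF p] by (intro set_integrable_mult_right) (simp add: o_def)
  have acG: "ac_derivative 0 pi G g" unfolding G_def by (rule ac_derivative_indefinite_integral[OF g])
  have acE: "ac_derivative 0 pi (\<lambda>x. exp (2 * G x)) (\<lambda>x. 2 * g x * exp (2 * G x))"
    by (rule ac_derivative_exp[OF ac_derivative_linear[OF bounded_linear_mult_right acG]])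
  have contE: "continuous_on {0..pi} (\<lambda>x. exp (2 * G x))" by (rule ac_derivative_continuous_on[OF acE])
  define K where "K w x = a + b * of_real x +
      integral {0..x} (\<lambda>t. of_real (x - t) * (p t * (of_real (exp (2 * G t)) * w t)))" for w :: "real \<Rightarrow> complex" and x
  have pu: "(\<lambda>t. p t * u t) absolutely_integrable_on {0..pi}" if "continuous_on {0..pi} u" for u
    using absolutely_integrable_continuous_mult[OF that p] by (simp add: mult.commute)
  have tpu: "(\<lambda>t. of_real t * (p t * u t)) absolutely_integrable_on {0..pi}" if "continuous_on {0..pi} u" for u
    by (rule absolutely_integrable_continuous_mult[OF _ pu[OF that]]) (auto intro: continuous_intros)
  \<comment> \<open>Splitting the kernel \<open>x - t\<close> removes the upper limit from the
    integrand, so that only indefinite integrals and a product have to be differentiated.\<close>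
  have split: "integral {0..x} (\<lambda>t. of_real (x - t) * (p t * u t)) =
      of_real x * integral {0..x} (\<lambda>t. p t * u t) - integral {0..x} (\<lambda>t. of_real t * (p t * u t))"
    if u: "continuous_on {0..pi} u" and x: "x \<in> {0..pi}" for u x
  proof -
    have "(\<lambda>t. p t * u t) integrable_on {0..x}" "(\<lambda>t. of_real t * (p t * u t)) integrable_on {0..x}"
      using pu[OF u] tpu[OF u] x by (auto intro!: integrable_on_subinterval[of _ "{0..pi}"] simp: absolutely_integrable_on_def)
    thus ?thesis
      by (simp add: left_diff_distrib HK_int_diff integrable_on_mult_right)
  qed
  have acK: "ac_derivative 0 pi (\<lambda>x. a + b * of_real x + integral {0..x} (\<lambda>t. of_real (x - t) * (p t * u t)))
      (\<lambda>x. b + integral {0..x} (\<lambda>t. p t * u t))" if u: "continuous_on {0..pi} u" for u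
  proof -
    have 1: "ac_derivative 0 pi (\<lambda>x. of_real x :: complex) (\<lambda>_. 1)"
      by (rule ac_derivative_C1) (auto intro!: derivative_eq_intros simp: has_vector_derivative_of_real)
    have 2: "ac_derivative 0 pi (\<lambda>x. a + b * of_real x) (\<lambda>_. 0 + b * 1)"
      by (rule ac_derivative_add[OF ac_derivative_const ac_derivative_linear[OF bounded_linear_mult_right 1]])
    note 3 = ac_derivative_add[OF 2 ac_derivative_diff[OF
        ac_derivative_mult[OF 1 ac_derivative_indefinite_integral[OF pu[OF u]]]
        ac_derivative_indefinite_integral[OF tpu[OF u]]]]
    show ?thesis
      by (rule ac_derivative_cong[OF 3]) (use split[OF u] in \<open>auto simp: algebra_simps\<close>)
  qed
  \<comment> \<open>Clamping to \<open>[0, pi]\<close> turns functions on the interval into bounded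
    continuous functions on the line, a complete space to which the fixed point theorem
    applies.\<close>
  define c :: "real \<Rightarrow> real" where "c x = max 0 (min pi x)" for x
  have c: "c x \<in> {0..pi}" "x \<in> {0..pi} \<Longrightarrow> c x = x" for x by (auto simp: c_def)
  have contc: "continuous_on UNIV c" unfolding c_def by (intro continuous_intros)
  define T where "T w = Bcontfun (\<lambda>x. of_real (exp (- (2 * G (c x)))) * K (apply_bcontfun w) (c x))" for w :: "real \<Rightarrow>\<^sub>C complex"
  have Ew: "continuous_on {0..pi} (\<lambda>t. of_real (exp (2 * G t)) * apply_bcontfun w t)" for w :: "real \<Rightarrow>\<^sub>C complex"
    by (intro continuous_intros contE continuous_on_apply_bcontfun)
  have "(\<lambda>x. of_real (exp (- (2 * G (c x)))) * K (apply_bcontfun w) (c x)) \<in> bcontfun" for w :: "real \<Rightarrow>\<^sub>C complex"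
  proof -
    have "continuous_on {0..pi} (\<lambda>x. of_real (exp (- (2 * G x))) * K (apply_bcontfun w) x)"
      unfolding K_def
      by (intro continuous_on_mult[OF _ ac_derivative_continuous_on[OF acK[OF Ew]]] continuous_intros
          ac_derivative_continuous_on[OF acG])
    hence "continuous_on (range c) (\<lambda>x. of_real (exp (- (2 * G x))) * K (apply_bcontfun w) x)"
      "bounded ((\<lambda>x. of_real (exp (- (2 * G x))) * K (apply_bcontfun w) x) ` {0..pi})"
      using c(1) by (auto intro: continuous_on_subset compact_imp_bounded compact_continuous_image)
    thus ?thesis
      using continuous_on_compose2[OF _ contc] c(1) by (auto simp: bcontfun_def intro: bounded_subset)
  qed
  hence T: "apply_bcontfun (T w) x = of_real (exp (- (2 * G (c x)))) * K (apply_bcontfun w) (c x)" for w x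
    by (simp add: T_def Bcontfun_inverse)
  have contr: "dist (T w1) (T w2) \<le> 1/2 * dist w1 w2" for w1 w2
  proof (rule dist_bound)
    fix x :: real
    define z where "z = c x"
    have z: "z \<in> {0..pi}" using c by (simp add: z_def)
    let ?f = "\<lambda>w t. of_real (z - t) * (p t * (of_real (exp (2 * G t)) * apply_bcontfun w t))"
    have fi: "?f w integrable_on {0..z}" for w
    proof -
      have "?f w absolutely_integrable_on {0..pi}"
        by (rule absolutely_integrable_continuous_mult[OF _ pu[OF Ew]]) (auto intro!: continuous_intros)
      thus ?thesis using z by (auto intro!: integrable_on_subinterval[of _ "{0..pi}"] simp: absolutely_integrable_on_def)
    qed
    have I: "((\<lambda>t. 2 * g t * exp (2 * G t)) has_integral (exp (2 * G z) - exp (2 * G 0))) {0..z}"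
      using z by (intro ac_derivative_has_integral ac_derivative_subset[OF acE]) simp_all
    have I': "((\<lambda>t. dist w1 w2 * (1/2) * (2 * g t * exp (2 * G t))) has_integral
        dist w1 w2 * (1/2) * (exp (2 * G z) - exp (2 * G 0))) {0..z}"
      by (rule has_integral_mult_right[OF I])
    have 1: "K (apply_bcontfun w1) z - K (apply_bcontfun w2) z = integral {0..z} (\<lambda>t. ?f w1 t - ?f w2 t)"
      using fi by (simp add: K_def HK_int_diff)
    have 2: "norm (integral {0..z} (\<lambda>t. ?f w1 t - ?f w2 t)) \<le> integral {0..z} (\<lambda>t. dist w1 w2 * (1/2) * (2 * g t * exp (2 * G t)))"
    proof (rule HK_norm_bound)
      show "(\<lambda>t. ?f w1 t - ?f w2 t) integrable_on {0..z}" using fi by (intro Henstock_Kurzweil_Integration.integrable_diff)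
      show "(\<lambda>t. dist w1 w2 * (1/2) * (2 * g t * exp (2 * G t))) integrable_on {0..z}" using I' by blast
      fix t assume t: "t \<in> {0..z}"
      have "norm (?f w1 t - ?f w2 t) = \<bar>z - t\<bar> * norm (p t) * exp (2 * G t) * norm (apply_bcontfun w1 t - apply_bcontfun w2 t)"
        by (simp flip: right_diff_distrib of_real_diff add: norm_mult)
      also have "\<dots> \<le> pi * norm (p t) * exp (2 * G t) * dist w1 w2"
        using t z dist_bounded[of w1 t w2] by (intro mult_mono) (auto simp: dist_norm)
      finally show "norm (?f w1 t - ?f w2 t) \<le> dist w1 w2 * (1/2) * (2 * g t * exp (2 * G t))"
        by (simp add: g_def mult_ac)
    qed
    have 3: "dist w1 w2 * (1/2) * (exp (2 * G z) - exp (2 * G 0)) \<le> dist w1 w2 * (1/2) * exp (2 * G z)"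
      by (intro mult_left_mono) auto
    have "norm (K (apply_bcontfun w1) z - K (apply_bcontfun w2) z) \<le> dist w1 w2 * (1/2) * exp (2 * G z)"
      using 2 3 unfolding 1 integral_unique[OF I'] by (rule order_trans)
    hence "exp (- (2 * G z)) * norm (K (apply_bcontfun w1) z - K (apply_bcontfun w2) z)
        \<le> exp (- (2 * G z)) * (dist w1 w2 * (1/2) * exp (2 * G z))" by (intro mult_left_mono) auto
    also have "\<dots> = 1/2 * dist w1 w2" by (simp add: exp_minus field_simps)
    finally show "dist (apply_bcontfun (T w1) x) (apply_bcontfun (T w2) x) \<le> 1/2 * dist w1 w2"
      unfolding T z_def[symmetric] dist_norm
      by (simp flip: right_diff_distrib add: norm_mult)
  qed
  have "\<exists>!w. T w = w"
    by (rule banach_fix_type[of "1/2"]) (simp_all only: contr, simp_all)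
  then obtain w where w: "T w = w" by blast
  define u where "u x = of_real (exp (2 * G x)) * apply_bcontfun w x" for x
  have u: "u x = K (apply_bcontfun w) x" if "x \<in> {0..pi}" for x
    unfolding u_def using T[of w x] w c(2)[OF that] by (simp add: exp_minus field_simps)
  have contu: "continuous_on {0..pi} u" unfolding u_def by (rule Ew)
  have acu: "ac_derivative 0 pi u (\<lambda>x. b + integral {0..x} (\<lambda>t. p t * u t))"
    by (rule ac_derivative_cong[OF acK[OF contu]]) (use u in \<open>auto simp: K_def u_def\<close>)
  have acv: "ac_derivative 0 pi (\<lambda>x. b + integral {0..x} (\<lambda>t. p t * u t)) (\<lambda>x. 0 + p x * u x)"
    by (rule ac_derivative_add[OF ac_derivative_const ac_derivative_indefinite_integral[OF pu[OF contu]]])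
  have "SL_solution q \<mu> u (\<lambda>x. b + integral {0..x} (\<lambda>t. p t * u t))"
    using acu acv by (simp add: SL_solution_iff p_def)
  moreover have "u 0 = a" using u[of 0] by (simp add: K_def)
  ultimately show ?thesis by (intro exI[of _ u] exI[of _ "\<lambda>x. b + integral {0..x} (\<lambda>t. p t * u t)"]) auto
qed

text \<open>The derivative of \<open>A\<close> contains the potential only as
  \<open>q + \<kappa>\<^sup>2 - \<mu>\<close>, so \<open>\<kappa>\<close> can be tuned:
  \<open>\<kappa> = 1\<close> gives uniqueness and local bounds, while
  \<open>\<kappa> = norm k\<close> for \<open>\<mu> = k\<^sup>2\<close> gives the sharp exponential
  growth. Both directions are needed because \<open>chi\<close> is normalised at the right
  endpoint.\<close>

lemma SL_energy:
  assumes q: "L1_potential q" and y: "SL_solution q \<mu> y y'" and \<kappa>: "\<kappa> > 0"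
    and st: "0 \<le> s" "s \<le> t" "t \<le> pi"
  defines "A \<equiv> \<lambda>x. (norm (y' x))\<^sup>2 + \<kappa>\<^sup>2 * (norm (y x))\<^sup>2"
    and "I \<equiv> (L1_mass q + (t - s) * norm (of_real (\<kappa>\<^sup>2) - \<mu>)) / \<kappa>"
  shows "A t \<le> A s * exp I" "A s \<le> A t * exp I"
proof -
  let ?A' = "\<lambda>x. (y' x \<bullet> ((of_real (q x) - \<mu>) * y x) + ((of_real (q x) - \<mu>) * y x) \<bullet> y' x)
      + \<kappa>\<^sup>2 * (y x \<bullet> y' x + y' x \<bullet> y x)"
  let ?r = "\<lambda>x. (\<bar>q x\<bar> + norm (of_real (\<kappa>\<^sup>2) - \<mu>)) / \<kappa>"
  have qi: "(\<lambda>x. \<bar>q x\<bar>) absolutely_integrable_on {0..pi}"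
    by (rule L1_potential_abs[OF q])
  have r: "?r absolutely_integrable_on {s..t}"
    using absolutely_integrable_on_subinterval[OF qi, of s t] st
    by (intro set_integrable_divide set_integral_add absolutely_integrable_on_const) auto
  have acy: "ac_derivative 0 pi y y'" "ac_derivative 0 pi y' (\<lambda>x. (of_real (q x) - \<mu>) * y x)"
    using y unfolding SL_solution_iff by auto
  have "ac_derivative 0 pi A ?A'"
    unfolding A_def power2_norm_eq_inner
    by (rule ac_derivative_add[OF ac_derivative_inner[OF acy(2) acy(2)]
        ac_derivative_linear[OF bounded_linear_mult_right ac_derivative_inner[OF acy(1) acy(1)]]])
  hence A: "ac_derivative s t A ?A'" using st ac_derivative_subset by blast
  have bound: "\<bar>?A' x\<bar> \<le> ?r x * A x" for x
  proof -
    have "?A' x = 2 * (y' x \<bullet> ((of_real (q x) + (of_real (\<kappa>\<^sup>2) - \<mu>)) * y x))"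
      by (simp add: algebra_simps inner_complex_def)
    hence "\<bar>?A' x\<bar> \<le> 2 * (norm (y' x) * norm ((of_real (q x) + (of_real (\<kappa>\<^sup>2) - \<mu>)) * y x))"
      using Cauchy_Schwarz_ineq2[of "y' x" "(of_real (q x) + (of_real (\<kappa>\<^sup>2) - \<mu>)) * y x"] by (simp add: abs_mult)
    also have "\<dots> = norm (of_real (q x) + (of_real (\<kappa>\<^sup>2) - \<mu>)) * (2 * norm (y' x) * norm (y x))"
      by (simp add: norm_mult)
    also have "\<dots> \<le> (\<bar>q x\<bar> + norm (of_real (\<kappa>\<^sup>2) - \<mu>)) * (A x / \<kappa>)"
    proof (intro mult_mono)
      show "norm (complex_of_real (q x) + (of_real (\<kappa>\<^sup>2) - \<mu>)) \<le> \<bar>q x\<bar> + norm (of_real (\<kappa>\<^sup>2) - \<mu>)"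
        by (rule order_trans[OF norm_triangle_ineq]) simp
      have "2 * norm (y' x) * (\<kappa> * norm (y x)) \<le> A x"
        using sum_squares_bound[of "norm (y' x)" "\<kappa> * norm (y x)"] by (simp add: A_def power_mult_distrib)
      thus "2 * norm (y' x) * norm (y x) \<le> A x / \<kappa>" using \<kappa> by (simp add: field_simps)
    qed auto
    finally show ?thesis by simp
  qed
  have "integral {s..t} (\<lambda>x. \<bar>q x\<bar> + norm (of_real (\<kappa>\<^sup>2) - \<mu>)) =
      integral {s..t} (\<lambda>x. \<bar>q x\<bar>) + (t - s) * norm (of_real (\<kappa>\<^sup>2) - \<mu>)"
    using absolutely_integrable_on_subinterval[OF qi, of s t] st
    by (subst HK_int_add) (auto simp: absolutely_integrable_on_def)
  hence "integral {s..t} ?r = (integral {s..t} (\<lambda>x. \<bar>q x\<bar>) + (t - s) * norm (of_real (\<kappa>\<^sup>2) - \<mu>)) / \<kappa>"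
    by simp
  also have "\<dots> \<le> I"
    unfolding I_def L1_mass_def using \<kappa> qi st absolutely_integrable_on_subinterval[OF qi, of s t]
    by (intro divide_right_mono add_right_mono integral_subset_le) (auto simp: absolutely_integrable_on_def)
  finally have I: "integral {s..t} ?r \<le> I" .
  have A0: "A x \<ge> 0" for x by (simp add: A_def)
  have "A t \<le> A s * exp (integral {s..t} ?r)"
    by (rule gronwall_forward[OF A r st(2)]) (use bound in \<open>auto simp: abs_le_iff\<close>)
  also have "\<dots> \<le> A s * exp I" using I A0 by (intro mult_left_mono) auto
  finally show "A t \<le> A s * exp I" .
  have "A s \<le> A t * exp (integral {s..t} ?r)"
    by (rule gronwall_backward[OF A r st(2)]) (use bound in \<open>auto simp: abs_le_iff\<close>)
  also have "\<dots> \<le> A t * exp I" using I A0 by (intro mult_left_mono) auto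
  finally show "A s \<le> A t * exp I" .
qed

lemma SL_solution_linear:
  assumes "SL_solution q \<mu> y y'" "SL_solution q \<mu> z z'"
  shows "SL_solution q \<mu> (\<lambda>x. a * y x + b * z x) (\<lambda>x. a * y' x + b * z' x)"
proof -
  have "ac_derivative 0 pi (\<lambda>x. a * y x + b * z x) (\<lambda>x. a * y' x + b * z' x)"
    using assms unfolding SL_solution_iff
    by (intro ac_derivative_add ac_derivative_linear[OF bounded_linear_mult_right]) auto
  moreover have "ac_derivative 0 pi (\<lambda>x. a * y' x + b * z' x)
      (\<lambda>x. a * ((of_real (q x) - \<mu>) * y x) + b * ((of_real (q x) - \<mu>) * z x))"
    using assms unfolding SL_solution_iff
    by (intro ac_derivative_add ac_derivative_linear[OF bounded_linear_mult_right]) auto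
  ultimately show ?thesis unfolding SL_solution_iff by (simp add: algebra_simps)
qed

lemma SL_solution_unique:
  assumes q: "L1_potential q" and y: "SL_solution q \<mu> y y'" and z: "SL_solution q \<mu> z z'"
    and eq: "y x0 = z x0" "y' x0 = z' x0" and x0: "x0 \<in> {0..pi}" and x: "x \<in> {0..pi}"
  shows "y x = z x" "y' x = z' x"
proof -
  have d: "SL_solution q \<mu> (\<lambda>x. 1 * y x + (-1) * z x) (\<lambda>x. 1 * y' x + (-1) * z' x)"
    by (rule SL_solution_linear[OF y z])
  have "(norm (1 * y' x + (-1) * z' x))\<^sup>2 + 1\<^sup>2 * (norm (1 * y x + (-1) * z x))\<^sup>2 \<le> 0"
  proof (cases "x0 \<le> x")
    case True
    show ?thesis using SL_energy(1)[OF q d, of 1 x0 x] True x x0 eq by simp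
  next
    case False
    show ?thesis using SL_energy(2)[OF q d, of 1 x x0] False x x0 eq by simp
  qed
  hence "(norm (y' x - z' x))\<^sup>2 + (norm (y x - z x))\<^sup>2 = 0"
    using sum_power2_ge_zero[of "norm (y' x - z' x)" "norm (y x - z x)"] by simp
  thus "y x = z x" "y' x = z' x" by (auto simp: sum_power2_eq_zero_iff)
qed

lemma SL_lagrange:
  assumes "SL_solution q \<mu> y y'" "SL_solution q0 \<nu> z z'"
  shows "ac_derivative 0 pi (\<lambda>x. y x * z' x - y' x * z x)
    (\<lambda>x. ((of_real (q0 x) - \<nu>) - (of_real (q x) - \<mu>)) * (y x * z x))"
proof -
  have "ac_derivative 0 pi (\<lambda>x. y x * z' x - y' x * z x)
     (\<lambda>x. (y x * ((of_real (q0 x) - \<nu>) * z x) + y' x * z' x)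
        - (y' x * z' x + ((of_real (q x) - \<mu>) * y x) * z x))"
    using assms unfolding SL_solution_iff
    by (intro ac_derivative_diff ac_derivative_mult) auto
  thus ?thesis by (rule ac_derivative_cong) (auto simp: algebra_simps)
qed

lemma SL_lagrange_integral:
  assumes "SL_solution q \<mu> y y'" "SL_solution q0 \<nu> z z'" "x \<in> {0..pi}"
  shows "((\<lambda>x. ((of_real (q0 x) - \<nu>) - (of_real (q x) - \<mu>)) * (y x * z x)) has_integral
     ((y x * z' x - y' x * z x) - (y 0 * z' 0 - y' 0 * z 0))) {0..x}"
  using assms(3) by (intro ac_derivative_has_integral ac_derivative_subset[OF SL_lagrange[OF assms(1,2)]]) simp_all

lemma SL_wronskian:
  assumes "SL_solution q \<mu> y y'" "SL_solution q \<mu> z z'" "x \<in> {0..pi}"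
  shows "y x * z' x - y' x * z x = y 0 * z' 0 - y' 0 * z 0"
proof -
  have "((\<lambda>x. 0) has_integral ((y x * z' x - y' x * z x) - (y 0 * z' 0 - y' 0 * z 0))) {0..x}"
    using SL_lagrange_integral[OF assms] by simp
  hence "(y x * z' x - y' x * z x) - (y 0 * z' 0 - y' 0 * z 0) = 0"
    by (rule has_integral_unique[OF _ has_integral_0])
  thus ?thesis by simp
qed

lemma SL_solution_continuous:
  assumes "SL_solution q \<mu> y y'"
  shows "continuous_on {0..pi} y" "continuous_on {0..pi} y'"
  using assms unfolding SL_solution_iff by (auto intro: ac_derivative_continuous_on)

section \<open>Growth of solutions in the square root \<open>k\<close> of the spectral
  parameter\<close>

lemma norm_sq_diff_square:
  fixes k :: complex
  shows "norm (complex_of_real ((norm k)\<^sup>2) - k\<^sup>2) = 2 * \<bar>Im k\<bar> * norm k"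
proof -
  have "complex_of_real ((norm k)\<^sup>2) - k\<^sup>2 = k * (cnj k - k)"
    unfolding complex_norm_square by (simp add: right_diff_distrib power2_eq_square)
  hence "norm (complex_of_real ((norm k)\<^sup>2) - k\<^sup>2) = norm k * norm (k - cnj k)"
    by (simp only: norm_mult norm_minus_commute)
  thus ?thesis by (simp add: complex_diff_cnj norm_mult)
qed

abbreviation growth :: "complex \<Rightarrow> real \<Rightarrow> real" where
  "growth k x \<equiv> exp (\<bar>Im k\<bar> * x)"

text \<open>With \<open>\<kappa> = norm k\<close> the exponent of the energy is
  \<open>2 * |Im k| * |t - s|\<close> plus a bounded term. The energy is quadratic, so the solution
  grows with half of that, which is the exact rate of the case \<open>q = 0\<close>.\<close>

lemma SL_solution_bounds:
  assumes q: "L1_potential q" and y: "SL_solution q (k\<^sup>2) y y'" and k: "norm k \<ge> 1"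
    and st: "s \<in> {0..pi}" "t \<in> {0..pi}"
  defines "B \<equiv> (norm (y' s) + norm k * norm (y s)) * exp (L1_mass q) * growth k \<bar>t - s\<bar>"
  shows "norm (y' t) \<le> B" "norm k * norm (y t) \<le> B"
proof -
  define N where "N = L1_mass q"
  have N: "N \<ge> 0" unfolding N_def by (rule L1_mass_nonneg[OF q])
  define A where "A x = (norm (y' x))\<^sup>2 + (norm k)\<^sup>2 * (norm (y x))\<^sup>2" for x
  have k0: "norm k > 0" using k by linarith
  have eq: "(N + \<bar>t - s\<bar> * norm (complex_of_real ((norm k)\<^sup>2) - k\<^sup>2)) / norm k = N / norm k + 2 * (\<bar>Im k\<bar> * \<bar>t - s\<bar>)"
    unfolding norm_sq_diff_square using k0 by (simp add: field_simps)
  have "A t \<le> A s * exp ((N + \<bar>t - s\<bar> * norm (complex_of_real ((norm k)\<^sup>2) - k\<^sup>2)) / norm k)"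
  proof (cases "s \<le> t")
    case True
    thus ?thesis using SL_energy(1)[OF q y k0, of s t] st unfolding A_def N_def by simp
  next
    case False
    thus ?thesis using SL_energy(2)[OF q y k0, of t s] st unfolding A_def N_def by simp
  qed
  also have "\<dots> \<le> A s * exp (2 * (N + \<bar>Im k\<bar> * \<bar>t - s\<bar>))"
  proof -
    have "N / norm k \<le> N / 1" using N k by (intro divide_left_mono) auto
    hence "N / norm k + 2 * (\<bar>Im k\<bar> * \<bar>t - s\<bar>) \<le> 2 * (N + \<bar>Im k\<bar> * \<bar>t - s\<bar>)" using N by simp
    thus ?thesis unfolding eq by (intro mult_left_mono) (auto simp: A_def)
  qed
  also have "\<dots> \<le> (norm (y' s) + norm k * norm (y s))\<^sup>2 * exp (2 * (N + \<bar>Im k\<bar> * \<bar>t - s\<bar>))"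
    by (intro mult_right_mono) (auto simp: A_def power2_sum power_mult_distrib)
  also have "\<dots> = B\<^sup>2"
    unfolding B_def N_def[symmetric] exp_double exp_add by (simp add: power_mult_distrib)
  finally have "A t \<le> B\<^sup>2" .
  moreover have "(norm (y' t))\<^sup>2 \<le> A t" "(norm k * norm (y t))\<^sup>2 \<le> A t"
    by (auto simp: A_def power_mult_distrib)
  moreover have "B \<ge> 0" unfolding B_def by simp
  ultimately show "norm (y' t) \<le> B" "norm k * norm (y t) \<le> B"
    by (meson order_trans power2_le_imp_le)+
qed

section \<open>Holomorphic dependence of solutions on the spectral parameter\<close>

definition sl_sol :: "(real \<Rightarrow> real) \<Rightarrow> complex \<Rightarrow> complex \<Rightarrow> complex \<Rightarrow> (real \<Rightarrow> complex) \<times> (real \<Rightarrow> complex)" where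
  "sl_sol q \<mu> a b = (SOME p. SL_solution q \<mu> (fst p) (snd p) \<and> fst p 0 = a \<and> snd p 0 = b)"

definition sl_y where "sl_y q \<mu> a b = fst (sl_sol q \<mu> a b)"
definition sl_y' where "sl_y' q \<mu> a b = snd (sl_sol q \<mu> a b)"

lemma
  assumes "L1_potential q"
  shows sl_y_solution: "SL_solution q \<mu> (sl_y q \<mu> a b) (sl_y' q \<mu> a b)"
    and sl_y_0: "sl_y q \<mu> a b 0 = a" and sl_y'_0: "sl_y' q \<mu> a b 0 = b"
proof -
  have "\<exists>p. SL_solution q \<mu> (fst p) (snd p) \<and> fst p 0 = a \<and> snd p 0 = b"
    using SL_solution_exists[OF assms, of \<mu> a b] by auto
  from someI_ex[OF this]
  show "SL_solution q \<mu> (sl_y q \<mu> a b) (sl_y' q \<mu> a b)" "sl_y q \<mu> a b 0 = a" "sl_y' q \<mu> a b 0 = b"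
    by (simp_all add: sl_y_def sl_y'_def sl_sol_def)
qed

lemma sl_y_locally_bounded:
  assumes q: "L1_potential q"
  shows "\<exists>B\<ge>0. \<forall>\<nu>. dist \<nu> \<mu> \<le> 1 \<longrightarrow> (\<forall>x\<in>{0..pi}. norm (sl_y q \<nu> a b x) \<le> B)"
proof -
  define N where "N = L1_mass q"
  define B where "B = sqrt (((norm b)\<^sup>2 + (norm a)\<^sup>2) * exp (N + pi * (2 + norm \<mu>)))"
  have "norm (sl_y q \<nu> a b x) \<le> B" if l: "dist \<nu> \<mu> \<le> 1" and x: "x \<in> {0..pi}" for \<nu> x
  proof -
    have "norm \<nu> \<le> 1 + norm \<mu>" using l norm_triangle_ineq2[of \<nu> \<mu>] by (simp add: dist_norm)
    hence "norm (1 - \<nu>) \<le> 2 + norm \<mu>" using norm_triangle_ineq4[of 1 \<nu>] by simp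
    hence le: "(N + x * norm (1 - \<nu>)) \<le> N + pi * (2 + norm \<mu>)"
      using x by (intro add_left_mono mult_mono) auto
    have "(norm (sl_y q \<nu> a b x))\<^sup>2 \<le> (norm (sl_y' q \<nu> a b x))\<^sup>2 + (norm (sl_y q \<nu> a b x))\<^sup>2" by simp
    also have "\<dots> \<le> ((norm b)\<^sup>2 + (norm a)\<^sup>2) * exp (N + x * norm (1 - \<nu>))"
      using SL_energy(1)[OF q sl_y_solution[OF q, of \<nu> a b], of 1 0 x] x
      by (simp add: sl_y_0[OF q] sl_y'_0[OF q] N_def)
    also have "\<dots> \<le> ((norm b)\<^sup>2 + (norm a)\<^sup>2) * exp (N + pi * (2 + norm \<mu>))"
      using le by (intro mult_left_mono) auto
    finally show ?thesis unfolding B_def by (rule real_le_rsqrt)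
  qed
  moreover have "B \<ge> 0" by (simp add: B_def)
  ultimately show ?thesis by blast
qed

lemma integrable_mult_continuous:
  fixes f g :: "real \<Rightarrow> complex"
  assumes "continuous_on {0..pi} f" "continuous_on {0..pi} g" "x \<in> {0..pi}"
  shows "(\<lambda>t. f t * g t) integrable_on {0..x}"
  by (intro integrable_continuous_real continuous_intros continuous_on_subset[OF assms(1)] continuous_on_subset[OF assms(2)])
    (use assms(3) in auto)

text \<open>Variation of constants, read off from Lagrange identities of the solution at \<nu> with
  the fundamental system at \<mu>, then solved by Cramer's rule, the Wronskian being 1. The exposed
  factor \<open>\<nu> - \<mu>\<close> makes this a formula for the difference quotient.\<close>

lemma sl_y_variation:
  fixes \<mu> :: complex
  assumes q: "L1_potential q" and x: "x \<in> {0..pi}"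
  defines "u \<equiv> sl_y q \<mu> 1 0" and "u' \<equiv> sl_y' q \<mu> 1 0" and "v \<equiv> sl_y q \<mu> 0 1" and "v' \<equiv> sl_y' q \<mu> 0 1"
  shows "sl_y q \<nu> a b x - sl_y q \<mu> a b x = (\<nu> - \<mu>) *
      (u x * integral {0..x} (\<lambda>t. sl_y q \<nu> a b t * v t) - v x * integral {0..x} (\<lambda>t. sl_y q \<nu> a b t * u t))" (is ?th1)
    and "sl_y' q \<nu> a b x - sl_y' q \<mu> a b x = (\<nu> - \<mu>) *
      (u' x * integral {0..x} (\<lambda>t. sl_y q \<nu> a b t * v t) - v' x * integral {0..x} (\<lambda>t. sl_y q \<nu> a b t * u t))" (is ?th2)
proof -
  define y y' where "y = sl_y q \<nu> a b" and "y' = sl_y' q \<nu> a b"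
  define w w' where "w = sl_y q \<mu> a b" and "w' = sl_y' q \<mu> a b"
  have ys: "SL_solution q \<nu> y y'" and ws: "SL_solution q \<mu> w w'"
    and us: "SL_solution q \<mu> u u'" and vs: "SL_solution q \<mu> v v'"
    unfolding y_def y'_def w_def w'_def u_def u'_def v_def v'_def by (rule sl_y_solution[OF q])+
  have ini: "y 0 = w 0" "y' 0 = w' 0" "u 0 = 1" "u' 0 = 0" "v 0 = 0" "v' 0 = 1"
    unfolding y_def y'_def w_def w'_def u_def u'_def v_def v'_def using sl_y_0[OF q] sl_y'_0[OF q] by auto
  have key: "(y x - w x) * z' x - (y' x - w' x) * z x = (\<nu> - \<mu>) * integral {0..x} (\<lambda>t. y t * z t)"
    if z: "SL_solution q \<mu> z z'" for z z'
  proof -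
    have "(y x * z' x - y' x * z x) - (y 0 * z' 0 - y' 0 * z 0) = integral {0..x} (\<lambda>t. (\<nu> - \<mu>) * (y t * z t))"
      using integral_unique[OF SL_lagrange_integral[OF ys z x]] by simp
    hence "(y x * z' x - y' x * z x) - (y 0 * z' 0 - y' 0 * z 0) = (\<nu> - \<mu>) * integral {0..x} (\<lambda>t. y t * z t)"
      by (simp only: integral_mult_right)
    moreover have "w x * z' x - w' x * z x = w 0 * z' 0 - w' 0 * z 0" by (rule SL_wronskian[OF ws z x])
    moreover have "(y x - w x) * z' x - (y' x - w' x) * z x = (y x * z' x - y' x * z x) - (w x * z' x - w' x * z x)"
      by (simp add: algebra_simps)
    ultimately show ?thesis using ini by simp
  qed
  have W: "u x * v' x - u' x * v x = 1" using SL_wronskian[OF us vs x] ini by simp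
  have "y x - w x = u x * ((y x - w x) * v' x - (y' x - w' x) * v x) - v x * ((y x - w x) * u' x - (y' x - w' x) * u x)"
    using W by algebra
  thus ?th1 unfolding key[OF us] key[OF vs] unfolding y_def w_def by (simp add: algebra_simps)
  have "y' x - w' x = u' x * ((y x - w x) * v' x - (y' x - w' x) * v x) - v' x * ((y x - w x) * u' x - (y' x - w' x) * u x)"
    using W by algebra
  thus ?th2 unfolding key[OF us] key[OF vs] unfolding y_def y'_def w'_def by (simp add: algebra_simps)
qed

lemma sl_y_lipschitz:
  assumes q: "L1_potential q"
  shows "\<exists>C\<ge>0. \<forall>\<nu>. dist \<nu> \<mu> \<le> 1 \<longrightarrow> (\<forall>x\<in>{0..pi}. norm (sl_y q \<nu> a b x - sl_y q \<mu> a b x) \<le> C * dist \<nu> \<mu>)"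
proof -
  obtain B where B: "B \<ge> 0" "\<And>\<nu> x. dist \<nu> \<mu> \<le> 1 \<Longrightarrow> x \<in> {0..pi} \<Longrightarrow> norm (sl_y q \<nu> a b x) \<le> B"
    using sl_y_locally_bounded[OF q, of \<mu> a b] by blast
  obtain U where U: "U \<ge> 0" "\<And>\<nu> x. dist \<nu> \<mu> \<le> 1 \<Longrightarrow> x \<in> {0..pi} \<Longrightarrow> norm (sl_y q \<nu> 1 0 x) \<le> U"
    using sl_y_locally_bounded[OF q, of \<mu> 1 0] by blast
  obtain V where V: "V \<ge> 0" "\<And>\<nu> x. dist \<nu> \<mu> \<le> 1 \<Longrightarrow> x \<in> {0..pi} \<Longrightarrow> norm (sl_y q \<nu> 0 1 x) \<le> V"
    using sl_y_locally_bounded[OF q, of \<mu> 0 1] by blast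
  have cont: "continuous_on {0..pi} (sl_y q \<nu> a b)" for \<nu> a b
    by (rule SL_solution_continuous(1)[OF sl_y_solution[OF q]])
  have I: "norm (integral {0..x} (\<lambda>t. sl_y q \<nu> a b t * z t)) \<le> B * Z * pi"
    if l: "dist \<nu> \<mu> \<le> 1" and x: "x \<in> {0..pi}" and z: "continuous_on {0..pi} z" "\<And>x. x \<in> {0..pi} \<Longrightarrow> norm (z x) \<le> Z" and Z: "Z \<ge> 0"
    for \<nu> x z Z
  proof -
    have "norm (integral {0..x} (\<lambda>t. sl_y q \<nu> a b t * z t)) \<le> integral {0..x} (\<lambda>_. B * Z)"
      by (rule HK_norm_bound)
        (use x z B(2)[OF l] B(1) Z integrable_mult_continuous[OF cont z(1) x] in \<open>auto simp: norm_mult intro!: mult_mono\<close>)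
    also have "\<dots> \<le> B * Z * pi" using x mult_right_mono[of x pi "B * Z"] B(1) Z by (simp add: mult_ac)
    finally show ?thesis .
  qed
  have "norm (sl_y q \<nu> a b x - sl_y q \<mu> a b x) \<le> (U * (B * V * pi) + V * (B * U * pi)) * dist \<nu> \<mu>"
    if l: "dist \<nu> \<mu> \<le> 1" and x: "x \<in> {0..pi}" for \<nu> x
  proof -
    have "norm (sl_y q \<mu> 1 0 x * integral {0..x} (\<lambda>t. sl_y q \<nu> a b t * sl_y q \<mu> 0 1 t)
        - sl_y q \<mu> 0 1 x * integral {0..x} (\<lambda>t. sl_y q \<nu> a b t * sl_y q \<mu> 1 0 t))
      \<le> U * (B * V * pi) + V * (B * U * pi)"
      using U V B U(2)[of \<mu> x] V(2)[of \<mu> x] x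
      by (intro order_trans[OF norm_triangle_ineq4] add_mono order_trans[OF norm_mult_ineq] mult_mono I l x cont) auto
    thus ?thesis unfolding sl_y_variation(1)[OF q x, of \<nu> a b \<mu>]
      unfolding norm_mult dist_norm by (subst mult.commute) (rule mult_right_mono, simp_all)
  qed
  thus ?thesis using B(1) U(1) V(1) by (intro exI[of _ "U * (B * V * pi) + V * (B * U * pi)"]) auto
qed

lemma sl_y_integral_tendsto:
  assumes q: "L1_potential q" and x: "x \<in> {0..pi}" and z: "continuous_on {0..pi} z"
  shows "((\<lambda>\<nu>. integral {0..x} (\<lambda>t. sl_y q \<nu> a b t * z t)) \<longlongrightarrow> integral {0..x} (\<lambda>t. sl_y q \<mu> a b t * z t)) (at \<mu>)"
proof -
  obtain C where C: "C \<ge> 0" "\<And>\<nu> x. dist \<nu> \<mu> \<le> 1 \<Longrightarrow> x \<in> {0..pi} \<Longrightarrow> norm (sl_y q \<nu> a b x - sl_y q \<mu> a b x) \<le> C * dist \<nu> \<mu>"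
    using sl_y_lipschitz[OF q, of \<mu> a b] by blast
  have "bounded (z ` {0..pi})" using z by (intro compact_imp_bounded compact_continuous_image) auto
  then obtain Z where Z: "\<And>t. t \<in> {0..pi} \<Longrightarrow> norm (z t) \<le> Z" unfolding bounded_iff by blast
  have Z0: "Z \<ge> 0" using Z[OF x] norm_ge_zero[of "z x"] by linarith
  have cont: "continuous_on {0..pi} (sl_y q \<nu> a b)" for \<nu> a b
    by (rule SL_solution_continuous(1)[OF sl_y_solution[OF q]])
  have le: "norm (integral {0..x} (\<lambda>t. sl_y q \<nu> a b t * z t) - integral {0..x} (\<lambda>t. sl_y q \<mu> a b t * z t)) \<le> C * Z * pi * dist \<nu> \<mu>"
    if l: "dist \<nu> \<mu> \<le> 1" for \<nu>
  proof -
    have "integral {0..x} (\<lambda>t. sl_y q \<nu> a b t * z t) - integral {0..x} (\<lambda>t. sl_y q \<mu> a b t * z t)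
        = integral {0..x} (\<lambda>t. (sl_y q \<nu> a b t - sl_y q \<mu> a b t) * z t)"
      using integrable_mult_continuous[OF cont z x]
      by (simp add: left_diff_distrib HK_int_diff)
    also have "norm \<dots> \<le> integral {0..x} (\<lambda>_. C * dist \<nu> \<mu> * Z)"
    proof (rule HK_norm_bound)
      show "(\<lambda>t. (sl_y q \<nu> a b t - sl_y q \<mu> a b t) * z t) integrable_on {0..x}"
        by (intro integrable_mult_continuous z x continuous_intros cont)
      show "norm ((sl_y q \<nu> a b t - sl_y q \<mu> a b t) * z t) \<le> C * dist \<nu> \<mu> * Z" if "t \<in> {0..x}" for t
        unfolding norm_mult using that x C(2)[OF l, of t] Z[of t] C(1) by (intro mult_mono) auto
    qed auto
    also have "\<dots> \<le> C * Z * pi * dist \<nu> \<mu>"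
      using x mult_right_mono[of x pi "C * Z * dist \<nu> \<mu>"] C(1) Z0 by (simp add: mult_ac)
    finally show ?thesis .
  qed
  have "((\<lambda>\<nu>. C * Z * pi * dist \<nu> \<mu>) \<longlongrightarrow> C * Z * pi * dist \<mu> \<mu>) (at \<mu>)" by (intro tendsto_intros)
  hence l0: "((\<lambda>\<nu>. C * Z * pi * dist \<nu> \<mu>) \<longlongrightarrow> 0) (at \<mu>)" by simp
  have ev: "eventually (\<lambda>\<nu>. dist \<nu> \<mu> \<le> 1) (at \<mu>)" unfolding eventually_at by (intro exI[of _ 1]) auto
  show ?thesis
    by (rule LIM_zero_cancel, rule Lim_null_comparison[OF _ l0], rule eventually_mono[OF ev]) (rule le)
qed

lemma
  assumes q: "L1_potential q" and x: "x \<in> {0..pi}"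
  shows sl_y_holomorphic: "(\<lambda>\<mu>. sl_y q \<mu> a b x) holomorphic_on UNIV"
    and sl_y'_holomorphic: "(\<lambda>\<mu>. sl_y' q \<mu> a b x) holomorphic_on UNIV"
proof -
  have cont: "continuous_on {0..pi} (sl_y q \<nu> a b)" for \<nu> a b
    by (rule SL_solution_continuous(1)[OF sl_y_solution[OF q]])
  \<comment> \<open>After division by \<open>\<nu> - \<mu>\<close> only the integrals depend on
    \<nu>, and they converge. Values and derivatives of solutions both have this shape.\<close>
  have diff: "F holomorphic_on UNIV"
    if F: "\<And>\<nu> \<mu>. F \<nu> - F \<mu> = (\<nu> - \<mu>) * (u \<mu> * integral {0..x} (\<lambda>t. sl_y q \<nu> a b t * sl_y q \<mu> 0 1 t)
        - v \<mu> * integral {0..x} (\<lambda>t. sl_y q \<nu> a b t * sl_y q \<mu> 1 0 t))" for F u v :: "complex \<Rightarrow> complex"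
  proof -
    have "(F has_field_derivative (u \<mu> * integral {0..x} (\<lambda>t. sl_y q \<mu> a b t * sl_y q \<mu> 0 1 t)
        - v \<mu> * integral {0..x} (\<lambda>t. sl_y q \<mu> a b t * sl_y q \<mu> 1 0 t))) (at \<mu>)" for \<mu>
      unfolding has_field_derivative_iff F[of _ \<mu>]
      by (rule Lim_transform_eventually[OF tendsto_diff[OF tendsto_mult[OF tendsto_const sl_y_integral_tendsto[OF q x cont]]
           tendsto_mult[OF tendsto_const sl_y_integral_tendsto[OF q x cont]]]])
        (auto simp: eventually_at_filter)
    thus ?thesis unfolding holomorphic_on_def field_differentiable_def by fastforce
  qed
  show "(\<lambda>\<mu>. sl_y q \<mu> a b x) holomorphic_on UNIV" by (rule diff[OF sl_y_variation(1)[OF q x]])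
  show "(\<lambda>\<mu>. sl_y' q \<mu> a b x) holomorphic_on UNIV" by (rule diff[OF sl_y_variation(2)[OF q x]])
qed

section \<open>Characteristic functions and eigenvalues\<close>

text \<open>Here \<open>h\<close> and \<open>b\<close> stand for the cotangents of the angles at 0
  and at pi. \<open>Delta\<close> vanishes exactly at the eigenvalues, whereas the zeros of
  \<open>Eta\<close> belong to the problem with \<open>y 0 = 0\<close> at the left endpoint.\<close>

definition phi where "phi q h \<mu> = sl_y q \<mu> 1 (- complex_of_real h)"
definition phi' where "phi' q h \<mu> = sl_y' q \<mu> 1 (- complex_of_real h)"
definition theta where "theta q \<mu> = sl_y q \<mu> 0 1"
definition theta' where "theta' q \<mu> = sl_y' q \<mu> 0 1"

definition Delta where "Delta q h b \<mu> = phi' q h \<mu> pi + complex_of_real b * phi q h \<mu> pi"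
definition Eta where "Eta q b \<mu> = theta' q \<mu> pi + complex_of_real b * theta q \<mu> pi"

text \<open>The solution with value 1 and slope \<open>- b\<close> at pi (see
  \<open>chi_pi\<close>). Writing it as this combination spares an initial value problem at the
  right endpoint and displays \<open>Eta\<close> and \<open>Delta\<close> as its data at 0.\<close>

definition chi where "chi q h b \<mu> x = Eta q b \<mu> * phi q h \<mu> x - Delta q h b \<mu> * theta q \<mu> x"
definition chi' where "chi' q h b \<mu> x = Eta q b \<mu> * phi' q h \<mu> x - Delta q h b \<mu> * theta' q \<mu> x"

text \<open>The growth of \<open>chi\<close> is measured from pi and that of the others from 0.
  Hence a product of \<open>chi\<close> with \<open>phi\<close> is bounded by
  \<open>exp (|Im k| * pi)\<close> for every \<open>x\<close>, precisely the size that a division by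
  \<open>Delta\<close> removes.\<close>

definition fund_bound where
  "fund_bound q h b C \<longleftrightarrow> C \<ge> 1 \<and> (\<forall>k x. norm k \<ge> 1 \<longrightarrow> x \<in> {0..pi} \<longrightarrow>
     norm (phi q h (k\<^sup>2) x) \<le> C * growth k x \<and>
     norm (phi' q h (k\<^sup>2) x) \<le> C * norm k * growth k x \<and>
     norm k * norm (theta q (k\<^sup>2) x) \<le> C * growth k x \<and>
     norm (chi q h b (k\<^sup>2) x) \<le> C * growth k (pi - x))"

lemma fund_boundD:
  assumes "fund_bound q h b C"
  shows "C \<ge> 1"
    "\<lbrakk>norm k \<ge> 1; x \<in> {0..pi}\<rbrakk> \<Longrightarrow> norm (phi q h (k\<^sup>2) x) \<le> C * growth k x"
    "\<lbrakk>norm k \<ge> 1; x \<in> {0..pi}\<rbrakk> \<Longrightarrow> norm (phi' q h (k\<^sup>2) x) \<le> C * norm k * growth k x"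
    "\<lbrakk>norm k \<ge> 1; x \<in> {0..pi}\<rbrakk> \<Longrightarrow> norm k * norm (theta q (k\<^sup>2) x) \<le> C * growth k x"
    "\<lbrakk>norm k \<ge> 1; x \<in> {0..pi}\<rbrakk> \<Longrightarrow> norm (chi q h b (k\<^sup>2) x) \<le> C * growth k (pi - x)"
  using assms unfolding fund_bound_def by blast+

section \<open>Fundamental solutions and the size of the characteristic function\<close>

context
  fixes q :: "real \<Rightarrow> real"
  assumes q: "L1_potential q"
begin

lemma phi_solution: "SL_solution q \<mu> (phi q h \<mu>) (phi' q h \<mu>)"
  unfolding phi_def phi'_def by (rule sl_y_solution[OF q])

lemma theta_solution: "SL_solution q \<mu> (theta q \<mu>) (theta' q \<mu>)"
  unfolding theta_def theta'_def by (rule sl_y_solution[OF q])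

lemma phi_theta_0:
  "phi q h \<mu> 0 = 1" "phi' q h \<mu> 0 = - of_real h" "theta q \<mu> 0 = 0" "theta' q \<mu> 0 = 1"
  unfolding phi_def phi'_def theta_def theta'_def using sl_y_0[OF q] sl_y'_0[OF q] by auto

lemma phi_theta_wronskian:
  assumes "x \<in> {0..pi}"
  shows "phi q h \<mu> x * theta' q \<mu> x - phi' q h \<mu> x * theta q \<mu> x = 1"
  using SL_wronskian[OF phi_solution theta_solution assms] by (simp add: phi_theta_0)

lemma phi_continuous: "continuous_on {0..pi} (phi q h \<mu>)" "continuous_on {0..pi} (phi' q h \<mu>)"
  using SL_solution_continuous[OF phi_solution] by auto

lemma phi_theta_holomorphic:
  assumes "x \<in> {0..pi}"
  shows "(\<lambda>\<mu>. phi q h \<mu> x) holomorphic_on UNIV" "(\<lambda>\<mu>. phi' q h \<mu> x) holomorphic_on UNIV"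
    "(\<lambda>\<mu>. theta q \<mu> x) holomorphic_on UNIV" "(\<lambda>\<mu>. theta' q \<mu> x) holomorphic_on UNIV"
  unfolding phi_def phi'_def theta_def theta'_def
  using sl_y_holomorphic[OF q assms] sl_y'_holomorphic[OF q assms] by auto

lemma Delta_holomorphic: "Delta q h b holomorphic_on S" and Eta_holomorphic: "Eta q b holomorphic_on S"
proof -
  have "Delta q h b holomorphic_on UNIV" "Eta q b holomorphic_on UNIV"
    unfolding Delta_def[abs_def] Eta_def[abs_def] by (intro holomorphic_intros phi_theta_holomorphic; simp)+
  thus "Delta q h b holomorphic_on S" "Eta q b holomorphic_on S"
    by (auto intro: holomorphic_on_subset)
qed

lemma chi_solution: "SL_solution q \<mu> (chi q h b \<mu>) (chi' q h b \<mu>)"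
proof -
  have eq: "chi q h b \<mu> = (\<lambda>x. Eta q b \<mu> * phi q h \<mu> x + (- Delta q h b \<mu>) * theta q \<mu> x)"
    "chi' q h b \<mu> = (\<lambda>x. Eta q b \<mu> * phi' q h \<mu> x + (- Delta q h b \<mu>) * theta' q \<mu> x)"
    by (auto simp: chi_def chi'_def fun_eq_iff)
  show ?thesis unfolding eq by (rule SL_solution_linear[OF phi_solution theta_solution])
qed

lemma chi_0: "chi q h b \<mu> 0 = Eta q b \<mu>" "chi' q h b \<mu> 0 = - of_real h * Eta q b \<mu> - Delta q h b \<mu>"
  by (auto simp: chi_def chi'_def phi_theta_0)

lemma chi_pi: "chi q h b \<mu> pi = 1" "chi' q h b \<mu> pi = - of_real b"
proof -
  have W: "phi q h \<mu> pi * theta' q \<mu> pi - phi' q h \<mu> pi * theta q \<mu> pi = 1"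
    by (rule phi_theta_wronskian) simp
  show "chi q h b \<mu> pi = 1" "chi' q h b \<mu> pi = - of_real b"
    unfolding chi_def chi'_def Eta_def Delta_def using W by algebra+
qed

lemma fund_bounds: "\<exists>C. fund_bound q h b C"
proof -
  define N where "N = L1_mass q"
  have N: "N \<ge> 0" unfolding N_def by (rule L1_mass_nonneg[OF q])
  define C where "C = (1 + \<bar>h\<bar> + \<bar>b\<bar>) * exp N"
  have C1: "exp N \<le> C" using mult_right_mono[of 1 "1 + \<bar>h\<bar> + \<bar>b\<bar>" "exp N"] by (simp add: C_def)
  have *: "(norm z + norm k) * exp N * E \<le> C * norm k * E"
    if "norm k \<ge> 1" "norm z \<le> \<bar>h\<bar> \<or> norm z \<le> \<bar>b\<bar>" "E > 0" for k z :: complex and E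
  proof -
    have "norm z \<le> (\<bar>h\<bar> + \<bar>b\<bar>) * norm k"
      using that mult_left_mono[of 1 "norm k" "\<bar>h\<bar> + \<bar>b\<bar>"] by auto
    hence "norm z + norm k \<le> (1 + \<bar>h\<bar> + \<bar>b\<bar>) * norm k" by (simp add: algebra_simps)
    hence "(norm z + norm k) * (exp N * E) \<le> ((1 + \<bar>h\<bar> + \<bar>b\<bar>) * norm k) * (exp N * E)"
      using that(3) by (intro mult_right_mono) auto
    thus ?thesis by (simp add: C_def mult_ac)
  qed
  have cancel: "a \<le> c" if "norm k * a \<le> c' * norm k * E" "norm k \<ge> 1" "c = c' * E" for k :: complex and a c c' E
  proof -
    have "norm k * a \<le> norm k * c" using that by (simp add: mult_ac)
    thus ?thesis by (rule mult_left_le_imp_le) (use that(2) in linarith)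
  qed
  have C1': "C \<ge> 1" using C1 N one_le_exp_iff[of N] by linarith
  have "fund_bound q h b C"
    unfolding fund_bound_def
  proof (intro conjI allI impI ballI C1')
    fix k :: complex and x assume k: "norm k \<ge> 1" and x: "x \<in> {0..pi}"
    have S: "norm (phi' q h (k\<^sup>2) x) \<le> (norm (- complex_of_real h) + norm k) * exp N * growth k x"
      "norm k * norm (phi q h (k\<^sup>2) x) \<le> (norm (- complex_of_real h) + norm k) * exp N * growth k x"
      using SL_solution_bounds[OF q phi_solution[of "k\<^sup>2" h] k, of 0 x] x
      by (simp_all add: phi_theta_0 N_def)
    have P: "norm (phi' q h (k\<^sup>2) x) \<le> C * norm k * growth k x"
      "norm k * norm (phi q h (k\<^sup>2) x) \<le> C * norm k * growth k x"
      by (rule order_trans[OF S(1) *[OF k]]; simp) (rule order_trans[OF S(2) *[OF k]]; simp)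
    show "norm (phi' q h (k\<^sup>2) x) \<le> C * norm k * growth k x" by (rule P)
    show "norm (phi q h (k\<^sup>2) x) \<le> C * growth k x" by (rule cancel[OF P(2) k refl])
    have S: "norm k * norm (theta q (k\<^sup>2) x) \<le> exp N * growth k x"
      using SL_solution_bounds(2)[OF q theta_solution[of "k\<^sup>2"] k, of 0 x] x
      by (simp add: phi_theta_0 N_def)
    show "norm k * norm (theta q (k\<^sup>2) x) \<le> C * growth k x"
      by (rule order_trans[OF S]) (simp add: C1)
    have S: "norm k * norm (chi q h b (k\<^sup>2) x) \<le> (norm (- complex_of_real b) + norm k) * exp N * growth k (pi - x)"
      using SL_solution_bounds(2)[OF q chi_solution[of "k\<^sup>2" h b] k, of pi x] x
      by (simp add: chi_pi N_def)
    have "norm k * norm (chi q h b (k\<^sup>2) x) \<le> C * norm k * growth k (pi - x)"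
      by (rule order_trans[OF S *[OF k]]) simp_all
    thus "norm (chi q h b (k\<^sup>2) x) \<le> C * growth k (pi - x)" by (rule cancel[OF _ k refl])
  qed
  thus ?thesis ..
qed

text \<open>Since \<open>w^2 = - k^2\<close>, the derivative of
  \<open>exp (w * x) * (y' - w * y)\<close> is \<open>exp (w * x) * q * y\<close>: the spectral
  parameter cancels and the potential enters only through its \<open>L^1\<close> norm. It is used
  with \<open>w = i k\<close> and \<open>w = - i k\<close>.\<close>

lemma exp_mult_solution_bound:
  fixes k w :: complex
  assumes y: "SL_solution q (k\<^sup>2) y y'" and w: "w\<^sup>2 = - k\<^sup>2"
    and bd: "\<And>x. x \<in> {0..pi} \<Longrightarrow> norm (exp (w * of_real x)) * norm (y x) \<le> D"
  shows "norm (exp (w * of_real pi) * (y' pi - w * y pi) - (y' 0 - w * y 0))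
     \<le> D * L1_mass q"
proof -
  have y1: "ac_derivative 0 pi y y'" "ac_derivative 0 pi y' (\<lambda>x. (of_real (q x) - k\<^sup>2) * y x)"
    using y unfolding SL_solution_iff by auto
  have e: "ac_derivative 0 pi (\<lambda>x. exp (w * of_real x)) (\<lambda>x. w * exp (w * of_real x))"
  proof (rule ac_derivative_C1)
    have "((\<lambda>z. exp (w * z)) has_field_derivative (w * exp (w * of_real x))) (at (of_real x))" for x :: real
      by (auto intro!: derivative_eq_intros)
    from has_vector_derivative_real_field[OF this]
    show "((\<lambda>x. exp (w * of_real x)) has_vector_derivative (w * exp (w * of_real x))) (at x)" for x :: real .
  qed (intro continuous_intros)
  note d0 = ac_derivative_mult[OF e ac_derivative_diff[OF y1(2) ac_derivative_linear[OF bounded_linear_mult_right y1(1)]], of w]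
  have w2: "w * (w * z) = - (k\<^sup>2 * z)" for z using w by (metis minus_mult_left mult.assoc power2_eq_square)
  have d: "ac_derivative 0 pi (\<lambda>x. exp (w * of_real x) * (y' x - w * y x)) (\<lambda>x. of_real (q x) * (exp (w * of_real x) * y x))"
    by (rule ac_derivative_cong[OF d0]) (simp_all add: algebra_simps w2)
  have qi: "(\<lambda>x. \<bar>q x\<bar>) absolutely_integrable_on {0..pi}"
    by (rule L1_potential_abs[OF q])
  hence qi': "(\<lambda>x. \<bar>q x\<bar>) integrable_on {0..pi}" by (simp add: absolutely_integrable_on_def)
  have "norm (exp (w * of_real pi) * (y' pi - w * y pi) - exp (w * of_real 0) * (y' 0 - w * y 0))
     \<le> integral {0..pi} (\<lambda>x. D * \<bar>q x\<bar>)"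
  proof (rule ac_derivative_norm_le[OF d])
    have "norm (of_real (q x) * (exp (w * of_real x) * y x)) \<le> D * \<bar>q x\<bar>" if "x \<in> {0<..<pi}" for x
      using mult_left_mono[OF bd[of x], of "\<bar>q x\<bar>"] that by (simp add: norm_mult mult_ac)
    thus "AE x\<in>{0<..<pi} in lebesgue. norm (of_real (q x) * (exp (w * of_real x) * y x)) \<le> D * \<bar>q x\<bar>" by simp
    show "(\<lambda>x. D * \<bar>q x\<bar>) integrable_on {0..pi}" using qi' by (rule integrable_on_mult_right)
  qed simp
  thus ?thesis by (simp add: L1_mass_def)
qed

text \<open>The two choices of \<open>w\<close> separate the exponentials. The combination
  \<open>g = y' - i k y\<close> at pi has size about \<open>norm k * exp (pi * Im k)\<close>, while
  \<open>p = y' + i k y\<close> is of lower order, and \<open>Delta\<close> is half of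
  \<open>g + p\<close> plus the boundary term with \<open>b\<close>.\<close>

lemma Delta_lower_bound:
  obtains K where "K \<ge> 1" "\<And>k. Im k \<ge> K \<Longrightarrow> norm (Delta q h b (k\<^sup>2)) \<ge> norm k * exp (pi * Im k) / 8"
proof -
  obtain C where "fund_bound q h b C" using fund_bounds by blast
  note C = fund_boundD[OF this]
  define N where "N = L1_mass q"
  \<comment> \<open>The error terms may use up a quarter of \<open>norm k\<close>. The term
    \<open>p\<close> already costs half of it, a quarter remains, and the factor 2 in front of
    \<open>Delta\<close> leaves 1/8.\<close>
  define K where "K = max 1 (4 * (2 * \<bar>h\<bar> + 2 * C * N + 2 * \<bar>b\<bar> * C))"
  have "norm (Delta q h b (k\<^sup>2)) \<ge> norm k * exp (pi * Im k) / 8" if k: "Im k \<ge> K" for k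
  proof -
    define \<tau> where "\<tau> = Im k"
    have \<tau>: "\<tau> \<ge> 1" "\<tau> \<ge> K" using k by (auto simp: K_def \<tau>_def)
    have nk: "norm k \<ge> \<tau>" using abs_Im_le_cmod[of k] by (simp add: \<tau>_def)
    have nk1: "norm k \<ge> 1" using nk \<tau> by linarith
    have kK: "norm k \<ge> 4 * (2 * \<bar>h\<bar> + 2 * C * N + 2 * \<bar>b\<bar> * C)" using nk \<tau> unfolding K_def by linarith
    define y y' where "y = phi q h (k\<^sup>2)" and "y' = phi' q h (k\<^sup>2)"
    have ys: "SL_solution q (k\<^sup>2) y y'" unfolding y_def y'_def by (rule phi_solution)
    have y0: "y 0 = 1" "y' 0 = - of_real h" by (auto simp: y_def y'_def phi_theta_0)
    have yb: "norm (y x) \<le> C * exp (\<tau> * x)" if "x \<in> {0..pi}" for x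
      using C(2)[OF nk1 that] \<tau> by (simp add: y_def \<tau>_def)
    define g p where "g = y' pi - \<i> * k * y pi" and "p = y' pi + \<i> * k * y pi"
    have ne: "norm (exp (\<i> * k * of_real x)) = exp (- (\<tau> * x))" "norm (exp (- \<i> * k * of_real x)) = exp (\<tau> * x)" for x :: real
      by (simp_all add: \<tau>_def)
    have 1: "norm (exp (\<i> * k * of_real pi) * g - (y' 0 - \<i> * k * y 0)) \<le> C * N"
      unfolding g_def N_def
    proof (rule exp_mult_solution_bound[OF ys])
      show "norm (exp (\<i> * k * of_real x)) * norm (y x) \<le> C" if "x \<in> {0..pi}" for x
        using mult_left_mono[OF yb[OF that], of "exp (- (\<tau> * x))"] unfolding ne by (simp add: exp_minus field_simps)
    qed (simp add: power_mult_distrib)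
    have 2: "norm (exp (- \<i> * k * of_real pi) * (y' pi - (- \<i> * k) * y pi) - (y' 0 - (- \<i> * k) * y 0)) \<le> (C * exp (2 * (\<tau> * pi))) * N"
      unfolding N_def
    proof (rule exp_mult_solution_bound[OF ys])
      show "norm (exp (- \<i> * k * of_real x)) * norm (y x) \<le> C * exp (2 * (\<tau> * pi))" if x: "x \<in> {0..pi}" for x
      proof -
        have "norm (exp (- \<i> * k * of_real x)) * norm (y x) \<le> exp (\<tau> * x) * (C * exp (\<tau> * x))"
          using mult_left_mono[OF yb[OF x], of "exp (\<tau> * x)"] unfolding ne by simp
        also have "\<dots> = C * exp (2 * (\<tau> * x))" by (simp add: exp_double power2_eq_square)
        also have "\<dots> \<le> C * exp (2 * (\<tau> * pi))" using C(1) x \<tau> by (intro mult_left_mono) auto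
        finally show ?thesis .
      qed
    qed (simp add: power_mult_distrib)
    let ?E = "exp (\<tau> * pi)"
    \<comment> \<open>Needed for the part \<open>norm k * exp (- (\<tau> * pi))\<close> of the bound
      on \<open>p\<close>, which has to be at most half of the main term.\<close>
    have E2: "exp (- (\<tau> * pi)) \<le> ?E / 2"
    proof -
      have "2 \<le> 1 + 2 * (\<tau> * pi)" using \<tau> pi_gt3 mult_mono[of 1 \<tau> 1 pi] by simp
      also have "\<dots> \<le> exp (2 * (\<tau> * pi))" by (rule exp_ge_add_one_self)
      finally have "2 * exp (- (\<tau> * pi)) \<le> exp (2 * (\<tau> * pi)) * exp (- (\<tau> * pi))" by (intro mult_right_mono) auto
      also have "\<dots> = ?E" by (simp add: exp_add[symmetric])
      finally show ?thesis by simp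
    qed
    have ini: "norm (y' 0 - \<i> * k * y 0) \<ge> norm k - \<bar>h\<bar>" "norm (y' 0 - (- \<i> * k) * y 0) \<le> norm k + \<bar>h\<bar>"
    proof -
      have "norm (\<i> * k) - norm (of_real h :: complex) \<le> norm (\<i> * k + of_real h)" by (rule norm_diff_ineq)
      also have "\<dots> = norm (y' 0 - \<i> * k * y 0)" unfolding y0 by (subst norm_minus_cancel[symmetric]) simp
      finally show "norm (y' 0 - \<i> * k * y 0) \<ge> norm k - \<bar>h\<bar>" by (simp add: norm_mult)
      show "norm (y' 0 - (- \<i> * k) * y 0) \<le> norm k + \<bar>h\<bar>"
        unfolding y0 using norm_triangle_ineq[of "\<i> * k" "- of_real h"] by (simp add: norm_mult)
    qed
    have "norm k - \<bar>h\<bar> - C * N \<le> norm (exp (\<i> * k * of_real pi) * g)"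
      using 1 ini(1) norm_triangle_ineq3[of "y' 0 - \<i> * k * y 0" "exp (\<i> * k * of_real pi) * g"]
        norm_minus_commute[of "y' 0 - \<i> * k * y 0" "exp (\<i> * k * of_real pi) * g"] by linarith
    also have "\<dots> = exp (- (\<tau> * pi)) * norm g" unfolding norm_mult ne ..
    finally have G: "?E * (norm k - \<bar>h\<bar> - C * N) \<le> norm g"
      using mult_left_mono[of "norm k - \<bar>h\<bar> - C * N" "exp (- (\<tau> * pi)) * norm g" ?E] by (simp add: exp_minus field_simps)
    have "?E * norm p = norm (exp (- \<i> * k * of_real pi) * p)" unfolding norm_mult ne ..
    also have "\<dots> \<le> (norm k + \<bar>h\<bar>) + (C * exp (2 * (\<tau> * pi))) * N"
      using 2 ini(2) norm_triangle_ineq2[of "exp (- \<i> * k * of_real pi) * p" "y' 0 - (- \<i> * k) * y 0"]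
      unfolding p_def by simp
    also have "exp (2 * (\<tau> * pi)) = ?E * ?E" by (simp add: exp_double power2_eq_square)
    finally have "exp (- (\<tau> * pi)) * (?E * norm p) \<le> exp (- (\<tau> * pi)) * ((norm k + \<bar>h\<bar>) + C * (?E * ?E) * N)"
      by (intro mult_left_mono) auto
    hence "norm p \<le> exp (- (\<tau> * pi)) * (norm k + \<bar>h\<bar>) + ?E * (C * N)"
      by (simp add: exp_minus field_simps)
    also have "\<dots> \<le> ?E / 2 * (norm k + \<bar>h\<bar>) + ?E * (C * N)"
      using E2 by (intro add_right_mono mult_right_mono) auto
    finally have P: "norm p \<le> ?E / 2 * (norm k + \<bar>h\<bar>) + ?E * (C * N)" .
    have "g + p = 2 * Delta q h b (k\<^sup>2) - 2 * of_real b * y pi"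
      unfolding g_def p_def Delta_def y_def y'_def by simp
    hence "g = 2 * Delta q h b (k\<^sup>2) - (2 * of_real b * y pi + p)" by (simp add: algebra_simps eq_diff_eq)
    hence ng: "norm g = norm (2 * Delta q h b (k\<^sup>2) - (2 * of_real b * y pi + p))" by (rule arg_cong)
    have "norm g \<le> norm (2 * Delta q h b (k\<^sup>2)) + (norm (2 * of_real b * y pi) + norm p)"
      using norm_triangle_ineq4[of "2 * Delta q h b (k\<^sup>2)" "2 * of_real b * y pi + p"] norm_triangle_ineq[of "2 * of_real b * y pi" p]
      unfolding ng by linarith
    also have "norm (2 * of_real b * y pi) \<le> 2 * \<bar>b\<bar> * (C * ?E)"
      using yb[of pi] by (simp add: norm_mult mult_left_mono)
    finally have "norm g \<le> 2 * norm (Delta q h b (k\<^sup>2)) + 2 * \<bar>b\<bar> * (C * ?E) + norm p" by (simp add: norm_mult)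
    with G P have "?E * (norm k - \<bar>h\<bar> - C * N) \<le> 2 * norm (Delta q h b (k\<^sup>2)) + 2 * \<bar>b\<bar> * (C * ?E) + (?E / 2 * (norm k + \<bar>h\<bar>) + ?E * (C * N))"
      by linarith
    hence "?E * (norm k / 2 - (3/2 * \<bar>h\<bar> + 2 * C * N + 2 * \<bar>b\<bar> * C)) \<le> 2 * norm (Delta q h b (k\<^sup>2))"
      by (simp add: field_simps)
    moreover have "?E * (norm k / 4) \<le> ?E * (norm k / 2 - (3/2 * \<bar>h\<bar> + 2 * C * N + 2 * \<bar>b\<bar> * C))"
      using kK by (intro mult_left_mono) auto
    ultimately have "?E * (norm k / 4) \<le> 2 * norm (Delta q h b (k\<^sup>2))" by linarith
    thus ?thesis by (simp add: \<tau>_def mult_ac)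
  qed
  moreover have "K \<ge> 1" by (simp add: K_def)
  ultimately show thesis by (rule that[rotated])
qed

end

section \<open>Reality, discreteness and infinitude of the zeros of \<open>Delta\<close>\<close>

context
  fixes q :: "real \<Rightarrow> real"
  assumes q: "L1_potential q"
begin

lemma SL_solution_cnj:
  assumes "SL_solution q \<mu> y y'"
  shows "SL_solution q (cnj \<mu>) (\<lambda>x. cnj (y x)) (\<lambda>x. cnj (y' x))"
proof -
  have a: "ac_derivative 0 pi y y'" "ac_derivative 0 pi y' (\<lambda>x. (of_real (q x) - \<mu>) * y x)"
    using assms unfolding SL_solution_iff by auto
  show ?thesis unfolding SL_solution_iff
    using ac_derivative_linear[OF bounded_linear_cnj a(1)] ac_derivative_linear[OF bounded_linear_cnj a(2)]
    by simp
qed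

lemma phi_cnj:
  assumes "x \<in> {0..pi}"
  shows "phi q h (cnj \<mu>) x = cnj (phi q h \<mu> x)" "phi' q h (cnj \<mu>) x = cnj (phi' q h \<mu> x)"
  using SL_solution_unique[OF q phi_solution[OF q, of "cnj \<mu>" h] SL_solution_cnj[OF phi_solution[OF q, of \<mu> h]], of 0 x] assms
  by (simp_all add: phi_theta_0[OF q])

lemma Delta_cnj: "Delta q h b (cnj \<mu>) = cnj (Delta q h b \<mu>)"
  by (simp add: Delta_def phi_cnj)

lemma phi_of_real:
  assumes "x \<in> {0..pi}"
  shows "phi q h (of_real r) x \<in> \<real>" "phi' q h (of_real r) x \<in> \<real>"
  using phi_cnj[OF assms, of h "of_real r"] by (simp_all add: Reals_cnj_iff)

lemma Delta_of_real: "Delta q h b (of_real r) \<in> \<real>"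
  using Delta_cnj[of h b "of_real r"] by (simp add: Reals_cnj_iff)

text \<open>At \<open>x = pi\<close> this is the norming constant when \<mu> is the eigenvalue.
  Smaller \<open>x\<close> serve to show that \<open>phi\<close> has no zeros at nonreal
  \<mu>.\<close>

definition phi_norm where "phi_norm h \<mu> x = integral {0..x} (\<lambda>t. (norm (phi q h \<mu> t))\<^sup>2)"

lemma phi_norm_continuous:
  assumes "x \<in> {0..pi}"
  shows "continuous_on {0..x} (\<lambda>t. (norm (phi q h \<mu> t))\<^sup>2)"
proof -
  have "continuous_on {0..x} (phi q h \<mu>)"
    by (rule continuous_on_subset[OF phi_continuous(1)[OF q]]) (use assms in auto)
  thus ?thesis by (intro continuous_intros)
qed

lemma phi_norm_integrable:
  "x \<in> {0..pi} \<Longrightarrow> (\<lambda>t. (norm (phi q h \<mu> t))\<^sup>2) integrable_on {0..x}"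
  by (rule integrable_continuous_real[OF phi_norm_continuous])

lemma phi_norm_pos:
  assumes "0 < x" "x \<le> pi"
  shows "phi_norm h \<mu> x > 0"
proof (rule ccontr)
  have nn: "phi_norm h \<mu> x \<ge> 0" unfolding phi_norm_def
    by (intro HK_int_nonneg phi_norm_integrable) (use assms in auto)
  assume "\<not> ?thesis"
  hence "phi_norm h \<mu> x = 0" using nn by simp
  hence "((\<lambda>t. (norm (phi q h \<mu> t))\<^sup>2) has_integral 0) (cbox 0 x)"
    using phi_norm_integrable[of x h \<mu>] assms by (auto simp: phi_norm_def has_integral_iff)
  hence "(norm (phi q h \<mu> 0))\<^sup>2 = 0"
    by (rule has_integral_0_cbox_imp_0[rotated 2])
      (use assms phi_norm_continuous[of x h \<mu>] in simp_all)
  thus False by (simp add: phi_theta_0[OF q])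
qed

text \<open>Lagrange identity of a solution with its complex conjugate. As \<open>b\<close> is real,
  adding \<open>b y\<close> to \<open>y'\<close> leaves the Wronskian unchanged, so at pi the
  boundary expression becomes \<open>Delta\<close>. This is the quantitative form of the reality of
  the spectrum.\<close>

lemma phi_imaginary_identity:
  assumes x: "x \<in> {0..pi}"
  shows "\<bar>Im \<mu>\<bar> * phi_norm h \<mu> x \<le> norm (phi q h \<mu> x) * norm (phi' q h \<mu> x + of_real b * phi q h \<mu> x)"
proof -
  let ?y = "phi q h \<mu>" and ?y' = "phi' q h \<mu>"
  have "((\<lambda>t. ((of_real (q t) - cnj \<mu>) - (of_real (q t) - \<mu>)) * (?y t * cnj (?y t))) has_integral
     ((?y x * cnj (?y' x) - ?y' x * cnj (?y x)) - (?y 0 * cnj (?y' 0) - ?y' 0 * cnj (?y 0)))) {0..x}"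
    by (rule SL_lagrange_integral[OF phi_solution[OF q] SL_solution_cnj[OF phi_solution[OF q]] x])
  moreover have "((of_real (q t) - cnj \<mu>) - (of_real (q t) - \<mu>)) * (?y t * cnj (?y t)) = (\<mu> - cnj \<mu>) * of_real ((norm (?y t))\<^sup>2)" for t
    unfolding complex_norm_square by simp
  ultimately have 1: "((\<lambda>t. (\<mu> - cnj \<mu>) * of_real ((norm (?y t))\<^sup>2)) has_integral
     (?y x * cnj (?y' x) - ?y' x * cnj (?y x))) {0..x}"
    by (simp only: phi_theta_0[OF q]) simp
  have "((\<lambda>t. (norm (?y t))\<^sup>2) has_integral phi_norm h \<mu> x) {0..x}"
    unfolding phi_norm_def by (rule integrable_integral[OF phi_norm_integrable[OF x]])
  from has_integral_linear[OF this bounded_linear_of_real]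
  have "((\<lambda>t. complex_of_real ((norm (?y t))\<^sup>2)) has_integral of_real (phi_norm h \<mu> x)) {0..x}"
    by (simp add: o_def)
  from has_integral_unique[OF 1 has_integral_mult_right[OF this, of "\<mu> - cnj \<mu>"]]
  have "?y x * cnj (?y' x) - ?y' x * cnj (?y x) = (\<mu> - cnj \<mu>) * of_real (phi_norm h \<mu> x)" .
  moreover have "?y x * cnj (?y' x + of_real b * ?y x) - (?y' x + of_real b * ?y x) * cnj (?y x) = ?y x * cnj (?y' x) - ?y' x * cnj (?y x)"
    by (simp add: algebra_simps)
  ultimately have eq: "(\<mu> - cnj \<mu>) * of_real (phi_norm h \<mu> x) =
      ?y x * cnj (?y' x + of_real b * ?y x) - (?y' x + of_real b * ?y x) * cnj (?y x)" by (simp only:)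
  have "norm ((\<mu> - cnj \<mu>) * of_real (phi_norm h \<mu> x)) \<le>
      norm (?y x * cnj (?y' x + of_real b * ?y x)) + norm ((?y' x + of_real b * ?y x) * cnj (?y x))"
    unfolding eq by (rule norm_triangle_ineq4)
  also have "\<dots> = 2 * (norm (?y x) * norm (?y' x + of_real b * ?y x))"
    by (simp only: norm_mult complex_mod_cnj) simp
  also have "norm ((\<mu> - cnj \<mu>) * of_real (phi_norm h \<mu> x)) = 2 * \<bar>Im \<mu>\<bar> * \<bar>phi_norm h \<mu> x\<bar>"
    by (simp add: norm_mult complex_diff_cnj)
  finally have "2 * (\<bar>Im \<mu>\<bar> * \<bar>phi_norm h \<mu> x\<bar>) \<le> 2 * (norm (?y x) * norm (?y' x + of_real b * ?y x))"
    by (simp only: mult.assoc)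
  moreover have "\<bar>Im \<mu>\<bar> * phi_norm h \<mu> x \<le> \<bar>Im \<mu>\<bar> * \<bar>phi_norm h \<mu> x\<bar>"
    by (intro mult_left_mono) auto
  ultimately show ?thesis by linarith
qed

lemma phi_nonzero:
  assumes "Im \<mu> \<noteq> 0" "x \<in> {0..pi}"
  shows "phi q h \<mu> x \<noteq> 0"
proof
  assume 0: "phi q h \<mu> x = 0"
  hence "x \<noteq> 0" using phi_theta_0(1)[OF q, of h \<mu>] by auto
  hence "phi_norm h \<mu> x > 0" using assms(2) by (intro phi_norm_pos) auto
  thus False using phi_imaginary_identity[OF assms(2), of \<mu> h 0] 0 assms(1)
    by (auto simp: mult_le_0_iff)
qed

lemma Delta_nonzero:
  assumes "Im \<mu> \<noteq> 0"
  shows "Delta q h b \<mu> \<noteq> 0"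
proof
  assume "Delta q h b \<mu> = 0"
  thus False using phi_imaginary_identity[of pi \<mu> h b] phi_norm_pos[of pi h \<mu>] assms
    by (auto simp: mult_le_0_iff Delta_def)
qed

text \<open>For bounded \<open>Im k\<close> the exponential lower bound is lost and
  \<open>Delta\<close> has zeros. What survives is the imaginary part identity, combined with a
  lower bound of order \<open>1 / norm k\<close> for the square norm of \<open>phi\<close>. It holds
  uniformly, however close \<open>k^2\<close> comes to an eigenvalue.\<close>

lemma Delta_strip_bound:
  obtains c where "c > 0"
    "\<And>k. norm k \<ge> 1 \<Longrightarrow> \<bar>Im k\<bar> \<le> K \<Longrightarrow> c * \<bar>Im (k\<^sup>2)\<bar> \<le> norm k * norm (Delta q h b (k\<^sup>2))"
proof -
  obtain C where "fund_bound q h b C" using fund_bounds[OF q] by blast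
  note C = fund_boundD[OF this]
  define L where "L = C * exp (\<bar>K\<bar> * pi)"
  have L: "L \<ge> 1" unfolding L_def using C(1) mult_mono[of 1 C 1 "exp (\<bar>K\<bar> * pi)"] by simp
  show thesis
  proof (rule that[of "1 / (8 * L\<^sup>2)"])
    show "1 / (8 * L\<^sup>2) > 0" using L by simp
    fix k :: complex assume k: "norm k \<ge> 1" "\<bar>Im k\<bar> \<le> K"
    let ?y = "phi q h (k\<^sup>2)" and ?D = "Delta q h b (k\<^sup>2)"
    have e: "growth k x \<le> exp (\<bar>K\<bar> * pi)" if "x \<in> {0..pi}" for x
    proof -
      have "\<bar>Im k\<bar> * x \<le> \<bar>K\<bar> * pi" using that k by (intro mult_mono) auto
      thus ?thesis by simp
    qed
    have b1: "norm (?y x) \<le> L" if "x \<in> {0..pi}" for x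
      unfolding L_def by (rule order_trans[OF C(2)[OF k(1) that] mult_left_mono[OF e[OF that]]]) (use C(1) in simp)
    have b2: "norm (phi' q h (k\<^sup>2) x) \<le> L * norm k" if "x \<in> {0..pi}" for x
    proof -
      have "norm (phi' q h (k\<^sup>2) x) \<le> C * norm k * exp (\<bar>K\<bar> * pi)"
        by (rule order_trans[OF C(3)[OF k(1) that] mult_left_mono[OF e[OF that]]]) (use C(1) in simp)
      thus ?thesis by (simp add: L_def mult_ac)
    qed
    \<comment> \<open>Near 0 the slope of \<open>phi\<close> is at most \<open>L * norm k\<close>,
      so \<open>phi\<close> stays within 1/2 of its initial value 1 up to \<open>x0\<close>. Its
      square norm is therefore at least \<open>x0 / 4\<close>.\<close>
    define x0 where "x0 = 1 / (2 * L * norm k)"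
    have Lk: "L * norm k \<ge> 1" using mult_mono[of 1 L 1 "norm k"] L k by simp
    have nz: "L \<noteq> 0" "k \<noteq> 0" using L k by auto
    have x0: "0 < x0" "x0 \<le> pi"
    proof -
      show "0 < x0" using L k by (auto simp: x0_def zero_less_mult_iff)
      have "x0 \<le> 1 / 2" using Lk by (simp add: x0_def divide_simps)
      thus "x0 \<le> pi" using pi_gt3 by simp
    qed
    have half: "norm (?y x) \<ge> 1/2" if x: "x \<in> {0..x0}" for x
    proof -
      have xp: "x \<in> {0..pi}" using x x0 by auto
      have ac: "ac_derivative 0 x (?y) (phi' q h (k\<^sup>2))"
        using phi_solution[OF q, of "k\<^sup>2" h] xp unfolding SL_solution_iff by (auto intro: ac_derivative_subset[of 0 pi])
      have "norm (?y x - ?y 0) \<le> integral {0..x} (\<lambda>_. L * norm k)"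
        by (rule ac_derivative_norm_le[OF ac]) (use xp b2 in auto)
      also have "\<dots> = L * norm k * x" using x by simp
      also have "\<dots> \<le> L * norm k * x0" using x L k by (intro mult_left_mono) auto
      also have "\<dots> = 1/2" using nz by (simp add: x0_def)
      finally have "norm (?y x - 1) \<le> 1/2" by (simp add: phi_theta_0[OF q])
      thus ?thesis using norm_triangle_ineq3[of "?y x" 1] by simp
    qed
    have "1 / (8 * L * norm k) = integral {0..x0} (\<lambda>_. 1/4 :: real)" using x0 by (simp add: x0_def)
    also have "\<dots> \<le> integral {0..x0} (\<lambda>t. (norm (?y t))\<^sup>2)"
    proof (rule HK_int_le)
      show "1/4 \<le> (norm (?y t))\<^sup>2" if "t \<in> {0..x0}" for t
        using power_mono[OF half[OF that], of 2] by (simp add: power2_eq_square)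
    qed (use phi_norm_integrable x0 in auto)
    also have "\<dots> \<le> phi_norm h (k\<^sup>2) pi"
      unfolding phi_norm_def using x0 by (intro integral_subset_le phi_norm_integrable) auto
    finally have "\<bar>Im (k\<^sup>2)\<bar> * (1 / (8 * L * norm k)) \<le> \<bar>Im (k\<^sup>2)\<bar> * phi_norm h (k\<^sup>2) pi" by (intro mult_left_mono) auto
    also have "\<dots> \<le> norm (?y pi) * norm (?D)"
      unfolding Delta_def by (rule phi_imaginary_identity) simp
    also have "\<dots> \<le> L * norm (?D)" using b1[of pi] by (intro mult_right_mono) auto
    finally have "norm k / L * (\<bar>Im (k\<^sup>2)\<bar> * (1 / (8 * L * norm k))) \<le> norm k / L * (L * norm (?D))"
      using L by (intro mult_left_mono) auto
    moreover have "norm k / L * (X * (1 / (8 * L * norm k))) = 1 / (8 * L\<^sup>2) * X" for X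
      using nz by (simp add: power2_eq_square)
    moreover have "norm k / L * (L * X) = norm k * X" for X using nz by simp
    ultimately show "1 / (8 * L\<^sup>2) * \<bar>Im (k\<^sup>2)\<bar> \<le> norm k * norm (?D)"
      by (simp only:)
  qed
qed

definition Delta_zeros where "Delta_zeros h b = {r::real. Delta q h b (of_real r) = 0}"

lemma Delta_zero_iff: "Delta q h b \<mu> = 0 \<longleftrightarrow> \<mu> \<in> complex_of_real ` Delta_zeros h b"
proof
  assume D: "Delta q h b \<mu> = 0"
  hence "Im \<mu> = 0" using Delta_nonzero by blast
  hence "\<mu> = of_real (Re \<mu>)" by (simp add: complex_eq_iff)
  thus "\<mu> \<in> complex_of_real ` Delta_zeros h b" using D by (metis (mono_tags) Delta_zeros_def image_eqI mem_Collect_eq)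
qed (auto simp: Delta_zeros_def)

lemma finite_Delta_zeros: "finite {r \<in> Delta_zeros h b. \<bar>r\<bar> \<le> R}"
proof -
  have nc: "\<not> Delta q h b constant_on UNIV"
  proof
    assume "Delta q h b constant_on UNIV"
    then obtain c where c: "\<And>z. Delta q h b z = c" unfolding constant_on_def by auto
    obtain K where K: "K \<ge> 1" "\<And>k. Im k \<ge> K \<Longrightarrow> norm (Delta q h b (k\<^sup>2)) \<ge> norm k * exp (pi * Im k) / 8"
      using Delta_lower_bound[OF q] by metis
    define t where "t = max K (8 * (norm c + 1))"
    have "norm c \<ge> norm (Complex 0 t) * exp (pi * t) / 8"
      using K(2)[of "Complex 0 t"] by (simp add: c t_def)
    moreover have "norm (Complex 0 t) = t" using K(1) by (simp add: t_def cmod_def)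
    moreover have "t * exp (pi * t) \<ge> t * 1" using K(1) by (intro mult_left_mono) (auto simp: t_def)
    ultimately show False by (simp add: t_def)
  qed
  have "finite {z \<in> cball 0 R. Delta q h b z = 0}"
    by (rule holomorphic_compact_finite_zeros[OF Delta_holomorphic[OF q] _ _ _ _ nc]) auto
  hence "finite {r::real. complex_of_real r \<in> {z \<in> cball 0 R. Delta q h b z = 0}}"
    by (rule finite_vimageI[of _ complex_of_real, unfolded vimage_def]) (simp add: inj_of_real)
  thus ?thesis by (rule rev_finite_subset) (auto simp: Delta_zeros_def)
qed

text \<open>A negative \<open>r\<close> is the square of \<open>k = i * sqrt (- r)\<close>, so a
  very negative zero would lie in the region where \<open>Delta\<close> is bounded below.\<close>

lemma Delta_zeros_bounded_below: "\<exists>m. \<forall>r\<in>Delta_zeros h b. m \<le> r"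
proof -
  obtain K where K: "K \<ge> 1" "\<And>k. Im k \<ge> K \<Longrightarrow> norm (Delta q h b (k\<^sup>2)) \<ge> norm k * exp (pi * Im k) / 8"
    using Delta_lower_bound[OF q] by metis
  have "- (K\<^sup>2) \<le> r" if r: "r \<in> Delta_zeros h b" for r
  proof (rule ccontr)
    assume "\<not> - (K\<^sup>2) \<le> r"
    hence rK: "K\<^sup>2 \<le> - r" by simp
    hence "K \<le> sqrt (- r)" by (rule real_le_rsqrt)
    moreover have "(Complex 0 (sqrt (- r)))\<^sup>2 = of_real r"
    proof -
      have "r \<le> 0" using rK zero_le_power2[of K] by linarith
      thus ?thesis by (simp add: power2_eq_square complex_eq_iff)
    qed
    ultimately have "norm (Complex 0 (sqrt (- r))) * exp (pi * sqrt (- r)) / 8 \<le> 0"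
      using K(2)[of "Complex 0 (sqrt (- r))"] r by (simp add: Delta_zeros_def)
    moreover have "Complex 0 (sqrt (- r)) \<noteq> 0" using \<open>K \<le> sqrt (- r)\<close> K(1) by (auto simp: complex_eq_iff)
    ultimately show False by (simp add: mult_le_0_iff)
  qed
  thus ?thesis by blast
qed

text \<open>At the points \<open>(n + 1/2)\<^sup>2\<close> the value of \<open>Delta\<close> is \<open>(-1)\<^sup>n\<^sup>+\<^sup>1 (n + 1/2) + O(1)\<close>.\<close>

lemma infinite_Delta_zeros: "infinite (Delta_zeros h b)"
proof -
  obtain C where "fund_bound q h b C" using fund_bounds[OF q] by blast
  note C = fund_boundD[OF this]
  define N where "N = L1_mass q"
  define B where "B = C * N + \<bar>h\<bar> + \<bar>b\<bar> * C"
  define \<kappa> where "\<kappa> n = real n + 1/2" for n :: nat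
  define F where "F r = Re (Delta q h b (of_real r))" for r
  have est: "\<bar>F ((\<kappa> n)\<^sup>2) + (-1)^n * \<kappa> n\<bar> \<le> B" if n: "n \<ge> 1" for n
  proof -
    define k where "k = complex_of_real (\<kappa> n)"
    have k1: "norm k \<ge> 1" using n unfolding k_def norm_of_real by (simp add: \<kappa>_def)
    define y y' where "y = phi q h (k\<^sup>2)" and "y' = phi' q h (k\<^sup>2)"
    have y0: "y 0 = 1" "y' 0 = - of_real h" by (auto simp: y_def y'_def phi_theta_0[OF q])
    have k2: "k\<^sup>2 = of_real ((\<kappa> n)\<^sup>2)" by (simp add: k_def)
    have real: "y pi \<in> \<real>" "y' pi \<in> \<real>" unfolding y_def y'_def k2 by (rule phi_of_real; simp)+
    have yb: "norm (y x) \<le> C" if "x \<in> {0..pi}" for x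
      using C(2)[OF k1 that] by (simp add: y_def k_def)
    have e1: "exp (\<i> * k * of_real pi) = \<i> * (-1)^n"
    proof -
      have "\<i> * k * of_real pi = \<i> * (of_real pi / 2) + of_nat n * (\<i> * of_real pi)"
        by (simp add: k_def \<kappa>_def algebra_simps)
      hence "exp (\<i> * k * of_real pi) = exp (\<i> * of_real pi / 2) * exp (\<i> * of_real pi) ^ n"
        by (simp add: exp_add exp_of_nat_mult)
      moreover have "exp (\<i> * of_real pi / 2) = cis (pi / 2)" by (simp add: cis_conv_exp)
      ultimately show ?thesis by (simp add: exp_pi_i' mult.commute)
    qed
    have "norm (exp (\<i> * k * of_real pi) * (y' pi - \<i> * k * y pi) - (y' 0 - \<i> * k * y 0)) \<le> C * N"
      unfolding N_def
    proof (rule exp_mult_solution_bound[OF q])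
      show "SL_solution q (k\<^sup>2) y y'" unfolding y_def y'_def by (rule phi_solution[OF q])
      show "norm (exp (\<i> * k * of_real x)) * norm (y x) \<le> C" if "x \<in> {0..pi}" for x
        using yb[OF that] by (simp add: k_def)
    qed (simp add: power_mult_distrib)
    hence I: "norm (\<i> * (-1)^n * (y' pi - \<i> * k * y pi) + of_real h + \<i> * k) \<le> C * N"
      unfolding e1 y0 by (simp add: algebra_simps)
    \<comment> \<open>Since \<open>phi\<close> and its derivative are real here, the imaginary part
      discards the term with \<open>k * y pi\<close> and isolates \<open>y' pi\<close> together with
      \<open>\<kappa> n\<close>.\<close>
    have "\<bar>Im (\<i> * (-1)^n * (y' pi - \<i> * k * y pi) + of_real h + \<i> * k)\<bar> \<le> C * N"
      by (rule order_trans[OF abs_Im_le_cmod I])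
    moreover have "Im (\<i> * (-1)^n * (y' pi - \<i> * k * y pi) + of_real h + \<i> * k) = (-1)^n * Re (y' pi) + \<kappa> n"
    proof -
      obtain u v where uv: "y pi = of_real u" "y' pi = of_real v" using real by (auto elim!: Reals_cases)
      have m: "(-1 :: complex)^n = of_real ((-1)^n)" by simp
      show ?thesis unfolding uv m k_def by simp
    qed
    ultimately have 1: "\<bar>(-1)^n * Re (y' pi) + \<kappa> n\<bar> \<le> C * N" by simp
    have F: "F ((\<kappa> n)\<^sup>2) = Re (y' pi) + b * Re (y pi)"
      unfolding F_def Delta_def y_def y'_def k2 by simp
    have "\<bar>Re (y pi)\<bar> \<le> C" using yb[of pi] abs_Re_le_cmod[of "y pi"] by simp
    hence 2: "\<bar>b * Re (y pi)\<bar> \<le> \<bar>b\<bar> * C" unfolding abs_mult by (intro mult_left_mono) auto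
    have "\<bar>Re (y' pi) + (-1)^n * \<kappa> n\<bar> \<le> C * N"
      using 1 by (cases "even n") (auto simp: abs_if split: if_splits)
    thus ?thesis unfolding F B_def using 2 by linarith
  qed
  have contF: "continuous_on S F" for S
  proof -
    have "continuous_on S (\<lambda>r::real. Delta q h b (of_real r))"
      by (rule continuous_on_compose2[OF holomorphic_on_imp_continuous_on[OF Delta_holomorphic[OF q]] continuous_on_of_real])
        (auto intro: continuous_on_id)
    thus ?thesis unfolding F_def by (rule continuous_on_Re)
  qed
  have zero: "\<exists>r\<in>Delta_zeros h b. (\<kappa> n)\<^sup>2 \<le> r" if n: "n \<ge> 1" "\<kappa> n > B" for n
  proof -
    have le: "(\<kappa> n)\<^sup>2 \<le> (\<kappa> (Suc n))\<^sup>2" by (intro power_mono) (auto simp: \<kappa>_def)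
    have k': "\<kappa> (Suc n) > B" using n by (simp add: \<kappa>_def)
    have "\<exists>r. (\<kappa> n)\<^sup>2 \<le> r \<and> r \<le> (\<kappa> (Suc n))\<^sup>2 \<and> F r = 0"
    proof (cases "even n")
      case True
      hence "F ((\<kappa> n)\<^sup>2) \<le> 0" "0 \<le> F ((\<kappa> (Suc n))\<^sup>2)"
        using est[of n] est[of "Suc n"] n k' by auto
      thus ?thesis using IVT'[of F _ 0, OF _ _ le contF] by blast
    next
      case False
      hence "0 \<le> F ((\<kappa> n)\<^sup>2)" "F ((\<kappa> (Suc n))\<^sup>2) \<le> 0"
        using est[of n] est[of "Suc n"] n k' by auto
      thus ?thesis using IVT2'[of F _ 0, OF _ _ le contF] by blast
    qed
    then obtain r where r: "(\<kappa> n)\<^sup>2 \<le> r" "F r = 0" by blast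
    have "Delta q h b (of_real r) = 0"
      using r(2) Delta_of_real[of h b r] unfolding F_def by (metis complex_is_Real_iff complex_eq_iff zero_complex.simps)
    thus ?thesis using r(1) by (auto simp: Delta_zeros_def)
  qed
  have "\<exists>r\<in>Delta_zeros h b. R \<le> r" for R
  proof -
    obtain n :: nat where n: "real n > \<bar>R\<bar> + \<bar>B\<bar> + 1" using reals_Archimedean2 by blast
    hence "n \<ge> 1" "\<kappa> n > B" "\<kappa> n \<ge> 1" "\<kappa> n \<ge> \<bar>R\<bar>" by (auto simp: \<kappa>_def)
    moreover have "\<kappa> n * 1 \<le> \<kappa> n * \<kappa> n" using calculation by (intro mult_left_mono) auto
    ultimately have "(\<kappa> n)\<^sup>2 \<ge> R" unfolding power2_eq_square by linarith
    thus ?thesis using zero[OF \<open>n \<ge> 1\<close> \<open>\<kappa> n > B\<close>] by (meson order_trans)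
  qed
  hence "\<not> bdd_above (Delta_zeros h b)"
    unfolding bdd_above_def by (meson gt_ex not_less order_trans less_le_trans)
  thus ?thesis using bdd_above_finite[of "Delta_zeros h b"] by metis
qed

end

section \<open>Increasing enumerations of discrete sets of reals\<close>

lemma enumeration_le:
  fixes e e' :: "nat \<Rightarrow> 'a::linorder"
  assumes "strict_mono e" "strict_mono e'" "range e' \<subseteq> range e"
  shows "e n \<le> e' n"
proof -
  have "\<forall>n. \<exists>m. e' n = e m" using assms(3) by blast
  then obtain m where m: "\<And>n. e' n = e (m n)" by metis
  have "strict_mono m"
  proof (rule strict_monoI)
    fix i j :: nat assume "i < j"
    hence "e (m i) < e (m j)" using strict_monoD[OF assms(2)] m by metis
    thus "m i < m j" using assms(1) by (simp add: strict_mono_less)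
  qed
  hence "n \<le> m n" by (rule strict_mono_imp_increasing)
  thus ?thesis using m assms(1) by (simp add: strict_mono_less_eq)
qed

lemma enumeration_unique:
  fixes e e' :: "nat \<Rightarrow> 'a::linorder"
  assumes "strict_mono e" "strict_mono e'" "range e' = range e"
  shows "e = e'"
  using enumeration_le[of e e'] enumeration_le[of e' e] assms
  by (intro ext antisym) auto

lemma enumeration_exists:
  fixes S :: "real set"
  assumes inf: "infinite S" and fin: "\<And>R. finite {s \<in> S. \<bar>s\<bar> \<le> R}" and bd: "\<exists>m. \<forall>s\<in>S. m \<le> s"
  shows "\<exists>e::nat \<Rightarrow> real. strict_mono e \<and> range e = S"
proof -
  obtain m where m: "\<And>s. s \<in> S \<Longrightarrow> m \<le> s" using bd by blast
  have finb: "finite {s \<in> S. s \<le> t}" for t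
    by (rule finite_subset[OF _ fin[of "\<bar>m\<bar> + \<bar>t\<bar>"]]) (use m in force)
  have ex: "\<exists>s\<in>S. P s \<and> (\<forall>t\<in>S. P t \<longrightarrow> s \<le> t)" if "s0 \<in> S" "P s0" for P s0
  proof -
    let ?A = "{s \<in> S. s \<le> s0 \<and> P s}"
    have A: "finite ?A" by (rule finite_subset[OF _ finb[of s0]]) auto
    have ne: "?A \<noteq> {}" using that by auto
    have "Min ?A \<in> ?A" by (rule Min_in[OF A ne])
    moreover have "Min ?A \<le> t" if "t \<in> S" "P t" for t
    proof (cases "t \<le> s0")
      case True
      thus ?thesis using that A by (intro Min_le) auto
    next
      case False
      thus ?thesis using \<open>Min ?A \<in> ?A\<close> by auto
    qed
    ultimately show ?thesis by blast
  qed
  have up: "\<exists>s\<in>S. x < s" for x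
  proof (rule ccontr)
    assume "\<not> ?thesis"
    hence "S \<subseteq> {s \<in> S. s \<le> x}" by (auto simp: not_less)
    thus False using finb inf finite_subset by blast
  qed
  define nxt where "nxt x = (SOME s. s \<in> S \<and> x < s \<and> (\<forall>t\<in>S. x < t \<longrightarrow> s \<le> t))" for x
  have nxt: "nxt x \<in> S" "x < nxt x" "\<And>t. t \<in> S \<Longrightarrow> x < t \<Longrightarrow> nxt x \<le> t" for x
  proof -
    obtain s0 where "s0 \<in> S" "x < s0" using up by blast
    hence "\<exists>s. s \<in> S \<and> x < s \<and> (\<forall>t\<in>S. x < t \<longrightarrow> s \<le> t)" using ex[of s0 "\<lambda>s. x < s"] by blast
    from someI_ex[OF this] show "nxt x \<in> S" "x < nxt x" "\<And>t. t \<in> S \<Longrightarrow> x < t \<Longrightarrow> nxt x \<le> t"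
      unfolding nxt_def by auto
  qed
  \<comment> \<open>The start \<open>m - 1\<close> lies strictly below \<open>S\<close>, so its
    successor is the least element of \<open>S\<close>.\<close>
  define e where "e = rec_nat (nxt (m - 1)) (\<lambda>_. nxt)"
  have e0: "e 0 = nxt (m - 1)" and eS: "e (Suc n) = nxt (e n)" for n by (simp_all add: e_def)
  have mono: "strict_mono e" using nxt(2) by (simp add: strict_mono_Suc_iff eS)
  have eS': "e n \<in> S" for n by (cases n) (simp_all add: e0 eS nxt(1))
  have "r \<in> range e" if r: "r \<in> S" for r
  proof (rule ccontr)
    assume nr: "r \<notin> range e"
    have "e n \<le> r" for n
    proof (induction n)
      case 0
      thus ?case unfolding e0 using nxt(3)[OF r, of "m - 1"] m[OF r] by simp
    next
      case (Suc n)
      hence "e n < r" using nr by (metis less_le rangeI)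
      thus ?case unfolding eS by (rule nxt(3)[OF r])
    qed
    hence "range e \<subseteq> {s \<in> S. s \<le> r}" using eS' by auto
    hence "finite (range e)" using finb finite_subset by blast
    thus False using strict_mono_imp_inj_on[OF mono] finite_imageD by blast
  qed
  hence "range e = S" using eS' by auto
  thus ?thesis using mono by blast
qed

section \<open>The Weyl function\<close>

text \<open>The coefficient for which \<open>theta + Weyl * phi\<close> satisfies the boundary
  condition at pi: that combination equals \<open>- chi / Delta\<close>.\<close>

definition Weyl where "Weyl q h b \<mu> = - Eta q b \<mu> / Delta q h b \<mu>"

context
  fixes q :: "real \<Rightarrow> real"
  assumes q: "L1_potential q"
begin

lemma SL_spectrum_eq:
  "SL_spectrum q \<alpha> \<beta> = complex_of_real ` Delta_zeros q (cot \<alpha>) (cot \<beta>)"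
proof -
  have "\<mu> \<in> SL_spectrum q \<alpha> \<beta> \<longleftrightarrow> Delta q (cot \<alpha>) (cot \<beta>) \<mu> = 0" for \<mu>
  proof
    assume "\<mu> \<in> SL_spectrum q \<alpha> \<beta>"
    then obtain y y' x where y: "SL_solution q \<mu> y y'" "x \<in> {0..pi}" "y x \<noteq> 0"
      "y 0 * of_real (cot \<alpha>) + y' 0 = 0" "y pi * of_real (cot \<beta>) + y' pi = 0"
      by (auto simp: SL_spectrum_def)
    have z: "SL_solution q \<mu> (\<lambda>x. y 0 * phi q (cot \<alpha>) \<mu> x + 0 * phi q (cot \<alpha>) \<mu> x)
       (\<lambda>x. y 0 * phi' q (cot \<alpha>) \<mu> x + 0 * phi' q (cot \<alpha>) \<mu> x)"
      by (rule SL_solution_linear[OF phi_solution[OF q] phi_solution[OF q]])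
    have "y' 0 = - (y 0 * of_real (cot \<alpha>))" using y(4) by (simp add: eq_neg_iff_add_eq_0 add.commute)
    hence eq: "y t = y 0 * phi q (cot \<alpha>) \<mu> t" "y' t = y 0 * phi' q (cot \<alpha>) \<mu> t" if "t \<in> {0..pi}" for t
      using SL_solution_unique[OF q y(1) z, of 0 t] that by (simp_all add: phi_theta_0[OF q])
    have "y 0 \<noteq> 0" using eq(1)[OF y(2)] y(3) by auto
    moreover have "y 0 * Delta q (cot \<alpha>) (cot \<beta>) \<mu> = 0"
      using y(5) eq[of pi] by (simp add: Delta_def algebra_simps)
    ultimately show "Delta q (cot \<alpha>) (cot \<beta>) \<mu> = 0" by simp
  next
    assume "Delta q (cot \<alpha>) (cot \<beta>) \<mu> = 0"
    thus "\<mu> \<in> SL_spectrum q \<alpha> \<beta>"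
      unfolding SL_spectrum_def
      by (intro CollectI exI[of _ "phi q (cot \<alpha>) \<mu>"] exI[of _ "phi' q (cot \<alpha>) \<mu>"] conjI bexI[of _ 0])
        (auto simp: phi_solution[OF q] phi_theta_0[OF q] Delta_def algebra_simps)
  qed
  thus ?thesis using Delta_zero_iff[OF q] by blast
qed

lemma SL_eigenvalue_enumerates:
  "strict_mono (SL_eigenvalue q \<alpha> \<beta>)" "range (SL_eigenvalue q \<alpha> \<beta>) = Delta_zeros q (cot \<alpha>) (cot \<beta>)"
proof -
  let ?Z = "Delta_zeros q (cot \<alpha>) (cot \<beta>)"
  have iff: "range (\<lambda>n. complex_of_real (e n)) = SL_spectrum q \<alpha> \<beta> \<longleftrightarrow> range e = ?Z" for e :: "nat \<Rightarrow> real"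
  proof -
    have "range (\<lambda>n. complex_of_real (e n)) = complex_of_real ` range e" by (auto simp: image_image)
    thus ?thesis unfolding SL_spectrum_eq by (simp add: inj_image_eq_iff inj_of_real)
  qed
  obtain e :: "nat \<Rightarrow> real" where e: "strict_mono e" "range e = ?Z"
    using enumeration_exists[OF infinite_Delta_zeros[OF q] finite_Delta_zeros[OF q] Delta_zeros_bounded_below[OF q]]
    by blast
  have "SL_eigenvalue q \<alpha> \<beta> = e"
    unfolding SL_eigenvalue_def iff
  proof (rule the_equality)
    fix e' :: "nat \<Rightarrow> real" assume "strict_mono e' \<and> range e' = ?Z"
    thus "e' = e" using e by (intro enumeration_unique) simp_all
  qed (use e in simp)
  thus "strict_mono (SL_eigenvalue q \<alpha> \<beta>)" "range (SL_eigenvalue q \<alpha> \<beta>) = ?Z" using e by auto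
qed

lemma SL_phi_eq:
  assumes "x \<in> {0..pi}"
  shows "SL_phi q \<alpha> \<mu> x = phi q (cot \<alpha>) \<mu> x"
  unfolding SL_phi_def
proof (rule the_equality)
  show "\<exists>y y'. SL_solution q \<mu> y y' \<and> y 0 = 1 \<and> y' 0 = - of_real (cot \<alpha>) \<and> phi q (cot \<alpha>) \<mu> x = y x"
    using phi_solution[OF q] phi_theta_0[OF q] by blast
next
  fix v assume "\<exists>y y'. SL_solution q \<mu> y y' \<and> y 0 = 1 \<and> y' 0 = - of_real (cot \<alpha>) \<and> v = y x"
  then obtain y y' where "SL_solution q \<mu> y y'" "y 0 = 1" "y' 0 = - of_real (cot \<alpha>)" "v = y x" by blast
  thus "v = phi q (cot \<alpha>) \<mu> x"
    using SL_solution_unique(1)[OF q _ phi_solution[OF q, of \<mu> "cot \<alpha>"], of y y' 0 x] assms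
    by (simp add: phi_theta_0[OF q])
qed

lemma SL_norming_eq:
  "SL_norming q \<alpha> \<beta> n = phi_norm q (cot \<alpha>) (of_real (SL_eigenvalue q \<alpha> \<beta> n)) pi"
  unfolding SL_norming_def phi_norm_def[OF q]
  by (rule HK_int_cong) (simp add: SL_phi_eq)

text \<open>The Lagrange identity between \<open>phi\<close> at \<mu> and at the eigenvalue \<nu>
  factors \<open>Delta\<close> as \<open>- (\<mu> - \<nu>) * J \<mu> / P\<close>, where
  \<open>J \<nu>\<close> is the norming constant and \<open>P\<close> the eigenfunction at pi.
  Normalising \<open>chi\<close> to 1 at pi gives \<open>Eta * P = 1\<close> at \<nu>, so the
  residue is \<open>1 / J \<nu>\<close>, and the zero of \<open>Delta\<close> is simple as a
  by-product.\<close>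

lemma Weyl_residue:
  assumes zero: "Delta q h b (of_real r) = 0"
  shows "((\<lambda>\<mu>. Weyl q h b \<mu> * (\<mu> - of_real r)) \<longlongrightarrow> of_real (1 / phi_norm q h (of_real r) pi)) (at (of_real r))"
proof -
  define \<nu> where "\<nu> = complex_of_real r"
  define J where "J \<mu> = integral {0..pi} (\<lambda>t. phi q h \<mu> t * phi q h \<nu> t)" for \<mu>
  define P where "P = phi q h \<nu> pi"
  have J: "(J \<longlongrightarrow> J \<nu>) (at \<nu>)"
    unfolding J_def using sl_y_integral_tendsto[OF q _ phi_continuous(1)[OF q, of h \<nu>], of pi 1 "- complex_of_real h" \<nu>]
    by (simp add: phi_def)
  have "((\<lambda>t. complex_of_real ((norm (phi q h \<nu> t))\<^sup>2)) has_integral of_real (phi_norm q h \<nu> pi)) {0..pi}"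
    using has_integral_linear[OF integrable_integral[OF phi_norm_integrable[OF q, of pi h \<nu>]] bounded_linear_of_real]
    by (simp add: o_def phi_norm_def[OF q])
  moreover have "complex_of_real ((norm (phi q h \<nu> t))\<^sup>2) = phi q h \<nu> t * phi q h \<nu> t" if "t \<in> {0..pi}" for t
    using phi_cnj(1)[OF q that, of h \<nu>] unfolding complex_norm_square by (simp add: \<nu>_def)
  ultimately have "((\<lambda>t. phi q h \<nu> t * phi q h \<nu> t) has_integral of_real (phi_norm q h \<nu> pi)) {0..pi}"
    by (rule has_integral_eq[rotated])
  hence J\<nu>: "J \<nu> = of_real (phi_norm q h \<nu> pi)" unfolding J_def by (rule integral_unique)
  have J0: "J \<nu> \<noteq> 0" unfolding J\<nu> using phi_norm_pos[OF q, of pi h \<nu>] by simp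
  have D\<nu>: "Delta q h b \<nu> = 0" using zero by (simp add: \<nu>_def)
  have EP: "Eta q b \<nu> * P = 1" using chi_pi(1)[OF q, of h b \<nu>] D\<nu> by (simp add: chi_def P_def)
  have P0: "P \<noteq> 0" using EP by auto
  have key: "- P * Delta q h b \<mu> = (\<mu> - \<nu>) * J \<mu>" for \<mu>
  proof -
    have "((\<lambda>t. (\<mu> - \<nu>) * (phi q h \<mu> t * phi q h \<nu> t)) has_integral
       (phi q h \<mu> pi * phi' q h \<nu> pi - phi' q h \<mu> pi * phi q h \<nu> pi)) {0..pi}"
      using SL_lagrange_integral[OF phi_solution[OF q, of \<mu> h] phi_solution[OF q, of \<nu> h], of pi]
      by (simp add: phi_theta_0[OF q])
    hence "(\<mu> - \<nu>) * J \<mu> = phi q h \<mu> pi * phi' q h \<nu> pi - phi' q h \<mu> pi * phi q h \<nu> pi"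
      unfolding J_def by (metis integral_unique integral_mult_right)
    moreover have "phi' q h \<nu> pi = - of_real b * P" using D\<nu> unfolding Delta_def P_def by (simp add: eq_neg_iff_add_eq_0)
    ultimately show ?thesis by (simp add: Delta_def P_def algebra_simps)
  qed
  have ev: "eventually (\<lambda>\<mu>. Eta q b \<mu> * P / J \<mu> = Weyl q h b \<mu> * (\<mu> - \<nu>)) (at \<nu>)"
  proof -
    have "eventually (\<lambda>\<mu>. J \<mu> \<noteq> 0) (at \<nu>)" using tendsto_imp_eventually_ne[OF J J0] .
    moreover have "eventually (\<lambda>\<mu>. \<mu> \<noteq> \<nu>) (at \<nu>)" by (rule eventually_neq_at_within)
    ultimately show ?thesis
    proof eventually_elim
      case (elim \<mu>)
      have "\<mu> - \<nu> \<noteq> 0" using elim by simp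
      moreover have D: "Delta q h b \<mu> = - ((\<mu> - \<nu>) * J \<mu>) / P"
        unfolding key[symmetric] using P0 by simp
      ultimately show ?case unfolding Weyl_def D using elim P0 by (simp add: divide_simps)
    qed
  qed
  have "continuous_on UNIV (Eta q b)" by (rule holomorphic_on_imp_continuous_on[OF Eta_holomorphic[OF q]])
  hence "(Eta q b \<longlongrightarrow> Eta q b \<nu>) (at \<nu>)" by (simp add: continuous_on_eq_continuous_at isCont_def)
  hence "((\<lambda>\<mu>. Eta q b \<mu> * P / J \<mu>) \<longlongrightarrow> Eta q b \<nu> * P / J \<nu>) (at \<nu>)"
    using J J0 by (intro tendsto_intros)
  from Lim_transform_eventually[OF this ev] show ?thesis
    using EP J\<nu> unfolding \<nu>_def by simp
qed

lemma Weyl_holomorphic: "Weyl q h b holomorphic_on - complex_of_real ` Delta_zeros q h b"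
  unfolding Weyl_def[abs_def]
  by (intro holomorphic_intros Eta_holomorphic[OF q] Delta_holomorphic[OF q])
    (simp add: Delta_zero_iff[OF q])

lemma Weyl_strip_bound:
  obtains C where "C \<ge> 0" "\<And>k. norm k \<ge> 1 \<Longrightarrow> \<bar>Im k\<bar> \<le> K \<Longrightarrow> \<bar>Im (k\<^sup>2)\<bar> * norm (Weyl q h b (k\<^sup>2)) \<le> C * norm k"
proof -
  obtain C where "fund_bound q h b C" using fund_bounds[OF q] by blast
  note C = fund_boundD[OF this]
  obtain c where c: "c > 0" "\<And>k. norm k \<ge> 1 \<Longrightarrow> \<bar>Im k\<bar> \<le> K \<Longrightarrow> c * \<bar>Im (k\<^sup>2)\<bar> \<le> norm k * norm (Delta q h b (k\<^sup>2))"
    using Delta_strip_bound[OF q, of K h b] by metis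
  show thesis
  proof (rule that[of "C * exp (\<bar>K\<bar> * pi) / c"])
    show "C * exp (\<bar>K\<bar> * pi) / c \<ge> 0" using C(1) c(1) by simp
    fix k :: complex assume k: "norm k \<ge> 1" "\<bar>Im k\<bar> \<le> K"
    have "norm (Eta q b (k\<^sup>2)) \<le> C * exp (\<bar>Im k\<bar> * pi)" using C(5)[OF k(1), of 0] by (simp add: chi_0[OF q])
    also have "\<dots> \<le> C * exp (\<bar>K\<bar> * pi)" using C(1) k(2) by (intro mult_left_mono) auto
    finally have E: "norm (Eta q b (k\<^sup>2)) \<le> C * exp (\<bar>K\<bar> * pi)" .
    show "\<bar>Im (k\<^sup>2)\<bar> * norm (Weyl q h b (k\<^sup>2)) \<le> C * exp (\<bar>K\<bar> * pi) / c * norm k"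
    proof (cases "Delta q h b (k\<^sup>2) = 0")
      \<comment> \<open>At a zero of \<open>Delta\<close> the quotient \<open>Weyl\<close> is 0 by
        the convention for division by zero.\<close>
      case True
      thus ?thesis using C(1) c(1) by (simp add: Weyl_def)
    next
      case False
      have I: "\<bar>Im (k\<^sup>2)\<bar> \<le> norm k * norm (Delta q h b (k\<^sup>2)) / c" using c(2)[OF k] c(1) by (simp add: field_simps)
      have "\<bar>Im (k\<^sup>2)\<bar> * norm (Weyl q h b (k\<^sup>2)) = \<bar>Im (k\<^sup>2)\<bar> * norm (Eta q b (k\<^sup>2)) / norm (Delta q h b (k\<^sup>2))"
        by (simp add: Weyl_def norm_divide)
      also have "\<dots> \<le> (norm k * norm (Delta q h b (k\<^sup>2)) / c) * (C * exp (\<bar>K\<bar> * pi)) / norm (Delta q h b (k\<^sup>2))"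
        using c(1) by (intro divide_right_mono mult_mono I E) auto
      also have "\<dots> = C * exp (\<bar>K\<bar> * pi) / c * norm k" using False by simp
      finally show ?thesis .
    qed
  qed
qed

end

text \<open>The bound is \<open>B * R\<close> because the length \<open>2 * pi * R\<close> of the
  circle is divided by the \<open>2 * pi\<close> of the residue theorem. The larger radius
  \<open>R'\<close> provides an open set around the closed disc with finitely many
  singularities.\<close>

lemma residue_sum_bound:
  fixes f :: "complex \<Rightarrow> complex"
  assumes "finite pts" and holo: "f holomorphic_on ball 0 R' - pts" and R: "0 < R" "R < R'"
    and sph: "\<And>p. p \<in> pts \<Longrightarrow> norm p \<noteq> R" and pR': "pts \<subseteq> ball 0 R'"
    and B: "\<And>z. norm z = R \<Longrightarrow> norm (f z) \<le> B"
  shows "norm (\<Sum>p\<in>{p\<in>pts. norm p < R}. residue f p) \<le> B * R"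
proof -
  let ?g = "circlepath 0 R"
  have img: "path_image ?g \<subseteq> ball 0 R' - pts" using R sph by (auto simp: dist_norm)
  have "contour_integral ?g f = 2 * pi * \<i> * (\<Sum>p\<in>pts. winding_number ?g p * residue f p)"
  proof (rule Residue_theorem[of "ball 0 R'" pts])
    show "\<forall>z. z \<notin> ball 0 R' \<longrightarrow> winding_number ?g z = 0"
      using R by (auto intro!: winding_number_zero_outside[of _ "cball 0 R"])
  qed (use assms img in auto)
  also have "(\<Sum>p\<in>pts. winding_number ?g p * residue f p) = (\<Sum>p\<in>pts. if norm p < R then residue f p else 0)"
  proof (rule sum.cong)
    fix p assume p: "p \<in> pts"
    show "winding_number ?g p * residue f p = (if norm p < R then residue f p else 0)"
    proof (cases "norm p < R")
      case True
      thus ?thesis by (simp add: winding_number_circlepath)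
    next
      case False
      hence "norm p > R" using sph[OF p] by linarith
      hence "winding_number ?g p = 0"
        using R by (intro winding_number_zero_outside[of _ "cball 0 R"]) auto
      thus ?thesis using False by simp
    qed
  qed simp
  also have "\<dots> = (\<Sum>p\<in>{p\<in>pts. norm p < R}. residue f p)"
    using assms(1) by (simp add: sum.inter_filter)
  finally have eq: "contour_integral ?g f = 2 * pi * \<i> * (\<Sum>p\<in>{p\<in>pts. norm p < R}. residue f p)" .
  have "continuous_on (path_image ?g) f"
    by (rule continuous_on_subset[OF holomorphic_on_imp_continuous_on[OF holo] img])
  hence ci: "(f has_contour_integral contour_integral ?g f) ?g"
    by (intro has_contour_integral_integral contour_integrable_continuous_circlepath)
  have B0: "B \<ge> 0" using order_trans[OF norm_ge_zero B[of "of_real R"]] R by simp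
  have "norm (contour_integral ?g f) \<le> B * (2 * pi * R)"
    by (rule has_contour_integral_bound_circlepath[OF ci B0 R(1)]) (use B in simp)
  thus ?thesis unfolding eq using R by (simp add: norm_mult)
qed

section \<open>Two problems with common eigenvalues\<close>

text \<open>This turns a bound of order \<open>1 / |mu|\<close> for the difference of the Weyl
  functions into \<open>o(1 / |mu|)\<close>. Dominated convergence treats integer \<tau>, and the
  integral is monotone in \<tau>.\<close>

lemma exp_weighted_integral_tendsto_0:
  fixes g :: "real \<Rightarrow> real"
  assumes g: "g absolutely_integrable_on {0..pi}" and "e > 0"
  obtains T where "T \<ge> 0" "\<And>\<tau>. \<tau> \<ge> T \<Longrightarrow> (\<lambda>x. \<bar>g x\<bar> * exp (- (2 * \<tau> * x))) integrable_on {0..pi}"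
    "\<And>\<tau>. \<tau> \<ge> T \<Longrightarrow> integral {0..pi} (\<lambda>x. \<bar>g x\<bar> * exp (- (2 * \<tau> * x))) < e"
proof -
  define f where "f \<tau> x = \<bar>g x\<bar> * exp (- (2 * \<tau> * x))" for \<tau> x
  have ag: "(\<lambda>x. \<bar>g x\<bar>) absolutely_integrable_on {0..pi}"
    using absolutely_integrable_norm[OF g] by (simp add: o_def)
  have fi: "f \<tau> integrable_on {0..pi}" for \<tau>
  proof -
    have "(\<lambda>x. exp (- (2 * \<tau> * x)) * \<bar>g x\<bar>) absolutely_integrable_on {0..pi}"
      by (rule absolutely_integrable_continuous_mult[OF _ ag]) (intro continuous_intros)
    thus ?thesis by (simp add: f_def[abs_def] mult.commute absolutely_integrable_on_def)
  qed
  have "(\<lambda>n. integral {0..pi} (f (real n))) \<longlonglongrightarrow> integral {0..pi} (\<lambda>x. if x \<in> {0} then \<bar>g 0\<bar> else 0)"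
  proof (rule dominated_convergence(2)[where h="\<lambda>x. \<bar>g x\<bar>"])
    show "(\<lambda>x. \<bar>g x\<bar>) integrable_on {0..pi}" using ag by (simp add: absolutely_integrable_on_def)
    show "norm (f (real n) x) \<le> \<bar>g x\<bar>" if "x \<in> {0..pi}" for n x
      using that mult_left_mono[of "exp (- (2 * real n * x))" 1 "\<bar>g x\<bar>"] by (simp add: f_def abs_mult)
    show "(\<lambda>n. f (real n) x) \<longlonglongrightarrow> (if x \<in> {0} then \<bar>g 0\<bar> else 0)" if "x \<in> {0..pi}" for x
    proof (cases "x = 0")
      case False
      hence x: "x > 0" using that by simp
      have "(\<lambda>n. \<bar>g x\<bar> * exp (- (2 * x)) ^ n) \<longlonglongrightarrow> \<bar>g x\<bar> * 0"
        by (intro tendsto_intros LIMSEQ_power_zero) (use x in simp)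
      moreover have "exp (- (2 * x)) ^ n = exp (- (2 * real n * x))" for n
        by (simp add: exp_of_nat_mult[symmetric] mult_ac)
      ultimately show ?thesis using False by (simp add: f_def)
    qed (simp add: f_def)
  qed (rule fi)
  also have "integral {0..pi} (\<lambda>x. if x \<in> {0} then \<bar>g 0\<bar> else 0) = integral {0..pi} (\<lambda>x. 0)"
    by (rule integral_spike[of "{0}"]) auto
  finally have "(\<lambda>n. integral {0..pi} (f (real n))) \<longlonglongrightarrow> 0" by simp
  hence "eventually (\<lambda>n. integral {0..pi} (f (real n)) < e) sequentially"
    using \<open>e > 0\<close> by (rule order_tendstoD(2))
  then obtain n where n: "integral {0..pi} (f (real n)) < e" by (meson eventually_happens sequentially_bot)
  show thesis
  proof (rule that[of "real n"])
    fix \<tau> assume \<tau>: "\<tau> \<ge> real n"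
    show "(\<lambda>x. \<bar>g x\<bar> * exp (- (2 * \<tau> * x))) integrable_on {0..pi}" using fi[of \<tau>] by (simp add: f_def[abs_def])
    have "integral {0..pi} (f \<tau>) \<le> integral {0..pi} (f (real n))"
    proof (rule HK_int_le[OF fi fi])
      fix x :: real assume "x \<in> {0..pi}"
      hence "real n * x \<le> \<tau> * x" using \<tau> by (intro mult_right_mono) auto
      thus "f \<tau> x \<le> f (real n) x" unfolding f_def by (intro mult_left_mono) auto
    qed
    thus "integral {0..pi} (\<lambda>x. \<bar>g x\<bar> * exp (- (2 * \<tau> * x))) < e" using n by (simp add: f_def[abs_def])
  qed simp
qed

section \<open>Square roots in the upper half plane and the weight on a circle\<close>

lemma complex_square_root_upper:
  obtains k :: complex where "k\<^sup>2 = \<mu>" "Im k \<ge> 0"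
proof (cases "Im (csqrt \<mu>) \<ge> 0")
  case True
  show ?thesis by (rule that[of "csqrt \<mu>"]) (use True in auto)
next
  case False
  show ?thesis by (rule that[of "- csqrt \<mu>"]) (use False in auto)
qed

text \<open>On \<open>norm \<mu> = R\<close> the modulus is \<open>(2 * |Im \<mu>| / R) ^ 3\<close>.
  The exponent comes from counting powers inside the parabola: \<open>|Im \<mu>| * norm M\<close> is
  of order \<open>norm k\<close>, \<open>|Im \<mu>|\<close> is at most of that order, and
  \<open>R = (norm k)^2\<close>. With exponent \<open>m\<close>, weight times difference times
  \<open>R\<close> is of order \<open>(norm k)^(2 - m)\<close>, so 3 is the least integer for which
  it tends to 0. At real points of the disc the weight is nonnegative, so it does not disturb the
  signs of residues.\<close>

definition edge_weight :: "real \<Rightarrow> complex \<Rightarrow> complex" where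
  "edge_weight R \<mu> = (1 - \<mu>\<^sup>2 / of_real (R\<^sup>2)) ^ 3"

lemma edge_weight_holomorphic: "edge_weight R holomorphic_on S"
  unfolding edge_weight_def[abs_def] by (cases "R = 0") (auto intro!: holomorphic_intros)

lemma edge_weight_on_circle:
  assumes "norm \<mu> = R" "R > 0"
  shows "norm (edge_weight R \<mu>) = (2 * \<bar>Im \<mu>\<bar> / R) ^ 3"
proof -
  have "complex_of_real (R\<^sup>2) = \<mu> * cnj \<mu>" using assms(1) complex_norm_square[of \<mu>] by simp
  hence "complex_of_real (R\<^sup>2) - \<mu>\<^sup>2 = \<mu> * (cnj \<mu> - \<mu>)" by (simp add: algebra_simps power2_eq_square)
  hence "norm (complex_of_real (R\<^sup>2) - \<mu>\<^sup>2) = norm \<mu> * norm (\<mu> - cnj \<mu>)"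
    by (simp only: norm_mult norm_minus_commute)
  hence n: "norm (complex_of_real (R\<^sup>2) - \<mu>\<^sup>2) = R * (2 * \<bar>Im \<mu>\<bar>)"
    using assms(1) by (simp add: complex_diff_cnj norm_mult)
  have "1 - \<mu>\<^sup>2 / of_real (R\<^sup>2) = (of_real (R\<^sup>2) - \<mu>\<^sup>2) / of_real (R\<^sup>2)" using assms(2) by (simp add: divide_simps)
  hence "norm (1 - \<mu>\<^sup>2 / of_real (R\<^sup>2)) = norm (complex_of_real (R\<^sup>2) - \<mu>\<^sup>2) / norm (complex_of_real (R\<^sup>2))"
    by (simp only: norm_divide)
  also have "\<dots> = 2 * \<bar>Im \<mu>\<bar> / R" unfolding n norm_of_real using assms(2) by (simp add: power2_eq_square)
  finally show ?thesis by (simp only: edge_weight_def norm_power)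
qed

lemma edge_weight_lower:
  assumes "2 * norm z \<le> R" "R > 0"
  shows "norm (edge_weight R z) \<ge> 1/4"
proof -
  have "norm z / R \<le> 1/2" using assms by (simp add: field_simps)
  hence "(norm z / R)\<^sup>2 \<le> (1/2)\<^sup>2" using assms(2) by (intro power_mono) auto
  hence "norm (z\<^sup>2 / of_real (R\<^sup>2)) \<le> 1/4"
    using assms(2) by (simp add: norm_divide norm_power power_divide)
  hence "norm (1 - z\<^sup>2 / of_real (R\<^sup>2)) \<ge> 3/4"
    using norm_triangle_ineq2[of 1 "z\<^sup>2 / of_real (R\<^sup>2)"] by simp
  hence "(3/4) ^ 3 \<le> norm (1 - z\<^sup>2 / of_real (R\<^sup>2)) ^ 3" by (intro power_mono) auto
  hence "1/4 \<le> norm (1 - z\<^sup>2 / of_real (R\<^sup>2)) ^ 3" by (simp add: power3_eq_cube)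
  thus ?thesis by (simp only: edge_weight_def norm_power)
qed

lemma edge_weight_of_real: "edge_weight R (of_real r) = of_real ((1 - (r / R)\<^sup>2) ^ 3)"
  by (simp add: edge_weight_def power_divide)

lemma edge_weight_of_real_bounds:
  fixes r R :: real
  assumes "R > 0"
  shows "\<bar>r\<bar> \<le> R \<Longrightarrow> 0 \<le> (1 - (r / R)\<^sup>2) ^ 3" "2 * \<bar>r\<bar> \<le> R \<Longrightarrow> 1/4 \<le> (1 - (r / R)\<^sup>2) ^ 3"
proof -
  show nn: "0 \<le> (1 - (r / R)\<^sup>2) ^ 3" if "\<bar>r\<bar> \<le> R"
    using that assms abs_square_le_1[of "r / R"] by simp
  show "1/4 \<le> (1 - (r / R)\<^sup>2) ^ 3" if "2 * \<bar>r\<bar> \<le> R"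
    using edge_weight_lower[of "of_real r" R] that assms nn unfolding edge_weight_of_real norm_of_real by simp
qed

context
  fixes q q0 :: "real \<Rightarrow> real" and h b b0 :: real
  assumes q: "L1_potential q" and q0: "L1_potential q0"
begin

text \<open>In the Lagrange identity of \<open>chi\<close> for both problems, the boundary term at 0
  is the numerator of the difference of the Weyl functions and the one at pi is
  \<open>b - b0\<close>. The integrand is of size
  \<open>|q0 - q| * exp (2 * Im k * (pi - x))\<close>, so after division by the two characteristic
  functions the factor \<open>exp (- 2 * Im k * x)\<close> makes the integral small.\<close>

lemma Weyl_difference_upper:
  assumes "\<epsilon> > 0"
  obtains K where "K \<ge> 1" "\<And>k. Im k \<ge> K \<Longrightarrow> norm (Weyl q h b (k\<^sup>2) - Weyl q0 h b0 (k\<^sup>2)) * (norm k)\<^sup>2 \<le> \<epsilon>"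
proof -
  obtain C where "fund_bound q h b C" using fund_bounds[OF q] by blast
  note C = fund_boundD[OF this]
  obtain C0 where "fund_bound q0 h b0 C0" using fund_bounds[OF q0] by blast
  note C0 = fund_boundD[OF this]
  obtain K1 where K1: "K1 \<ge> 1" "\<And>k. Im k \<ge> K1 \<Longrightarrow> norm (Delta q h b (k\<^sup>2)) \<ge> norm k * exp (pi * Im k) / 8"
    using Delta_lower_bound[OF q] by metis
  obtain K0 where K0: "K0 \<ge> 1" "\<And>k. Im k \<ge> K0 \<Longrightarrow> norm (Delta q0 h b0 (k\<^sup>2)) \<ge> norm k * exp (pi * Im k) / 8"
    using Delta_lower_bound[OF q0] by metis
  define g where "g x = q0 x - q x" for x
  have g: "g absolutely_integrable_on {0..pi}" unfolding g_def
    using L1_potential_integrable q q0 by (intro set_integral_diff) auto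
  \<comment> \<open>Each lower bound for a characteristic function costs a factor 8. The resulting
    64 is doubled because the integral and the boundary term \<open>b - b0\<close> get one half of
    \<epsilon> each.\<close>
  define e where "e = \<epsilon> / (128 * (C * C0))"
  have e: "e > 0" using assms C C0 by (simp add: e_def)
  obtain T where T: "T \<ge> 0" "\<And>\<tau>. \<tau> \<ge> T \<Longrightarrow> (\<lambda>x. \<bar>g x\<bar> * exp (- (2 * \<tau> * x))) integrable_on {0..pi}"
    "\<And>\<tau>. \<tau> \<ge> T \<Longrightarrow> integral {0..pi} (\<lambda>x. \<bar>g x\<bar> * exp (- (2 * \<tau> * x))) < e"
    by (rule exp_weighted_integral_tendsto_0[OF g e]) (erule that, blast+)
  define K where "K = Max {K1, K0, T, 128 * \<bar>b - b0\<bar> / \<epsilon>}"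
  have "norm (Weyl q h b (k\<^sup>2) - Weyl q0 h b0 (k\<^sup>2)) * (norm k)\<^sup>2 \<le> \<epsilon>" if k: "Im k \<ge> K" for k
  proof -
    define \<tau> where "\<tau> = Im k"
    have \<tau>: "\<tau> \<ge> K1" "\<tau> \<ge> K0" "\<tau> \<ge> T" "\<tau> \<ge> 128 * \<bar>b - b0\<bar> / \<epsilon>" using k by (auto simp: K_def \<tau>_def)
    have \<tau>1: "\<tau> \<ge> 1" using \<tau>(1) K1(1) by linarith
    have nk: "norm k \<ge> 1" using abs_Im_le_cmod[of k] \<tau>1 by (simp add: \<tau>_def)
    let ?D = "Delta q h b (k\<^sup>2)" and ?Dz = "Delta q0 h b0 (k\<^sup>2)"
    let ?E = "Eta q b (k\<^sup>2)" and ?Ez = "Eta q0 b0 (k\<^sup>2)"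
    let ?y = "chi q h b (k\<^sup>2)" and ?z = "chi q0 h b0 (k\<^sup>2)"
    define L where "L = norm k * exp (pi * \<tau>) / 8"
    have L0: "L > 0" using nk by (auto simp: L_def intro!: mult_pos_pos)
    have DL: "norm ?D \<ge> L" "norm ?Dz \<ge> L" using K1(2)[of k] K0(2)[of k] \<tau> by (auto simp: L_def \<tau>_def)
    have nz: "?D \<noteq> 0" "?Dz \<noteq> 0" using DL L0 by auto
    have I: "((\<lambda>x. of_real (g x) * (?y x * ?z x)) has_integral
        ((of_real b - of_real b0) - (?D * ?Ez - ?E * ?Dz))) {0..pi}"
      using SL_lagrange_integral[OF chi_solution[OF q, of "k\<^sup>2" h b] chi_solution[OF q0, of "k\<^sup>2" h b0], of pi]
      by (simp add: chi_0[OF q] chi_0[OF q0] chi_pi[OF q] chi_pi[OF q0] g_def algebra_simps)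
    have "norm ((of_real b - of_real b0) - (?D * ?Ez - ?E * ?Dz)) \<le>
        integral {0..pi} (\<lambda>x. C * C0 * exp (2 * (pi * \<tau>)) * (\<bar>g x\<bar> * exp (- (2 * \<tau> * x))))"
      unfolding integral_unique[OF I, symmetric]
    proof (rule HK_norm_bound)
      show "(\<lambda>x. of_real (g x) * (?y x * ?z x)) integrable_on {0..pi}" using I by blast
      show "(\<lambda>x. C * C0 * exp (2 * (pi * \<tau>)) * (\<bar>g x\<bar> * exp (- (2 * \<tau> * x)))) integrable_on {0..pi}"
        by (rule integrable_on_mult_right[OF T(2)[OF \<tau>(3)]])
      fix x assume x: "x \<in> {0..pi}"
      have "norm (?y x) * norm (?z x) \<le> (C * growth k (pi - x)) * (C0 * growth k (pi - x))"
        using C(1) by (intro mult_mono C(5)[OF nk x] C0(5)[OF nk x]) auto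
      also have "\<dots> = C * C0 * exp (2 * (pi * \<tau>)) * exp (- (2 * \<tau> * x))"
        using \<tau>1 by (simp add: \<tau>_def exp_add[symmetric] algebra_simps)
      finally have "\<bar>g x\<bar> * (norm (?y x) * norm (?z x)) \<le> \<bar>g x\<bar> * (C * C0 * exp (2 * (pi * \<tau>)) * exp (- (2 * \<tau> * x)))"
        by (intro mult_left_mono) auto
      thus "norm (of_real (g x) * (?y x * ?z x)) \<le>
          C * C0 * exp (2 * (pi * \<tau>)) * (\<bar>g x\<bar> * exp (- (2 * \<tau> * x)))"
        by (simp add: norm_mult mult_ac)
    qed
    also have "\<dots> \<le> C * C0 * exp (2 * (pi * \<tau>)) * e"
      unfolding integral_mult_right using T(3)[OF \<tau>(3)] C(1) C0(1) by (intro mult_left_mono) auto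
    also have "\<dots> = exp (2 * (pi * \<tau>)) * (\<epsilon> / 128)" using C(1) C0(1) by (simp add: e_def)
    finally have 1: "norm ((of_real b - of_real b0) - (?D * ?Ez - ?E * ?Dz)) \<le> exp (2 * (pi * \<tau>)) * (\<epsilon> / 128)" .
    have "128 * \<bar>b - b0\<bar> \<le> \<epsilon> * \<tau>" using \<tau>(4) assms by (simp add: field_simps)
    also have "\<dots> \<le> \<epsilon> * exp (2 * (pi * \<tau>))"
    proof -
      have "\<tau> \<le> 2 * (pi * \<tau>)" using \<tau>1 pi_gt3 mult_right_mono[of 1 "2 * pi" \<tau>] by simp
      also have "\<dots> \<le> exp (2 * (pi * \<tau>))" using exp_ge_add_one_self[of "2 * (pi * \<tau>)"] by linarith
      finally show ?thesis using assms by (intro mult_left_mono) auto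
    qed
    finally have 2: "norm (complex_of_real b - of_real b0) \<le> exp (2 * (pi * \<tau>)) * (\<epsilon> / 128)"
      by (simp flip: of_real_diff add: mult.commute)
    have "norm (?D * ?Ez - ?E * ?Dz) \<le> norm ((of_real b - of_real b0) - (?D * ?Ez - ?E * ?Dz)) + norm (complex_of_real b - of_real b0)"
      using norm_triangle_sub[of "?D * ?Ez - ?E * ?Dz" "complex_of_real b - of_real b0"]
      by (simp add: norm_minus_commute)
    with 1 2 have 3: "norm (?D * ?Ez - ?E * ?Dz) \<le> exp (2 * (pi * \<tau>)) * (\<epsilon> / 64)" by linarith
    have "Weyl q h b (k\<^sup>2) - Weyl q0 h b0 (k\<^sup>2) = (?D * ?Ez - ?E * ?Dz) / (?D * ?Dz)"
      using nz by (simp add: Weyl_def divide_simps)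
    hence "norm (Weyl q h b (k\<^sup>2) - Weyl q0 h b0 (k\<^sup>2)) = norm (?D * ?Ez - ?E * ?Dz) / (norm ?D * norm ?Dz)"
      by (simp add: norm_divide norm_mult)
    also have "\<dots> \<le> (exp (2 * (pi * \<tau>)) * (\<epsilon> / 64)) / (L * L)"
      using L0 DL 3 assms by (intro frac_le mult_mono) auto
    also have "\<dots> = \<epsilon> / (norm k)\<^sup>2"
      unfolding L_def exp_double using nk by (auto simp: field_simps power2_eq_square)
    finally have "norm (Weyl q h b (k\<^sup>2) - Weyl q0 h b0 (k\<^sup>2)) \<le> \<epsilon> / (norm k)\<^sup>2" .
    moreover have "(norm k)\<^sup>2 > 0" using nk by (intro zero_less_power) linarith
    ultimately show ?thesis by (simp only: pos_le_divide_eq)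
  qed
  moreover have "K \<ge> 1" using K1(1) by (simp add: K_def max_def)
  ultimately show thesis by (rule that[rotated])
qed

section \<open>The difference of the Weyl functions on large circles, and its residues\<close>

definition Weyl_diff where "Weyl_diff \<mu> = Weyl q h b \<mu> - Weyl q0 h b0 \<mu>"

lemma Weyl_diff_circle_bound:
  assumes "\<epsilon> > 0"
  obtains R0 where "R0 \<ge> 1" "\<And>R \<mu>. R \<ge> R0 \<Longrightarrow> norm \<mu> = R \<Longrightarrow> norm (Weyl_diff \<mu> * edge_weight R \<mu>) * R \<le> \<epsilon>"
proof -
  \<comment> \<open>The weight is at most \<open>2 ^ 3\<close> on the circle, hence
    \<open>\<epsilon> / 8\<close>.\<close>
  obtain K where K: "K \<ge> 1" "\<And>k. Im k \<ge> K \<Longrightarrow> norm (Weyl q h b (k\<^sup>2) - Weyl q0 h b0 (k\<^sup>2)) * (norm k)\<^sup>2 \<le> \<epsilon> / 8"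
    using Weyl_difference_upper[of "\<epsilon> / 8"] assms by (metis divide_pos_pos zero_less_numeral)
  obtain C where C: "C \<ge> 0" "\<And>k. norm k \<ge> 1 \<Longrightarrow> \<bar>Im k\<bar> \<le> K \<Longrightarrow> \<bar>Im (k\<^sup>2)\<bar> * norm (Weyl q h b (k\<^sup>2)) \<le> C * norm k"
    using Weyl_strip_bound[OF q, of K h b] by metis
  obtain C0 where C0: "C0 \<ge> 0" "\<And>k. norm k \<ge> 1 \<Longrightarrow> \<bar>Im k\<bar> \<le> K \<Longrightarrow> \<bar>Im (k\<^sup>2)\<bar> * norm (Weyl q0 h b0 (k\<^sup>2)) \<le> C0 * norm k"
    using Weyl_strip_bound[OF q0, of K h b0] by metis
  \<comment> \<open>The factor 32 is 8 from the cube of 2 in the weight times 4 from squaring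
    \<open>|Im \<mu>| <= 2 * (norm k * K)\<close>. Inside the parabola the quantity to be bounded is
    then at most \<open>A / norm k\<close>.\<close>
  define A where "A = 32 * (C + C0) * K\<^sup>2"
  define A' where "A' = max 1 (4 * A / \<epsilon>)"
  show thesis
  proof (rule that[of "A'\<^sup>2"])
    show "A'\<^sup>2 \<ge> 1" by (simp add: A'_def)
    fix R :: real and \<mu> :: complex assume R: "R \<ge> A'\<^sup>2" and \<mu>: "norm \<mu> = R"
    have A'1: "A' \<ge> 1" by (simp add: A'_def)
    hence "A'\<^sup>2 \<ge> 1" by simp
    hence R1: "R \<ge> 1" using R by linarith
    obtain k where k: "k\<^sup>2 = \<mu>" "Im k \<ge> 0" using complex_square_root_upper by blast
    have nk: "(norm k)\<^sup>2 = R" using \<mu> k(1) by (metis norm_power)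
    have nkA: "norm k \<ge> A'" using R nk by (metis norm_ge_zero power2_le_imp_le)
    hence nk1: "norm k \<ge> 1" using A'1 by linarith
    have w: "norm (edge_weight R \<mu>) = (2 * \<bar>Im \<mu>\<bar> / R) ^ 3"
      using edge_weight_on_circle[OF \<mu>] R1 by simp
    show "norm (Weyl_diff \<mu> * edge_weight R \<mu>) * R \<le> \<epsilon>"
    proof (cases "Im k \<ge> K")
      case True
      have "2 * \<bar>Im \<mu>\<bar> / R \<le> 2" using abs_Im_le_cmod[of \<mu>] \<mu> R1 by (simp add: field_simps)
      hence "norm (edge_weight R \<mu>) \<le> 2 ^ 3" unfolding w using R1 by (intro power_mono) auto
      moreover have "norm (Weyl_diff \<mu>) * R \<le> \<epsilon> / 8" using K(2)[OF True] k(1) nk by (simp add: Weyl_diff_def)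
      ultimately have "(norm (Weyl_diff \<mu>) * R) * norm (edge_weight R \<mu>) \<le> (\<epsilon> / 8) * 2 ^ 3"
        using assms by (intro mult_mono) auto
      thus ?thesis by (simp add: norm_mult mult_ac)
    next
      case False
      hence ik: "\<bar>Im k\<bar> \<le> K" using k(2) by simp
      have "\<bar>Im \<mu>\<bar> * norm (Weyl_diff \<mu>) \<le> \<bar>Im \<mu>\<bar> * norm (Weyl q h b \<mu>) + \<bar>Im \<mu>\<bar> * norm (Weyl q0 h b0 \<mu>)"
        unfolding Weyl_diff_def distrib_left[symmetric] by (intro mult_left_mono norm_triangle_ineq4) auto
      also have "\<dots> \<le> (C + C0) * norm k" using C(2)[OF nk1 ik] C0(2)[OF nk1 ik] k(1) by (simp add: distrib_right)
      finally have 1: "\<bar>Im \<mu>\<bar> * norm (Weyl_diff \<mu>) \<le> (C + C0) * norm k" .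
      have "\<bar>Im \<mu>\<bar> = 2 * (\<bar>Re k\<bar> * \<bar>Im k\<bar>)" unfolding k(1)[symmetric] by (simp add: power2_eq_square abs_mult)
      also have "\<dots> \<le> 2 * (norm k * K)" using ik abs_Re_le_cmod[of k] by (intro mult_left_mono mult_mono) auto
      finally have 2: "\<bar>Im \<mu>\<bar> \<le> 2 * (norm k * K)" .
      have "norm (Weyl_diff \<mu> * edge_weight R \<mu>) * R = (\<bar>Im \<mu>\<bar> * norm (Weyl_diff \<mu>)) * (8 * \<bar>Im \<mu>\<bar>\<^sup>2 / R\<^sup>2)"
        unfolding norm_mult w using R1 by (simp add: power2_eq_square power3_eq_cube)
      also have "\<dots> \<le> ((C + C0) * norm k) * (8 * (2 * (norm k * K))\<^sup>2 / R\<^sup>2)"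
        using C(1) C0(1) 2 by (intro mult_mono 1 divide_right_mono power_mono) auto
      also have "\<dots> = A / norm k"
        unfolding nk[symmetric] A_def using nk1 by (auto simp: power2_eq_square field_simps)
      also have "\<dots> \<le> \<epsilon>"
      proof -
        have "4 * A / \<epsilon> \<le> norm k" using nkA by (simp add: A'_def)
        hence "4 * A \<le> \<epsilon> * norm k" using assms by (simp add: field_simps)
        moreover have "A \<ge> 0" using C(1) C0(1) by (simp add: A_def)
        ultimately have "A \<le> \<epsilon> * norm k" by linarith
        moreover have "norm k > 0" using nk1 by linarith
        ultimately show ?thesis by (simp only: pos_divide_le_eq)
      qed
      finally show ?thesis .
    qed
  qed
qed

lemma Weyl_diff_residue:
  assumes Z: "Delta_zeros q h b = Delta_zeros q0 h b0" and r: "r \<in> Delta_zeros q h b"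
    and g: "g holomorphic_on T" "open T" "complex_of_real r \<in> T"
  shows "residue (\<lambda>\<mu>. Weyl_diff \<mu> * g \<mu>) (of_real r) =
    of_real (1 / phi_norm q h (of_real r) pi - 1 / phi_norm q0 h (of_real r) pi) * g (of_real r)"
proof -
  define A where "A = complex_of_real ` ({s \<in> Delta_zeros q h b. \<bar>s\<bar> \<le> \<bar>r\<bar> + 1} - {r})"
  define S where "S = T \<inter> ball 0 (\<bar>r\<bar> + 1) - A"
  have "finite A" unfolding A_def using finite_Delta_zeros[OF q, of h b "\<bar>r\<bar> + 1"] by blast
  hence S: "open S" unfolding S_def using g(2) by (intro open_Diff open_Int finite_imp_closed) auto
  have rS: "complex_of_real r \<in> S" using g(3) by (auto simp: S_def A_def)
  have sub: "S - {complex_of_real r} \<subseteq> - complex_of_real ` Delta_zeros q h b"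
    by (auto simp: S_def A_def)
  have "Weyl q h b holomorphic_on S - {complex_of_real r}" "Weyl q0 h b0 holomorphic_on S - {complex_of_real r}"
    using holomorphic_on_subset[OF Weyl_holomorphic[OF q] sub]
      holomorphic_on_subset[OF Weyl_holomorphic[OF q0] sub[unfolded Z]] by auto
  moreover have "g holomorphic_on S - {complex_of_real r}" using g(1) by (rule holomorphic_on_subset) (auto simp: S_def)
  ultimately have hol: "(\<lambda>\<mu>. Weyl_diff \<mu> * g \<mu>) holomorphic_on S - {complex_of_real r}"
    unfolding Weyl_diff_def by (intro holomorphic_intros)
  have "continuous_on T g" using g(1) by (rule holomorphic_on_imp_continuous_on)
  hence "(g \<longlongrightarrow> g (of_real r)) (at (of_real r))"
    using g(2,3) by (simp add: continuous_on_eq_continuous_at isCont_def)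
  moreover have "((\<lambda>\<mu>. Weyl q h b \<mu> * (\<mu> - of_real r)) \<longlongrightarrow> of_real (1 / phi_norm q h (of_real r) pi)) (at (of_real r))"
    using r by (intro Weyl_residue[OF q]) (auto simp: Delta_zeros_def[OF q])
  moreover have "((\<lambda>\<mu>. Weyl q0 h b0 \<mu> * (\<mu> - of_real r)) \<longlongrightarrow> of_real (1 / phi_norm q0 h (of_real r) pi)) (at (of_real r))"
    using r unfolding Z by (intro Weyl_residue[OF q0]) (auto simp: Delta_zeros_def[OF q0])
  ultimately have "((\<lambda>\<mu>. (Weyl q h b \<mu> * (\<mu> - of_real r) - Weyl q0 h b0 \<mu> * (\<mu> - of_real r)) * g \<mu>) \<longlongrightarrow>
      (of_real (1 / phi_norm q h (of_real r) pi) - of_real (1 / phi_norm q0 h (of_real r) pi)) * g (of_real r)) (at (of_real r))"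
    by (intro tendsto_mult tendsto_diff)
  hence "((\<lambda>\<mu>. (Weyl_diff \<mu> * g \<mu>) * (\<mu> - of_real r)) \<longlongrightarrow>
      of_real (1 / phi_norm q h (of_real r) pi - 1 / phi_norm q0 h (of_real r) pi) * g (of_real r)) (at (of_real r))"
    by (simp add: Weyl_diff_def algebra_simps)
  thus ?thesis by (rule residue_simple'[OF S rS hol])
qed

lemma avoiding_radius:
  obtains R where "R \<ge> X" "\<And>r. r \<in> Delta_zeros q h b \<Longrightarrow> \<bar>r\<bar> \<noteq> R"
proof -
  have "finite (abs ` {r \<in> Delta_zeros q h b. \<bar>r\<bar> \<le> X + 1})" using finite_Delta_zeros[OF q] by blast
  moreover have "infinite {X..X + 1}" by (simp add: infinite_Icc)
  ultimately have "\<not> {X..X + 1} \<subseteq> abs ` {r \<in> Delta_zeros q h b. \<bar>r\<bar> \<le> X + 1}" using finite_subset by blast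
  then obtain R where "R \<in> {X..X + 1}" "R \<notin> abs ` {r \<in> Delta_zeros q h b. \<bar>r\<bar> \<le> X + 1}" by blast
  thus thesis by (intro that[of R]) auto
qed

lemma Weyl_diff_good_radius:
  assumes "\<epsilon> > 0"
  obtains R where "R \<ge> X" "R > 0" "\<And>r. r \<in> Delta_zeros q h b \<Longrightarrow> \<bar>r\<bar> \<noteq> R"
    "\<And>\<mu>. norm \<mu> = R \<Longrightarrow> norm (Weyl_diff \<mu> * edge_weight R \<mu>) \<le> \<epsilon> / R"
proof -
  obtain R0 where R0: "R0 \<ge> 1" "\<And>R \<mu>. R \<ge> R0 \<Longrightarrow> norm \<mu> = R \<Longrightarrow> norm (Weyl_diff \<mu> * edge_weight R \<mu>) * R \<le> \<epsilon>"
    using Weyl_diff_circle_bound[OF assms] by blast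
  obtain R where R: "R \<ge> max R0 X" "\<And>r. r \<in> Delta_zeros q h b \<Longrightarrow> \<bar>r\<bar> \<noteq> R"
    using avoiding_radius by blast
  thus thesis using R0 by (intro that[of R]) (auto simp: pos_le_divide_eq)
qed

text \<open>\<open>A\<close> holds the poles of \<open>g\<close> itself: it is empty when
  \<open>g\<close> is the weight and \<open>{z}\<close> when \<open>g\<close> is the weight times
  the Cauchy kernel at \<open>z\<close>.\<close>

lemma Weyl_diff_residue_sum_bound:
  assumes Z: "Delta_zeros q h b = Delta_zeros q0 h b0"
    and R: "R > 0" "\<And>r. r \<in> Delta_zeros q h b \<Longrightarrow> \<bar>r\<bar> \<noteq> R"
    and A: "finite A" "\<And>z. z \<in> A \<Longrightarrow> norm z < R"
    and g: "g holomorphic_on - A" and B: "\<And>\<mu>. norm \<mu> = R \<Longrightarrow> norm (Weyl_diff \<mu> * g \<mu>) \<le> B"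
  shows "norm (\<Sum>p\<in>complex_of_real ` {r \<in> Delta_zeros q h b. \<bar>r\<bar> < R} \<union> A. residue (\<lambda>\<mu>. Weyl_diff \<mu> * g \<mu>) p) \<le> B * R"
proof -
  \<comment> \<open>Poles are listed up to \<open>R + 1\<close>, so that a neighbourhood of the
    closed disc is free of others.\<close>
  define pts where "pts = complex_of_real ` {r \<in> Delta_zeros q h b. \<bar>r\<bar> < R + 1} \<union> A"
  have "finite {r \<in> Delta_zeros q h b. \<bar>r\<bar> < R + 1}"
    by (rule finite_subset[OF _ finite_Delta_zeros[OF q, of h b "R + 1"]]) auto
  hence fin: "finite pts" using A(1) by (simp add: pts_def)
  have sub: "ball 0 (R + 1) - pts \<subseteq> - complex_of_real ` Delta_zeros q h b" "ball 0 (R + 1) - pts \<subseteq> - A"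
    by (auto simp: pts_def)
  have "Weyl q h b holomorphic_on ball 0 (R + 1) - pts" "Weyl q0 h b0 holomorphic_on ball 0 (R + 1) - pts"
    using holomorphic_on_subset[OF Weyl_holomorphic[OF q] sub(1)]
      holomorphic_on_subset[OF Weyl_holomorphic[OF q0] sub(1)[unfolded Z]] by auto
  moreover have "g holomorphic_on ball 0 (R + 1) - pts" by (rule holomorphic_on_subset[OF g sub(2)])
  ultimately have hol: "(\<lambda>\<mu>. Weyl_diff \<mu> * g \<mu>) holomorphic_on ball 0 (R + 1) - pts"
    unfolding Weyl_diff_def by (intro holomorphic_intros)
  have "norm (\<Sum>p\<in>{p\<in>pts. norm p < R}. residue (\<lambda>\<mu>. Weyl_diff \<mu> * g \<mu>) p) \<le> B * R"
  proof (rule residue_sum_bound[OF fin hol R(1)])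
    show "norm p \<noteq> R" if p: "p \<in> pts" for p
    proof (cases "p \<in> A")
      case True
      thus ?thesis using A(2)[of p] by simp
    next
      case False
      then obtain r where "r \<in> Delta_zeros q h b" "p = of_real r" using p by (auto simp: pts_def)
      thus ?thesis using R(2)[of r] by simp
    qed
    show "pts \<subseteq> ball 0 (R + 1)" using A(2) by (force simp: pts_def)
  qed (use B in auto)
  moreover have "{p\<in>pts. norm p < R} = complex_of_real ` {r \<in> Delta_zeros q h b. \<bar>r\<bar> < R} \<union> A"
    using A(2) by (auto simp: pts_def)
  ultimately show ?thesis by simp
qed

text \<open>The contour estimate controls only the whole weighted sum of the \<open>c r\<close>. As
  no term is negative, a single term is bounded by the sum and nothing can cancel, so letting the
  radius grow forces each \<open>c s\<close> to be 0.\<close>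

lemma norming_constants_eq:
  assumes Z: "Delta_zeros q h b = Delta_zeros q0 h b0"
    and N: "\<And>r. r \<in> Delta_zeros q h b \<Longrightarrow> phi_norm q0 h (of_real r) pi \<le> phi_norm q h (of_real r) pi"
    and s: "s \<in> Delta_zeros q h b"
  shows "phi_norm q h (of_real s) pi = phi_norm q0 h (of_real s) pi"
proof -
  define c where "c r = 1 / phi_norm q0 h (of_real r) pi - 1 / phi_norm q h (of_real r) pi" for r :: real
  have pos: "phi_norm q h \<mu> pi > 0" "phi_norm q0 h \<mu> pi > 0" for \<mu>
    by (rule phi_norm_pos[OF q]; simp) (rule phi_norm_pos[OF q0]; simp)
  have c0: "c r \<ge> 0" if "r \<in> Delta_zeros q h b" for r
    using N[OF that] pos by (simp add: c_def frac_le)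
  have "c s \<le> 0 + \<epsilon>" if \<epsilon>: "\<epsilon> > 0" for \<epsilon>
  proof -
    \<comment> \<open>\<open>R >= 2 * |s| + 1\<close> keeps \<open>s\<close> in the inner half of
      the disc, where the weight is at least 1/4; this is matched by the
      \<open>\<epsilon> / 4\<close>.\<close>
    obtain R where R: "R \<ge> 2 * \<bar>s\<bar> + 1" "R > 0" "\<And>r. r \<in> Delta_zeros q h b \<Longrightarrow> \<bar>r\<bar> \<noteq> R"
      and B: "\<And>\<mu>. norm \<mu> = R \<Longrightarrow> norm (Weyl_diff \<mu> * edge_weight R \<mu>) \<le> \<epsilon> / 4 / R"
      using Weyl_diff_good_radius[of "\<epsilon> / 4" "2 * \<bar>s\<bar> + 1"] \<epsilon> by (metis divide_pos_pos zero_less_numeral)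
    have Rp: "2 * \<bar>s\<bar> \<le> R" "\<bar>s\<bar> < R" using R(1) by auto
    let ?Z = "{r \<in> Delta_zeros q h b. \<bar>r\<bar> < R}"
    have finZ: "finite ?Z" by (rule finite_subset[OF _ finite_Delta_zeros[OF q, of h b R]]) auto
    define t where "t r = (1 - (r / R)\<^sup>2) ^ 3" for r :: real
    have t: "edge_weight R (of_real r) = of_real (t r)" "\<bar>r\<bar> \<le> R \<Longrightarrow> 0 \<le> t r" "2 * \<bar>r\<bar> \<le> R \<Longrightarrow> t r \<ge> 1/4" for r :: real
      unfolding t_def edge_weight_of_real using edge_weight_of_real_bounds[OF R(2)] by simp_all
    have "norm (\<Sum>p\<in>complex_of_real ` ?Z \<union> {}. residue (\<lambda>\<mu>. Weyl_diff \<mu> * edge_weight R \<mu>) p) \<le> (\<epsilon> / 4 / R) * R"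
      by (rule Weyl_diff_residue_sum_bound[OF Z R(2,3) _ _ edge_weight_holomorphic B]) simp_all
    also have "(\<Sum>p\<in>complex_of_real ` ?Z \<union> {}. residue (\<lambda>\<mu>. Weyl_diff \<mu> * edge_weight R \<mu>) p)
        = (\<Sum>r\<in>?Z. residue (\<lambda>\<mu>. Weyl_diff \<mu> * edge_weight R \<mu>) (of_real r))"
      by (simp add: sum.reindex inj_on_def)
    also have "\<dots> = (\<Sum>r\<in>?Z. of_real (- (c r * t r)))"
    proof (rule sum.cong)
      fix r assume r: "r \<in> ?Z"
      thus "residue (\<lambda>\<mu>. Weyl_diff \<mu> * edge_weight R \<mu>) (of_real r) = of_real (- (c r * t r))"
        using Weyl_diff_residue[OF Z _ edge_weight_holomorphic[of R UNIV], of r] t(1)[of r]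
        by (simp add: c_def algebra_simps)
    qed simp
    also have "\<dots> = of_real (- (\<Sum>r\<in>?Z. c r * t r))" by (simp add: sum_negf)
    finally have "(\<Sum>r\<in>?Z. c r * t r) \<le> \<epsilon> / 4" using R(2) by (simp del: of_real_minus of_real_sum)
    moreover have "c s * t s \<le> (\<Sum>r\<in>?Z. c r * t r)"
      by (rule member_le_sum) (use s Rp(2) finZ c0 t(2) in auto)
    moreover have "c s * (1/4) \<le> c s * t s" using t(3)[OF Rp(1)] c0[OF s] by (intro mult_left_mono)
    ultimately show ?thesis by simp
  qed
  hence "c s \<le> 0" by (rule field_le_epsilon)
  hence "c s = 0" using c0[OF s] by simp
  thus ?thesis using pos by (simp add: c_def)
qed

text \<open>With equal norming constants the residues at the eigenvalues vanish. Inserting the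
  Cauchy kernel at \<open>z\<close> leaves only the residue
  \<open>Weyl_diff z * edge_weight R z\<close>, which the contour estimate makes small. On the
  circle \<open>norm (\<mu> - z) >= 1\<close>, so the kernel does not spoil the bound.\<close>

lemma Weyl_eq:
  assumes Z: "Delta_zeros q h b = Delta_zeros q0 h b0"
    and N: "\<And>r. r \<in> Delta_zeros q h b \<Longrightarrow> phi_norm q h (of_real r) pi = phi_norm q0 h (of_real r) pi"
    and z: "z \<notin> complex_of_real ` Delta_zeros q h b"
  shows "Weyl q h b z = Weyl q0 h b0 z"
proof -
  have "norm (Weyl_diff z) \<le> 0 + \<epsilon>" if \<epsilon>: "\<epsilon> > 0" for \<epsilon>
  proof -
    obtain R where R: "R \<ge> 2 * norm z + 1" "R > 0" "\<And>r. r \<in> Delta_zeros q h b \<Longrightarrow> \<bar>r\<bar> \<noteq> R"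
      and B: "\<And>\<mu>. norm \<mu> = R \<Longrightarrow> norm (Weyl_diff \<mu> * edge_weight R \<mu>) \<le> \<epsilon> / 4 / R"
      using Weyl_diff_good_radius[of "\<epsilon> / 4" "2 * norm z + 1"] \<epsilon> by (metis divide_pos_pos zero_less_numeral)
    have Rp: "2 * norm z \<le> R" "norm z < R" "R \<ge> norm z + 1" using R(1) norm_ge_zero[of z] by linarith+
    let ?Z = "{r \<in> Delta_zeros q h b. \<bar>r\<bar> < R}"
    let ?g = "\<lambda>\<mu>. edge_weight R \<mu> / (\<mu> - z)"
    have finZ: "finite ?Z" by (rule finite_subset[OF _ finite_Delta_zeros[OF q, of h b R]]) auto
    have g: "?g holomorphic_on - {z}" by (intro holomorphic_intros edge_weight_holomorphic) auto
    have "norm (\<Sum>p\<in>complex_of_real ` ?Z \<union> {z}. residue (\<lambda>\<mu>. Weyl_diff \<mu> * ?g \<mu>) p) \<le> (\<epsilon> / 4 / R) * R"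
    proof (rule Weyl_diff_residue_sum_bound[OF Z R(2,3) _ _ g])
      fix \<mu> :: complex assume \<mu>: "norm \<mu> = R"
      have "norm (\<mu> - z) \<ge> 1" using norm_triangle_ineq2[of \<mu> z] \<mu> Rp(3) by linarith
      hence "norm (Weyl_diff \<mu> * edge_weight R \<mu>) / norm (\<mu> - z) \<le> norm (Weyl_diff \<mu> * edge_weight R \<mu>) / 1"
        by (intro divide_left_mono) auto
      thus "norm (Weyl_diff \<mu> * ?g \<mu>) \<le> \<epsilon> / 4 / R" using B[OF \<mu>] by (simp add: norm_mult norm_divide)
    qed (use Rp in auto)
    also have "(\<Sum>p\<in>complex_of_real ` ?Z \<union> {z}. residue (\<lambda>\<mu>. Weyl_diff \<mu> * ?g \<mu>) p)
        = (\<Sum>p\<in>complex_of_real ` ?Z. residue (\<lambda>\<mu>. Weyl_diff \<mu> * ?g \<mu>) p) + residue (\<lambda>\<mu>. Weyl_diff \<mu> * ?g \<mu>) z"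
      using finZ z by (subst sum.union_disjoint) auto
    also have "(\<Sum>p\<in>complex_of_real ` ?Z. residue (\<lambda>\<mu>. Weyl_diff \<mu> * ?g \<mu>) p) = 0"
    proof (rule sum.neutral, intro ballI)
      fix p assume "p \<in> complex_of_real ` ?Z"
      then obtain r where r: "r \<in> Delta_zeros q h b" "p = of_real r" by auto
      hence "of_real r \<in> - {z}" using z by auto
      from Weyl_diff_residue[OF Z r(1) g _ this] N[OF r(1)] r(2)
      show "residue (\<lambda>\<mu>. Weyl_diff \<mu> * ?g \<mu>) p = 0" by (simp add: open_Compl)
    qed
    also have "residue (\<lambda>\<mu>. Weyl_diff \<mu> * ?g \<mu>) z = Weyl_diff z * edge_weight R z"
    proof -
      define S where "S = ball 0 R - complex_of_real ` ?Z"
      have S: "open S" "z \<in> S" using finZ z Rp(2) by (auto simp: S_def intro!: open_Diff finite_imp_closed)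
      have sub: "S \<subseteq> - complex_of_real ` Delta_zeros q h b" by (auto simp: S_def)
      have "Weyl q h b holomorphic_on S" "Weyl q0 h b0 holomorphic_on S"
        using holomorphic_on_subset[OF Weyl_holomorphic[OF q] sub]
          holomorphic_on_subset[OF Weyl_holomorphic[OF q0] sub[unfolded Z]] by auto
      hence "(\<lambda>\<mu>. Weyl_diff \<mu> * edge_weight R \<mu>) holomorphic_on S"
        unfolding Weyl_diff_def by (intro holomorphic_intros edge_weight_holomorphic)
      from residue_simple[OF S this] show ?thesis by simp
    qed
    finally have "norm (Weyl_diff z) * norm (edge_weight R z) \<le> \<epsilon> / 4" using R(2) by (simp add: norm_mult)
    moreover have "norm (Weyl_diff z) * (1/4) \<le> norm (Weyl_diff z) * norm (edge_weight R z)"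
      by (intro mult_left_mono edge_weight_lower Rp R) auto
    ultimately show ?thesis by simp
  qed
  hence "norm (Weyl_diff z) \<le> 0" by (rule field_le_epsilon)
  thus ?thesis by (simp add: Weyl_diff_def)
qed

end

section \<open>From equal Weyl functions to equal potentials and boundary conditions\<close>

lemma theta_eq_Weyl:
  assumes "Delta q h b \<mu> \<noteq> 0"
  shows "theta q \<mu> x = - Weyl q h b \<mu> * phi q h \<mu> x - chi q h b \<mu> x / Delta q h b \<mu>"
  using assms by (simp add: Weyl_def chi_def field_simps)

text \<open>Substituting \<open>theta = - Weyl * phi - chi / Delta\<close> cancels the terms with
  the Weyl functions and leaves products of \<open>chi\<close> and \<open>phi\<close> divided by
  \<open>Delta\<close>, which are of order \<open>1 / norm k\<close> for large \<open>Im k\<close>.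
  Near the positive axis \<open>Delta\<close> may vanish, but there the original expression is
  already of that order, since \<open>theta\<close> carries a factor \<open>1 / norm k\<close>. So
  \<open>P\<close> tends to 0 in every direction and Liouville applies.\<close>

lemma phi_theta_cross_eq:
  assumes q: "L1_potential q" and q0: "L1_potential q0"
    and Z: "Delta_zeros q h b = Delta_zeros q0 h b0"
    and W: "\<And>z. z \<notin> complex_of_real ` Delta_zeros q h b \<Longrightarrow> Weyl q h b z = Weyl q0 h b0 z"
    and x: "x \<in> {0..pi}"
  shows "phi q h \<mu> x * theta q0 \<mu> x = theta q \<mu> x * phi q0 h \<mu> x"
proof -
  define P where "P \<mu> = phi q h \<mu> x * theta q0 \<mu> x - theta q \<mu> x * phi q0 h \<mu> x" for \<mu>
  have hol: "P holomorphic_on UNIV"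
    unfolding P_def by (intro holomorphic_intros phi_theta_holomorphic q q0 x)
  obtain C where "fund_bound q h b C" using fund_bounds[OF q] by blast
  note C = fund_boundD[OF this]
  obtain C0 where "fund_bound q0 h b0 C0" using fund_bounds[OF q0] by blast
  note C0 = fund_boundD[OF this]
  obtain K1 where K1: "K1 \<ge> 1" "\<And>k. Im k \<ge> K1 \<Longrightarrow> norm (Delta q h b (k\<^sup>2)) \<ge> norm k * exp (pi * Im k) / 8"
    using Delta_lower_bound[OF q] by metis
  obtain K0 where K0: "K0 \<ge> 1" "\<And>k. Im k \<ge> K0 \<Longrightarrow> norm (Delta q0 h b0 (k\<^sup>2)) \<ge> norm k * exp (pi * Im k) / 8"
    using Delta_lower_bound[OF q0] by metis
  define K where "K = max K1 K0"
  \<comment> \<open>Two quotients with a factor 8 each from the lower bounds for the characteristic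
    functions, plus the two products in the strip, where each growth factor is at most
    \<open>exp (K * pi)\<close>.\<close>
  define B where "B = 16 * C * C0 + 2 * C * C0 * exp (2 * (K * pi))"
  have bound: "norm k * norm (P (k\<^sup>2)) \<le> B" if k: "norm k \<ge> 1" "Im k \<ge> 0" for k
  proof (cases "Im k \<ge> K")
    case True
    let ?y = "phi q h (k\<^sup>2) x" and ?z = "phi q0 h (k\<^sup>2) x"
      and ?c = "chi q h b (k\<^sup>2) x" and ?d = "chi q0 h b0 (k\<^sup>2) x" and ?D = "Delta q h b (k\<^sup>2)" and ?Dz = "Delta q0 h b0 (k\<^sup>2)"
    define \<tau> where "\<tau> = Im k"
    have \<tau>: "\<tau> \<ge> K1" "\<tau> \<ge> K0" using True by (auto simp: K_def \<tau>_def)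
    define L where "L = norm k * exp (pi * \<tau>) / 8"
    have L0: "L > 0" using k by (auto simp: L_def intro!: mult_pos_pos)
    have DL: "norm (?D) \<ge> L" "norm (?Dz) \<ge> L" using K1(2)[of k] K0(2)[of k] \<tau> by (auto simp: L_def \<tau>_def)
    have nz: "?D \<noteq> 0" "?Dz \<noteq> 0" using DL L0 by auto
    have "Weyl q h b (k\<^sup>2) = Weyl q0 h b0 (k\<^sup>2)" using nz(1) by (intro W) (simp add: Delta_zero_iff[OF q])
    hence Peq: "P (k\<^sup>2) = ?c * ?z / ?D - ?y * ?d / ?Dz"
      unfolding P_def theta_eq_Weyl[OF nz(1)] theta_eq_Weyl[OF nz(2)] by (simp add: algebra_simps)
    have e: "growth k (pi - x) * growth k x = exp (pi * \<tau>)"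
      using k(2) by (simp add: \<tau>_def exp_add[symmetric] algebra_simps)
    have "norm (?c) * norm (?z) \<le> (C * growth k (pi - x)) * (C0 * growth k x)"
      using C(1) by (intro mult_mono C(5)[OF k(1) x] C0(2)[OF k(1) x]) auto
    also have "\<dots> = C * C0 * (growth k (pi - x) * growth k x)" by simp
    finally have 1: "norm (?c) * norm (?z) \<le> C * C0 * exp (pi * \<tau>)" unfolding e .
    have "norm (?y) * norm (?d) \<le> (C * growth k x) * (C0 * growth k (pi - x))"
      using C(1) by (intro mult_mono C(2)[OF k(1) x] C0(5)[OF k(1) x]) auto
    also have "\<dots> = C * C0 * (growth k (pi - x) * growth k x)" by simp
    finally have 2: "norm (?y) * norm (?d) \<le> C * C0 * exp (pi * \<tau>)" unfolding e .
    have "norm (P (k\<^sup>2)) \<le> norm (?c) * norm (?z) / norm (?D)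
        + norm (?y) * norm (?d) / norm (?Dz)"
      unfolding Peq by (rule order_trans[OF norm_triangle_ineq4]) (simp add: norm_mult norm_divide)
    also have "\<dots> \<le> C * C0 * exp (pi * \<tau>) / L + C * C0 * exp (pi * \<tau>) / L"
      using L0 DL 1 2 C(1) C0(1) by (intro add_mono frac_le) auto
    finally have "norm k * norm (P (k\<^sup>2)) \<le> norm k * (C * C0 * exp (pi * \<tau>) / L + C * C0 * exp (pi * \<tau>) / L)"
      by (intro mult_left_mono) auto
    also have "\<dots> = 16 * C * C0" using k(1) unfolding L_def by (auto simp: field_simps)
    also have "\<dots> \<le> B" using C(1) C0(1) by (simp add: B_def)
    finally show ?thesis .
  next
    case False
    let ?y = "phi q h (k\<^sup>2) x" and ?z = "phi q0 h (k\<^sup>2) x"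
      and ?v = "theta q (k\<^sup>2) x" and ?w = "theta q0 (k\<^sup>2) x"
    have e: "growth k x * growth k x \<le> exp (2 * (K * pi))"
    proof -
      have "Im k * x \<le> K * pi" using False k(2) x by (intro mult_mono) auto
      moreover have "\<bar>Im k\<bar> = Im k" using k(2) by simp
      ultimately show ?thesis unfolding exp_add[symmetric] exp_le_cancel_iff by linarith
    qed
    have "norm (?y) * (norm k * norm (?w)) \<le> (C * growth k x) * (C0 * growth k x)"
      using C(1) by (intro mult_mono C(2)[OF k(1) x] C0(4)[OF k(1) x]) auto
    moreover have "(norm k * norm (?v)) * norm (?z) \<le> (C * growth k x) * (C0 * growth k x)"
      using C(1) by (intro mult_mono C(4)[OF k(1) x] C0(2)[OF k(1) x]) auto
    moreover have "(C * growth k x) * (C0 * growth k x) \<le> C * C0 * exp (2 * (K * pi))"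
      using mult_left_mono[OF e, of "C * C0"] C(1) C0(1) by (simp add: mult_ac)
    moreover have "norm k * norm (P (k\<^sup>2)) \<le> norm k * (norm (?y * ?w) + norm (?v * ?z))"
      unfolding P_def by (intro mult_left_mono norm_triangle_ineq4) auto
    moreover have "\<dots> = norm (?y) * (norm k * norm (?w)) + (norm k * norm (?v)) * norm (?z)"
      by (simp add: norm_mult algebra_simps)
    moreover have "C * C0 \<ge> 0" using C(1) C0(1) by simp
    ultimately show ?thesis unfolding B_def by linarith
  qed
  have "(P \<longlongrightarrow> 0) at_infinity"
    unfolding Lim_at_infinity
  proof (intro allI impI)
    fix e :: real assume e: "e > 0"
    define A where "A = max 1 (B / e + 1)"
    have "dist (P \<mu>) 0 < e" if \<mu>: "norm \<mu> \<ge> A\<^sup>2" for \<mu>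
    proof -
      obtain k where k: "k\<^sup>2 = \<mu>" "Im k \<ge> 0" using complex_square_root_upper by blast
      have "(norm k)\<^sup>2 \<ge> A\<^sup>2" using \<mu> k(1) by (metis norm_power)
      hence kA: "norm k \<ge> A" by (rule power2_le_imp_le) simp
      hence k1: "norm k \<ge> 1" by (simp add: A_def)
      have "B / e < norm k" using kA by (simp add: A_def)
      hence "B < norm k * e" using e by (simp add: field_simps)
      hence "norm k * norm (P \<mu>) < norm k * e" using bound[OF k1 k(2)] k(1) by simp
      thus ?thesis using k1 by (simp add: mult_less_cancel_left)
    qed
    thus "\<exists>b. \<forall>\<mu>. b \<le> norm \<mu> \<longrightarrow> dist (P \<mu>) 0 < e" by blast
  qed
  hence "P \<mu> = 0" by (rule Liouville_weak_0[OF hol])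
  thus ?thesis by (simp add: P_def)
qed

lemma vector_derivative_eq_on_interval:
  fixes f g :: "real \<Rightarrow> 'a::real_normed_vector"
  assumes "(f has_vector_derivative f') (at x)" "(g has_vector_derivative g') (at x)"
    and x: "x \<in> {s<..<t}" and "\<And>u. u \<in> {s<..<t} \<Longrightarrow> f u = g u"
  shows "f' = g'"
proof -
  have "(f has_vector_derivative g') (at x)"
    by (rule has_vector_derivative_transform_within_open[OF assms(2) _ x]) (use assms(4) in auto)
  thus ?thesis using assms(1) vector_derivative_unique_at by blast
qed

text \<open>Differentiating \<open>phi theta0 = theta phi0\<close> gives \<open>phi\<^sup>2 = phi0\<^sup>2\<close>; differentiating this shows that
  the Wronskian of \<open>phi\<close> and \<open>phi0\<close> vanishes, and its derivative is \<open>(q0 - q) phi phi0\<close>.\<close>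

lemma potentials_eq:
  assumes q: "L1_potential q" and q0: "L1_potential q0"
    and cross: "\<And>x. x \<in> {0..pi} \<Longrightarrow> phi q h \<mu> x * theta q0 \<mu> x = theta q \<mu> x * phi q0 h \<mu> x"
    and \<mu>: "Im \<mu> \<noteq> 0"
  shows "AE x\<in>{0<..<pi} in lebesgue. q x = q0 x"
proof -
  define y y' w w' where "y = phi q h \<mu>" and "y' = phi' q h \<mu>" and "w = theta q \<mu>" and "w' = theta' q \<mu>"
  define z z' v v' where "z = phi q0 h \<mu>" and "z' = phi' q0 h \<mu>" and "v = theta q0 \<mu>" and "v' = theta' q0 \<mu>"
  have sol: "SL_solution q \<mu> y y'" "SL_solution q \<mu> w w'" "SL_solution q0 \<mu> z z'" "SL_solution q0 \<mu> v v'"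
    unfolding y_def y'_def w_def w'_def z_def z'_def v_def v'_def
    by (rule phi_solution[OF q] theta_solution[OF q] phi_solution[OF q0] theta_solution[OF q0])+
  note d = SL_solution_derivative[OF sol(1)] SL_solution_derivative[OF sol(2)]
    SL_solution_derivative[OF sol(3)] SL_solution_derivative[OF sol(4)]
  have nz: "y x \<noteq> 0" "z x \<noteq> 0" if "x \<in> {0..pi}" for x
    unfolding y_def z_def using phi_nonzero[OF q \<mu> that] phi_nonzero[OF q0 \<mu> that] by auto
  have W: "y x * w' x - y' x * w x = 1" "z x * v' x - z' x * v x = 1" if "x \<in> {0..pi}" for x
    unfolding y_def y'_def w_def w'_def z_def z'_def v_def v'_def
    using phi_theta_wronskian[OF q that] phi_theta_wronskian[OF q0 that] by auto
  have cr: "y x * v x = w x * z x" if "x \<in> {0<..<pi}" for x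
    using cross[of x] that by (simp add: y_def v_def w_def z_def)
  have sq: "y x * y x = z x * z x" if x: "x \<in> {0<..<pi}" for x
  proof -
    have 1: "y x * v' x + y' x * v x = w x * z' x + w' x * z x"
      by (rule vector_derivative_eq_on_interval[OF has_vector_derivative_mult[OF d(1)[OF x] d(4)[OF x]]
          has_vector_derivative_mult[OF d(2)[OF x] d(3)[OF x]] x cr])
    have xx: "x \<in> {0..pi}" using x by simp
    \<comment> \<open>Both Wronskians equal 1 and are inserted as factors. By \<open>cr\<close> the
      extra terms combine into \<open>y x * z x\<close> times the difference of the two sides of the
      differentiated relation.\<close>
    have "y x * y x - z x * z x = y x * y x * (z x * v' x - z' x * v x) - z x * z x * (y x * w' x - y' x * w x)"
      unfolding W[OF xx] by simp
    also have "\<dots> = y x * z x * (y x * v' x - z x * w' x) - y x * z' x * (y x * v x) + z x * y' x * (w x * z x)"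
      by (simp add: algebra_simps)
    also have "\<dots> = y x * z x * (y x * v' x - z x * w' x) - y x * z' x * (w x * z x) + z x * y' x * (y x * v x)"
      unfolding cr[OF x] ..
    also have "\<dots> = y x * z x * ((y x * v' x + y' x * v x) - (w x * z' x + w' x * z x))"
      by (simp add: algebra_simps)
    also have "\<dots> = 0" unfolding 1 by simp
    finally show ?thesis by simp
  qed
  have W0: "y x * z' x - y' x * z x = 0" if x: "x \<in> {0<..<pi}" for x
  proof -
    have 1: "y x * y' x + y' x * y x = z x * z' x + z' x * z x"
      by (rule vector_derivative_eq_on_interval[OF has_vector_derivative_mult[OF d(1)[OF x] d(1)[OF x]]
          has_vector_derivative_mult[OF d(3)[OF x] d(3)[OF x]] x sq])
    have "2 * (z x * (y x * z' x - y' x * z x)) = y x * (z x * z' x + z' x * z x) - 2 * y' x * (z x * z x)"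
      by (simp add: algebra_simps)
    also have "\<dots> = y x * (y x * y' x + y' x * y x) - 2 * y' x * (y x * y x)"
      unfolding 1[symmetric] sq[OF x, symmetric] ..
    also have "\<dots> = 0" by (simp add: algebra_simps)
    finally have "2 * (z x * (y x * z' x - y' x * z x)) = 0" .
    thus ?thesis using nz(2)[of x] x by simp
  qed
  have "AE x\<in>{0<..<pi} in lebesgue. ((\<lambda>x. y x * z' x - y' x * z x) has_vector_derivative
      (((of_real (q0 x) - \<mu>) - (of_real (q x) - \<mu>)) * (y x * z x))) (at x)"
    using SL_lagrange[OF sol(1) sol(3)] by (simp add: ac_derivative_def)
  thus ?thesis
  proof eventually_elim
    case (elim x)
    show ?case
    proof
      assume x: "x \<in> {0<..<pi}"
      have "((of_real (q0 x) - \<mu>) - (of_real (q x) - \<mu>)) * (y x * z x) = 0"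
        by (rule vector_derivative_eq_on_interval[OF elim[rule_format, OF x] has_vector_derivative_const x W0])
      hence "complex_of_real (q0 x) = of_real (q x)" using nz[of x] x by simp
      thus "q x = q0 x" by simp
    qed
  qed
qed

text \<open>In the Lagrange identity of the two \<open>chi\<close> the integrand now vanishes almost
  everywhere, and equal Weyl values at \<mu> remove the boundary term at 0. What is left is
  \<open>b - b0 = 0\<close>.\<close>

lemma boundary_values_eq:
  assumes q: "L1_potential q" and q0: "L1_potential q0"
    and eq: "AE x\<in>{0<..<pi} in lebesgue. q x = q0 x"
    and W: "Weyl q h b \<mu> = Weyl q0 h b0 \<mu>" and \<mu>: "Im \<mu> \<noteq> 0"
  shows "b = b0"
proof -
  obtain N where N: "negligible N" "\<And>x. x \<notin> N \<Longrightarrow> x \<in> {0<..<pi} \<longrightarrow> q x = q0 x"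
    using AE_lebesgue_negligibleE[OF eq] by blast
  let ?y = "chi q h b \<mu>" and ?z = "chi q0 h b0 \<mu>"
  have "((\<lambda>x. ((of_real (q0 x) - \<mu>) - (of_real (q x) - \<mu>)) * (?y x * ?z x)) has_integral
     ((of_real b - of_real b0) - (Delta q h b \<mu> * Eta q0 b0 \<mu> - Eta q b \<mu> * Delta q0 h b0 \<mu>))) {0..pi}"
    using SL_lagrange_integral[OF chi_solution[OF q, of \<mu> h b] chi_solution[OF q0, of \<mu> h b0], of pi]
    by (simp add: chi_0[OF q] chi_0[OF q0] chi_pi[OF q] chi_pi[OF q0] algebra_simps)
  hence "((\<lambda>x. 0) has_integral
     ((of_real b - of_real b0) - (Delta q h b \<mu> * Eta q0 b0 \<mu> - Eta q b \<mu> * Delta q0 h b0 \<mu>))) {0..pi}"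
    by (rule has_integral_spike[of "N \<union> {0, pi}", rotated 2]) (use N in auto)
  hence "(of_real b - of_real b0) - (Delta q h b \<mu> * Eta q0 b0 \<mu> - Eta q b \<mu> * Delta q0 h b0 \<mu>) = 0"
    by (rule has_integral_unique[OF _ has_integral_0])
  moreover have "Delta q h b \<mu> * Eta q0 b0 \<mu> = Eta q b \<mu> * Delta q0 h b0 \<mu>"
    using W Delta_nonzero[OF q \<mu>, of h b] Delta_nonzero[OF q0 \<mu>, of h b0]
    unfolding Weyl_def by (simp add: frac_eq_eq)
  ultimately have "complex_of_real b = of_real b0" by simp
  thus ?thesis by simp
qed

lemma cot_inj_on_0_pi:
  assumes "x \<in> {0<..<pi}" "y \<in> {0<..<pi}" "cot x = cot y"
  shows "x = y"
proof -
  have "sin x > 0" "sin y > 0" using assms by (auto intro: sin_gt_zero)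
  hence "cos x * sin y = cos y * sin x" using assms(3) by (simp add: cot_def frac_eq_eq)
  hence "sin (x - y) = 0" by (simp add: sin_diff mult.commute)
  moreover have "- pi < x - y" "x - y < pi" using assms(1,2) by auto
  ultimately have "x - y = 0" using sin_eq_0_pi by blast
  thus ?thesis by simp
qed

theorem theorem1p2:
  fixes q q0 :: "real \<Rightarrow> real" and \<alpha>0 \<beta> \<beta>0 :: real
  assumes "L1_potential q" and "L1_potential q0"
    and "\<alpha>0 \<in> {0<..<pi}" and "\<beta> \<in> {0<..<pi}" and "\<beta>0 \<in> {0<..<pi}"
    and "L2_derivative q"
    and "\<And>n. SL_eigenvalue q \<alpha>0 \<beta> n = SL_eigenvalue q0 \<alpha>0 \<beta>0 n"
    and "\<And>n. SL_norming q \<alpha>0 \<beta> n \<ge> SL_norming q0 \<alpha>0 \<beta>0 n"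
  shows "\<beta> = \<beta>0 \<and> (AE x in lebesgue. x \<in> {0<..<pi} \<longrightarrow> q x = q0 x)"
proof -
  note q = assms(1) and q0 = assms(2)
  let ?h = "cot \<alpha>0" and ?b = "cot \<beta>" and ?c = "cot \<beta>0"
  have eig: "SL_eigenvalue q \<alpha>0 \<beta> = SL_eigenvalue q0 \<alpha>0 \<beta>0" using assms(7) by (rule ext)
  have Z: "Delta_zeros q ?h ?b = Delta_zeros q0 ?h ?c"
    using SL_eigenvalue_enumerates(2)[OF q, of \<alpha>0 \<beta>] SL_eigenvalue_enumerates(2)[OF q0, of \<alpha>0 \<beta>0] eig by simp
  have N: "phi_norm q0 ?h (of_real r) pi \<le> phi_norm q ?h (of_real r) pi" if "r \<in> Delta_zeros q ?h ?b" for r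
  proof -
    obtain n where "r = SL_eigenvalue q \<alpha>0 \<beta> n"
      using SL_eigenvalue_enumerates(2)[OF q, of \<alpha>0 \<beta>] \<open>r \<in> Delta_zeros q ?h ?b\<close> by blast
    thus ?thesis
      using assms(8)[of n] eig by (simp add: SL_norming_eq[OF q] SL_norming_eq[OF q0])
  qed
  have W: "Weyl q ?h ?b z = Weyl q0 ?h ?c z" if "z \<notin> complex_of_real ` Delta_zeros q ?h ?b" for z
    by (rule Weyl_eq[OF q q0 Z norming_constants_eq[OF q q0 Z N] that])
  \<comment> \<open>A single nonreal point is enough: there neither \<open>phi\<close> vanishes on
    \<open>[0, pi]\<close> and both characteristic functions are nonzero.\<close>
  have cross: "phi q ?h \<i> x * theta q0 \<i> x = theta q \<i> x * phi q0 ?h \<i> x" if "x \<in> {0..pi}" for x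
    by (rule phi_theta_cross_eq[OF q q0 Z W that])
  have ae: "AE x\<in>{0<..<pi} in lebesgue. q x = q0 x"
    by (rule potentials_eq[OF q q0 cross]) simp_all
  have "\<i> \<notin> complex_of_real ` Delta_zeros q ?h ?b" by (auto simp: complex_eq_iff)
  from boundary_values_eq[OF q q0 ae W[OF this]] have "?b = ?c" by simp
  thus ?thesis using ae cot_inj_on_0_pi[OF assms(4,5)] by simp
qed

end
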